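(* Let $E$ be a unital commutative Fréchet ${}^*$-algebra which is isomorphic as a Fréchet space to a nuclear power series space $\Lambda_\infty(\alpha)$ of infinite type. Then the following statements are equivalent. (i) $E$ is isomorphic as a Fréchet ${}^*$-algebra to a complemented ${}^*$-subalgebra of $\mathscr{L}^*(s)$. (ii) $E$ is isomorphic as a Fréchet ${}^*$-algebra to a closed ${}^*$-subalgebra of $\mathscr{L}^*(s)$. (iii) $E$ is a DN-algebra, i.e. there is a dominating Hilbert norm $\|\cdot\|=\sqrt{(\cdot,\cdot)}$ on $E$ such that $(xy,z)=(y,x^*z)$ for all $x,y,z\in E$.
   Context: All spaces are over $\mathbb{C}$. A topological ${}^*$-algebra is a topological vector space that is a ${}^*$-algebra with separately continuous multiplication and continuous involution; a Fréchet ${}^*$-algebra is a topological ${}^*$-algebra whose underlying space is a Fréchet space (metrizable, complete, locally convex; local $m$-convexity is not required). An isomorphism of Fréchet (topological) ${}^*$-algebras is a ${}^*$-algebra isomorphism that is a homeomorphism; a subalgebra carries the subspace topology. Power series spaces: for a monotonically increasing sequence $\alpha=(\alpha_j)_{j\in\mathbb{N}}\subset(0,\infty)$ with $\alpha_j\to\infty$, $\Lambda_\infty(\alpha)=\{(\xi_j)\in\mathbb{C}^{\mathbb{N}}:|\xi|_{\alpha,q}^2=\sum_j|\xi_j|^2e^{2q\alpha_j}<\infty\text{ for all }q\in\mathbb{N}_0\}$, with the Fréchet topology given by the norms $|\cdot|_{\alpha,q}$. It is nuclear if and only if $\sup_j \frac{\log j}{\alpha_j}<\infty$. Dominating norm: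 let $E$ be a Fréchet space with an (increasing) fundamental system of seminorms $(\|\cdot\|_q)_{q\in\mathbb{N}_0}$. A continuous norm $\|\cdot\|$ on $E$ is dominating if for every $q$ there are $r\in\mathbb{N}_0$ and $C>0$ with $\|x\|_q^2\le C\|x\|\,\|x\|_r$ for all $x\in E$. It is a dominating Hilbert norm if moreover $\|\cdot\|=\sqrt{(\cdot,\cdot)}$ for a scalar product $(\cdot,\cdot)$ on $E$. The algebra $\mathscr{L}^*(s)$: $s=\{\xi\in\mathbb{C}^{\mathbb{N}}:|\xi|_q^2=\sum_j|\xi_j|^2j^{2q}<\infty\text{ for all }q\in\mathbb{N}_0\}$ with the Fréchet topology given by the norms $|\cdot|_q$; it is a dense subspace of $\ell_2$. $\mathscr{L}^*(s)$ is the set of all linear maps $x\colon s\to s$ such that, regarding $x$ as an unbounded operator in $\ell_2$ with domain $s$, its Hilbert space adjoint $x^*$ satisfies $s\subset\mathscr{D}(x^* )$ and $x^*(s)\subset s$. It is a ${}^*$-algebra under composition with involution $x\mapsto x^*|_s$ (again written $x^*$). Its topology $\tau^*$ is the locally convex topology given by the seminorms $p_{N,B}(x)=\max\{\sup_{\xi\in B}|x\xi|_N,\sup_{\xi\in B}|x^*\xi|_N\}$, where $N\in\mathbb{N}_0$ and $B$ runs over the bounded subsets of $s$. A ${}^*$-subalgebra of $\mathscr{L}^*(s)$ is complemented if it is the range of a continuous linear projection on $\mathscr{L}^*(s)$. *)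

theory Defs
  imports "HOL-Analysis.Analysis" "HOL-Algebra.Module"
begin

section \<open>Topological vector spaces and topological star-algebras over the complex numbers\<close>

definition complex_field :: "complex ring" where
  "complex_field =
     \<lparr>carrier = UNIV, monoid.mult = (*), one = 1, ring.zero = 0, add = (+)\<rparr>"

text \<open>As for every module record of HOL-Algebra, the ring fields \<open>mult\<close> and \<open>one\<close> are
  present but play no role when only the vector space structure is considered.\<close>

record 'a tvs = "(complex, 'a) module" +
  topol :: "'a topology"

record 'a star_tvs = "'a tvs" +
  star :: "'a \<Rightarrow> 'a"

locale topological_vector_space = Module.module complex_field V
  for V :: "('a, 'm) tvs_scheme" (structure) +
  assumes topspace_eq: "topspace (topol V) = carrier V"
    and continuous_add:
      "continuous_map (prod_topology (topol V) (topol V)) (topol V) (\<lambda>(x, y). x \<oplus> y)"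
    and continuous_smult:
      "continuous_map (prod_topology euclidean (topol V)) (topol V) (\<lambda>(c, x). c \<odot> x)"

definition convex_in :: "('a, 'm) tvs_scheme \<Rightarrow> 'a set \<Rightarrow> bool" where
  "convex_in V W \<longleftrightarrow> W \<subseteq> carrier V \<and>
     (\<forall>x\<in>W. \<forall>y\<in>W. \<forall>t::real. 0 \<le> t \<and> t \<le> 1 \<longrightarrow>
        complex_of_real t \<odot>\<^bsub>V\<^esub> x \<oplus>\<^bsub>V\<^esub> complex_of_real (1 - t) \<odot>\<^bsub>V\<^esub> y \<in> W)"

definition locally_convex :: "('a, 'm) tvs_scheme \<Rightarrow> bool" where
  "locally_convex V \<longleftrightarrow>
     (\<forall>U. openin (topol V) U \<and> \<zero>\<^bsub>V\<^esub> \<in> U \<longrightarrow>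
        (\<exists>W. openin (topol V) W \<and> convex_in V W \<and> \<zero>\<^bsub>V\<^esub> \<in> W \<and> W \<subseteq> U))"

definition tvs_Cauchy :: "('a, 'm) tvs_scheme \<Rightarrow> (nat \<Rightarrow> 'a) \<Rightarrow> bool" where
  "tvs_Cauchy V u \<longleftrightarrow> range u \<subseteq> carrier V \<and>
     (\<forall>U. openin (topol V) U \<and> \<zero>\<^bsub>V\<^esub> \<in> U \<longrightarrow>
        (\<exists>N. \<forall>m\<ge>N. \<forall>n\<ge>N. u m \<ominus>\<^bsub>V\<^esub> u n \<in> U))"

text \<open>Since the topology is metrizable, completeness of the canonical uniformity
  amounts to convergence of Cauchy sequences.\<close>

locale frechet_space = topological_vector_space V
  for V :: "('a, 'm) tvs_scheme" (structure) +
  assumes metrizable: "metrizable_space (topol V)"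
    and locally_convex: "locally_convex V"
    and complete: "tvs_Cauchy V u \<Longrightarrow> \<exists>l. limitin (topol V) u l sequentially"

text \<open>Algebras are associative but need not possess a unit.\<close>

locale star_algebra = Module.module complex_field A
  for A :: "('a, 'm) star_tvs_scheme" (structure) +
  assumes mult_closed: "\<lbrakk>x \<in> carrier A; y \<in> carrier A\<rbrakk> \<Longrightarrow> x \<otimes> y \<in> carrier A"
    and mult_assoc: "\<lbrakk>x \<in> carrier A; y \<in> carrier A; z \<in> carrier A\<rbrakk> \<Longrightarrow>
      (x \<otimes> y) \<otimes> z = x \<otimes> (y \<otimes> z)"
    and mult_l_distr: "\<lbrakk>x \<in> carrier A; y \<in> carrier A; z \<in> carrier A\<rbrakk> \<Longrightarrow>
      (x \<oplus> y) \<otimes> z = x \<otimes> z \<oplus> y \<otimes> z"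
    and mult_r_distr: "\<lbrakk>x \<in> carrier A; y \<in> carrier A; z \<in> carrier A\<rbrakk> \<Longrightarrow>
      z \<otimes> (x \<oplus> y) = z \<otimes> x \<oplus> z \<otimes> y"
    and smult_mult_l: "\<lbrakk>x \<in> carrier A; y \<in> carrier A\<rbrakk> \<Longrightarrow> (c \<odot> x) \<otimes> y = c \<odot> (x \<otimes> y)"
    and smult_mult_r: "\<lbrakk>x \<in> carrier A; y \<in> carrier A\<rbrakk> \<Longrightarrow> x \<otimes> (c \<odot> y) = c \<odot> (x \<otimes> y)"
    and star_closed: "x \<in> carrier A \<Longrightarrow> star A x \<in> carrier A"
    and star_star: "x \<in> carrier A \<Longrightarrow> star A (star A x) = x"
    and star_add: "\<lbrakk>x \<in> carrier A; y \<in> carrier A\<rbrakk> \<Longrightarrow> star A (x \<oplus> y) = star A x \<oplus> star A y"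
    and star_smult: "x \<in> carrier A \<Longrightarrow> star A (c \<odot> x) = cnj c \<odot> star A x"
    and star_mult: "\<lbrakk>x \<in> carrier A; y \<in> carrier A\<rbrakk> \<Longrightarrow> star A (x \<otimes> y) = star A y \<otimes> star A x"

locale topological_star_algebra = topological_vector_space A + star_algebra A
  for A :: "('a, 'm) star_tvs_scheme" (structure) +
  assumes continuous_mult_l: "a \<in> carrier A \<Longrightarrow> continuous_map (topol A) (topol A) (\<lambda>x. a \<otimes> x)"
    and continuous_mult_r: "a \<in> carrier A \<Longrightarrow> continuous_map (topol A) (topol A) (\<lambda>x. x \<otimes> a)"
    and continuous_star: "continuous_map (topol A) (topol A) (star A)"

locale frechet_star_algebra = topological_star_algebra A + frechet_space A
  for A :: "('a, 'm) star_tvs_scheme" (structure)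

locale unital_commutative_frechet_star_algebra = frechet_star_algebra A
  for A :: "('a, 'm) star_tvs_scheme" (structure) +
  assumes one_closed: "\<one> \<in> carrier A"
    and one_mult: "x \<in> carrier A \<Longrightarrow> \<one> \<otimes> x = x"
    and mult_commute: "\<lbrakk>x \<in> carrier A; y \<in> carrier A\<rbrakk> \<Longrightarrow> x \<otimes> y = y \<otimes> x"


section \<open>Linear maps, isomorphisms and subalgebras\<close>

definition clinear_map ::
  "('a, 'm) tvs_scheme \<Rightarrow> ('b, 'n) tvs_scheme \<Rightarrow> ('a \<Rightarrow> 'b) \<Rightarrow> bool" where
  "clinear_map V W f \<longleftrightarrow> f \<in> carrier V \<rightarrow> carrier W \<and>
     (\<forall>x\<in>carrier V. \<forall>y\<in>carrier V. f (x \<oplus>\<^bsub>V\<^esub> y) = f x \<oplus>\<^bsub>W\<^esub> f y) \<and>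
     (\<forall>c. \<forall>x\<in>carrier V. f (c \<odot>\<^bsub>V\<^esub> x) = c \<odot>\<^bsub>W\<^esub> f x)"

definition tvs_isomorphism ::
  "('a, 'm) tvs_scheme \<Rightarrow> ('b, 'n) tvs_scheme \<Rightarrow> ('a \<Rightarrow> 'b) \<Rightarrow> bool" where
  "tvs_isomorphism V W f \<longleftrightarrow> clinear_map V W f \<and> bij_betw f (carrier V) (carrier W) \<and>
     homeomorphic_map (topol V) (topol W) f"

definition tvs_isomorphic ::
  "('a, 'm) tvs_scheme \<Rightarrow> ('b, 'n) tvs_scheme \<Rightarrow> bool" where
  "tvs_isomorphic V W \<longleftrightarrow> (\<exists>f. tvs_isomorphism V W f)"

definition star_algebra_isomorphic ::
  "('a, 'm) star_tvs_scheme \<Rightarrow> ('b, 'n) star_tvs_scheme \<Rightarrow> bool" where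
  "star_algebra_isomorphic A B \<longleftrightarrow> (\<exists>f. tvs_isomorphism A B f \<and>
     (\<forall>x\<in>carrier A. \<forall>y\<in>carrier A. f (x \<otimes>\<^bsub>A\<^esub> y) = f x \<otimes>\<^bsub>B\<^esub> f y) \<and>
     (\<forall>x\<in>carrier A. f (star A x) = star B (f x)))"

text \<open>A star-subalgebra is not required to contain the unit of the ambient algebra.\<close>

definition star_subalgebra :: "'a set \<Rightarrow> ('a, 'm) star_tvs_scheme \<Rightarrow> bool" where
  "star_subalgebra S A \<longleftrightarrow> S \<subseteq> carrier A \<and> \<zero>\<^bsub>A\<^esub> \<in> S \<and>
     (\<forall>x\<in>S. \<forall>y\<in>S. x \<oplus>\<^bsub>A\<^esub> y \<in> S) \<and>
     (\<forall>c. \<forall>x\<in>S. c \<odot>\<^bsub>A\<^esub> x \<in> S) \<and>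
     (\<forall>x\<in>S. \<forall>y\<in>S. x \<otimes>\<^bsub>A\<^esub> y \<in> S) \<and>
     (\<forall>x\<in>S. star A x \<in> S)"

definition subalgebra_of :: "('a, 'm) star_tvs_scheme \<Rightarrow> 'a set \<Rightarrow> ('a, 'm) star_tvs_scheme" where
  "subalgebra_of A S = A\<lparr>carrier := S, topol := subtopology (topol A) S\<rparr>"

definition complemented_in :: "'a set \<Rightarrow> ('a, 'm) tvs_scheme \<Rightarrow> bool" where
  "complemented_in S V \<longleftrightarrow> (\<exists>P. clinear_map V V P \<and> continuous_map (topol V) (topol V) P \<and>
     (\<forall>x\<in>carrier V. P (P x) = P x) \<and> P ` carrier V = S)"


section \<open>Seminorms, nuclearity and dominating norms\<close>

definition seminorm_on :: "('a, 'm) tvs_scheme \<Rightarrow> ('a \<Rightarrow> real) \<Rightarrow> bool" where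
  "seminorm_on V p \<longleftrightarrow>
     (\<forall>x\<in>carrier V. 0 \<le> p x) \<and>
     (\<forall>c. \<forall>x\<in>carrier V. p (c \<odot>\<^bsub>V\<^esub> x) = cmod c * p x) \<and>
     (\<forall>x\<in>carrier V. \<forall>y\<in>carrier V. p (x \<oplus>\<^bsub>V\<^esub> y) \<le> p x + p y)"

definition continuous_seminorm :: "('a, 'm) tvs_scheme \<Rightarrow> ('a \<Rightarrow> real) \<Rightarrow> bool" where
  "continuous_seminorm V p \<longleftrightarrow> seminorm_on V p \<and> continuous_map (topol V) euclideanreal p"

definition continuous_norm :: "('a, 'm) tvs_scheme \<Rightarrow> ('a \<Rightarrow> real) \<Rightarrow> bool" where
  "continuous_norm V p \<longleftrightarrow> continuous_seminorm V p \<and> (\<forall>x\<in>carrier V. p x = 0 \<longrightarrow> x = \<zero>\<^bsub>V\<^esub>)"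

text \<open>Nuclearity: for every continuous seminorm \<open>p\<close> there is a continuous seminorm \<open>q \<ge> p\<close>
  such that the canonical map \<open>V / ker q \<rightarrow> V / ker p\<close> between the local normed spaces is
  nuclear, i.e. equals \<open>\<Sum>n. \<lambda> n \<cdot> f n \<otimes> y n\<close> with \<open>\<lambda>\<close> absolutely summable and \<open>f\<close>, \<open>y\<close>
  bounded.  Functionals on \<open>V / ker q\<close> and elements of \<open>V / ker p\<close> are represented on \<open>V\<close>.\<close>

definition linear_functional :: "('a, 'm) tvs_scheme \<Rightarrow> ('a \<Rightarrow> complex) \<Rightarrow> bool" where
  "linear_functional V f \<longleftrightarrow>
     (\<forall>x\<in>carrier V. \<forall>y\<in>carrier V. f (x \<oplus>\<^bsub>V\<^esub> y) = f x + f y) \<and>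
     (\<forall>c. \<forall>x\<in>carrier V. f (c \<odot>\<^bsub>V\<^esub> x) = c * f x)"

definition nuclear_space :: "('a, 'm) tvs_scheme \<Rightarrow> bool" where
  "nuclear_space V \<longleftrightarrow>
     (\<forall>p. continuous_seminorm V p \<longrightarrow>
        (\<exists>q. continuous_seminorm V q \<and> (\<forall>x\<in>carrier V. p x \<le> q x) \<and>
          (\<exists>(l :: nat \<Rightarrow> complex) (f :: nat \<Rightarrow> 'a \<Rightarrow> complex) (y :: nat \<Rightarrow> 'a).
             summable (\<lambda>n. cmod (l n)) \<and>
             (\<forall>n. linear_functional V (f n) \<and> (\<forall>x\<in>carrier V. cmod (f n x) \<le> q x)) \<and>
             (\<forall>n. y n \<in> carrier V \<and> p (y n) \<le> 1) \<and>
             (\<forall>x\<in>carrier V.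
                (\<lambda>N. p (x \<ominus>\<^bsub>V\<^esub> finsum V (\<lambda>n. (l n * f n x) \<odot>\<^bsub>V\<^esub> y n) {..<N}))
                  \<longlonglongrightarrow> 0))))"

definition fundamental_system :: "('a, 'm) tvs_scheme \<Rightarrow> (nat \<Rightarrow> 'a \<Rightarrow> real) \<Rightarrow> bool" where
  "fundamental_system V P \<longleftrightarrow>
     (\<forall>q. continuous_seminorm V (P q)) \<and>
     (\<forall>q. \<forall>x\<in>carrier V. P q x \<le> P (Suc q) x) \<and>
     (\<forall>U. openin (topol V) U \<and> \<zero>\<^bsub>V\<^esub> \<in> U \<longrightarrow>
        (\<exists>q. \<exists>e>0. {x \<in> carrier V. P q x < e} \<subseteq> U))"

text \<open>The property does not depend on the choice of the fundamental system.\<close>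

definition dominating_norm :: "('a, 'm) tvs_scheme \<Rightarrow> ('a \<Rightarrow> real) \<Rightarrow> bool" where
  "dominating_norm V nrm \<longleftrightarrow> continuous_norm V nrm \<and>
     (\<exists>P. fundamental_system V P \<and>
        (\<forall>q. \<exists>r. \<exists>C>0. \<forall>x\<in>carrier V. (P q x)\<^sup>2 \<le> C * nrm x * P r x))"

definition scalar_product :: "('a, 'm) tvs_scheme \<Rightarrow> ('a \<Rightarrow> 'a \<Rightarrow> complex) \<Rightarrow> bool" where
  "scalar_product V ip \<longleftrightarrow>
     (\<forall>z\<in>carrier V. linear_functional V (\<lambda>x. ip x z)) \<and>
     (\<forall>x\<in>carrier V. \<forall>y\<in>carrier V. ip y x = cnj (ip x y)) \<and>
     (\<forall>x\<in>carrier V. x \<noteq> \<zero>\<^bsub>V\<^esub> \<longrightarrow> 0 < Re (ip x x))"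

definition DN_algebra :: "('a, 'm) star_tvs_scheme \<Rightarrow> bool" where
  "DN_algebra A \<longleftrightarrow>
     (\<exists>ip. scalar_product A ip \<and> dominating_norm A (\<lambda>x. sqrt (Re (ip x x))) \<and>
        (\<forall>x\<in>carrier A. \<forall>y\<in>carrier A. \<forall>z\<in>carrier A.
           ip (x \<otimes>\<^bsub>A\<^esub> y) z = ip y (star A x \<otimes>\<^bsub>A\<^esub> z)))"

text \<open>The locally convex topology on a vector space, with carrier \<open>S\<close> and subtraction \<open>diff\<close>,
  given by a family \<open>P\<close> of seminorms.\<close>

definition seminorm_topology :: "'a set \<Rightarrow> ('a \<Rightarrow> 'a \<Rightarrow> 'a) \<Rightarrow> ('a \<Rightarrow> real) set \<Rightarrow> 'a topology" where
  "seminorm_topology S diff P =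
     topology_generated_by {{y \<in> S. p (diff y x) < e} | p x e. p \<in> P \<and> x \<in> S \<and> 0 < e}"


section \<open>Power series spaces of infinite type\<close>

definition psp_carrier :: "(nat \<Rightarrow> real) \<Rightarrow> (nat \<Rightarrow> complex) set" where
  "psp_carrier \<alpha> =
     {\<xi>. \<forall>q::nat. summable (\<lambda>j. (cmod (\<xi> j))\<^sup>2 * exp (2 * real q * \<alpha> j))}"

definition psp_norm :: "(nat \<Rightarrow> real) \<Rightarrow> nat \<Rightarrow> (nat \<Rightarrow> complex) \<Rightarrow> real" where
  "psp_norm \<alpha> q \<xi> = sqrt (\<Sum>j. (cmod (\<xi> j))\<^sup>2 * exp (2 * real q * \<alpha> j))"

definition power_series_space :: "(nat \<Rightarrow> real) \<Rightarrow> (nat \<Rightarrow> complex) tvs" where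
  "power_series_space \<alpha> =
     \<lparr>carrier = psp_carrier \<alpha>,
      monoid.mult = undefined, one = undefined,
      ring.zero = (\<lambda>_. 0), add = (\<lambda>\<xi> \<eta> j. \<xi> j + \<eta> j),
      smult = (\<lambda>c \<xi> j. c * \<xi> j),
      topol = seminorm_topology (psp_carrier \<alpha>) (\<lambda>\<xi> \<eta> j. \<xi> j - \<eta> j) (range (psp_norm \<alpha>))\<rparr>"


section \<open>The algebra of unbounded operators on the space of rapidly decreasing sequences\<close>

text \<open>Sequences are indexed from 0, so the weight attached to index \<open>j\<close> is \<open>Suc j\<close>.\<close>

definition s_space :: "(nat \<Rightarrow> complex) set" where
  "s_space = {\<xi>. \<forall>q::nat. summable (\<lambda>j. (cmod (\<xi> j))\<^sup>2 * real (Suc j) ^ (2 * q))}"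

definition s_norm :: "nat \<Rightarrow> (nat \<Rightarrow> complex) \<Rightarrow> real" where
  "s_norm q \<xi> = sqrt (\<Sum>j. (cmod (\<xi> j))\<^sup>2 * real (Suc j) ^ (2 * q))"

definition s_bounded :: "(nat \<Rightarrow> complex) set \<Rightarrow> bool" where
  "s_bounded B \<longleftrightarrow> B \<subseteq> s_space \<and> (\<forall>q. bdd_above (s_norm q ` B))"

definition l2_space :: "(nat \<Rightarrow> complex) set" where
  "l2_space = {\<xi>. summable (\<lambda>j. (cmod (\<xi> j))\<^sup>2)}"

definition l2_inner :: "(nat \<Rightarrow> complex) \<Rightarrow> (nat \<Rightarrow> complex) \<Rightarrow> complex" where
  "l2_inner \<xi> \<eta> = (\<Sum>j. \<xi> j * cnj (\<eta> j))"

text \<open>The Hilbert space adjoint of an operator with (dense) domain \<open>s\<close>.\<close>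

definition adjoint_domain :: "((nat \<Rightarrow> complex) \<Rightarrow> (nat \<Rightarrow> complex)) \<Rightarrow> (nat \<Rightarrow> complex) set" where
  "adjoint_domain x =
     {\<eta> \<in> l2_space. \<exists>\<zeta>\<in>l2_space. \<forall>\<xi>\<in>s_space. l2_inner (x \<xi>) \<eta> = l2_inner \<xi> \<zeta>}"

definition adjoint_op ::
  "((nat \<Rightarrow> complex) \<Rightarrow> (nat \<Rightarrow> complex)) \<Rightarrow> (nat \<Rightarrow> complex) \<Rightarrow> (nat \<Rightarrow> complex)" where
  "adjoint_op x \<eta> =
     (THE \<zeta>. \<zeta> \<in> l2_space \<and> (\<forall>\<xi>\<in>s_space. l2_inner (x \<xi>) \<eta> = l2_inner \<xi> \<zeta>))"

text \<open>Maps \<open>s \<rightarrow> s\<close> are represented by functions that are \<open>undefined\<close> outside \<open>s\<close>.\<close>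

definition lstar_carrier :: "((nat \<Rightarrow> complex) \<Rightarrow> (nat \<Rightarrow> complex)) set" where
  "lstar_carrier =
     {x \<in> s_space \<rightarrow>\<^sub>E s_space.
        (\<forall>\<xi>\<in>s_space. \<forall>\<eta>\<in>s_space. x (\<lambda>j. \<xi> j + \<eta> j) = (\<lambda>j. x \<xi> j + x \<eta> j)) \<and>
        (\<forall>c. \<forall>\<xi>\<in>s_space. x (\<lambda>j. c * \<xi> j) = (\<lambda>j. c * x \<xi> j)) \<and>
        s_space \<subseteq> adjoint_domain x \<and> adjoint_op x ` s_space \<subseteq> s_space}"

definition lstar_seminorm ::
  "nat \<Rightarrow> (nat \<Rightarrow> complex) set \<Rightarrow> ((nat \<Rightarrow> complex) \<Rightarrow> (nat \<Rightarrow> complex)) \<Rightarrow> real" where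
  "lstar_seminorm N B x =
     max (SUP \<xi>\<in>B. s_norm N (x \<xi>)) (SUP \<xi>\<in>B. s_norm N (adjoint_op x \<xi>))"

text \<open>The empty bounded set, which would contribute the zero seminorm, is left out because
  the supremum of the empty set of reals is unspecified.\<close>

definition lstar :: "((nat \<Rightarrow> complex) \<Rightarrow> (nat \<Rightarrow> complex)) star_tvs" where
  "lstar =
     \<lparr>carrier = lstar_carrier,
      monoid.mult = compose s_space,
      one = (\<lambda>\<xi>\<in>s_space. \<xi>),
      ring.zero = (\<lambda>\<xi>\<in>s_space. (\<lambda>_. 0)),
      add = (\<lambda>x y. \<lambda>\<xi>\<in>s_space. (\<lambda>j. x \<xi> j + y \<xi> j)),
      smult = (\<lambda>c x. \<lambda>\<xi>\<in>s_space. (\<lambda>j. c * x \<xi> j)),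
      topol = seminorm_topology lstar_carrier
        (\<lambda>x y. \<lambda>\<xi>\<in>s_space. (\<lambda>j. x \<xi> j - y \<xi> j))
        {lstar_seminorm N B | N B. s_bounded B \<and> B \<noteq> {}},
      star = (\<lambda>x. restrict (adjoint_op x) s_space)\<rparr>"

end

theory Submission
  imports Defs
begin

text \<open>
  A commutative star-subalgebra of \<open>L*(s)\<close> that is metrizable has its topology given by seminorms
  \<open>p\<^sub>q\<^sub>,\<^sub>B\<close> with one bounded set \<open>B = {\<xi>. \<bar>\<xi>\<^sub>j\<bar> \<le> w\<^sub>j}\<close>, \<open>w\<close> rapidly decreasing. Then
  \<open>(x, y) = \<Sum>\<^sub>j u\<^sub>j\<^sup>2 \<langle>x e\<^sub>j, y e\<^sub>j\<rangle>\<close> with \<open>u\<^sub>j = w\<^sub>j (j + 1)\<^sup>4\<close> is a dominating scalar product: the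
  operators are normal, so \<open>x\<close> and \<open>x*\<close> are controlled alike, and \<open>\<bar>\<xi>\<bar>\<^sub>q\<^sup>2 \<le> \<bar>\<xi>\<bar>\<^sub>0 \<bar>\<xi>\<bar>\<^sub>2\<^sub>q\<close> in \<open>s\<close>.

  Conversely, apply Gram-Schmidt to the unit vectors of \<open>\<Lambda>(\<alpha>)\<close> with respect to the dominating scalar
  product. The resulting orthonormal vectors \<open>f\<^sub>n\<close> satisfy \<open>\<bar>f\<^sub>n\<bar>\<^sub>q \<le> C exp (r \<alpha>\<^sub>n)\<close> by domination, and
  \<open>\<bar>(\<xi>, f\<^sub>n)\<bar> \<le> C exp (- m \<alpha>\<^sub>n) \<bar>\<xi>\<bar>\<^sub>p\<^sub>+\<^sub>m\<close> by orthogonality to the first \<open>n\<close> unit vectors. With nuclearity,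
  i.e. \<open>\<Sum>\<^sub>j exp (- k \<alpha>\<^sub>j) < \<infinity>\<close>, the map \<open>\<xi> \<mapsto> ((\<xi>, f\<^sub>n))\<^sub>n\<close> is therefore an automorphism of \<open>\<Lambda>(\<alpha>)\<close>
  that carries the scalar product to that of \<open>\<ell>\<^sub>2\<close>. Moreover \<open>\<Lambda>(\<alpha>)\<close> is a coordinate subspace of
  \<open>s\<close>, so \<open>x\<close> acts on \<open>s\<close> as multiplication \<open>T x\<close> by \<open>x\<close> after the orthogonal projection; \<open>X \<mapsto> T (X 1)\<close>
  is a continuous projection onto the image of \<open>T\<close>, the continuity resting on uniform boundedness.
\<close>

section \<open>Topologies given by seminorms\<close>

text \<open>The seminorms of \<open>lstar\<close> measure an operator and its adjoint together, so a
  dominating norm has to control both by one number; commutativity makes this possible, because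
  every operator of the subalgebra is then normal. In the other direction, the invariance of the
  scalar product says that multiplication operators have formal adjoints. The obstacle is that the
  given isomorphism with the power series space is only topological and need not respect the scalar
  product. It is corrected by an automorphism. Orthonormalising the unit vectors in the order of
  growing \<alpha> yields one, because triangularity gives two matching estimates at the scale
  \<open>exp (\<alpha> n)\<close>: the new vectors grow at most like a power of it, and the
  coefficients of smooth vectors decay faster than any power. As multiplication is only separately
  continuous, uniformity over bounded sets comes from a Banach-Steinhaus theorem, proved for power
  series spaces by nested balls. The same theorem shows that the elements of \<open>lstar\<close>
  are continuous on \<open>s\<close>.\<close>

definition topology_by_seminorms :: "('a, 'm) tvs_scheme \<Rightarrow> ('a \<Rightarrow> real) set \<Rightarrow> bool" where
  "topology_by_seminorms V \<P> \<longleftrightarrow>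
     (\<forall>U. openin (topol V) U \<longleftrightarrow> U \<subseteq> carrier V \<and>
        (\<forall>x\<in>U. \<exists>p\<in>\<P>. \<exists>e>0. \<forall>z\<in>carrier V. p z < e \<longrightarrow> x \<oplus>\<^bsub>V\<^esub> z \<in> U))"

text \<open>Basic neighbourhoods are balls of single seminorms, without finite intersections: the
  families used below are directed. Translates are written with \<open>\<oplus>\<close> rather than
  through differences, so that linear maps carry them to translates.\<close>

locale seminormed_space = Module.module complex_field V
  for V :: "('a, 'm) tvs_scheme" (structure) +
  fixes \<P> :: "('a \<Rightarrow> real) set"
  assumes topology: "topology_by_seminorms V \<P>"
    and nonempty: "\<P> \<noteq> {}"
    and seminorms: "p \<in> \<P> \<Longrightarrow> seminorm_on V p"

lemma seminorm_onD:
  assumes "seminorm_on V p" "x \<in> carrier V"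
  shows seminorm_on_nonneg: "0 \<le> p x"
    and seminorm_on_smult: "p (c \<odot>\<^bsub>V\<^esub> x) = cmod c * p x"
    and seminorm_on_triangle: "y \<in> carrier V \<Longrightarrow> p (x \<oplus>\<^bsub>V\<^esub> y) \<le> p x + p y"
  using assms by (auto simp: seminorm_on_def)

lemma complex_field_simps [simp]:
  "carrier complex_field = UNIV" "c \<otimes>\<^bsub>complex_field\<^esub> d = c * d" "\<one>\<^bsub>complex_field\<^esub> = 1"
  "\<zero>\<^bsub>complex_field\<^esub> = 0" "c \<oplus>\<^bsub>complex_field\<^esub> d = c + d"
  by (simp_all add: complex_field_def)

lemma cring_complex_field: "cring complex_field"
proof (intro cringI abelian_groupI comm_monoidI)
  show "\<exists>y\<in>carrier complex_field. y \<oplus>\<^bsub>complex_field\<^esub> x = \<zero>\<^bsub>complex_field\<^esub>" for x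
    by (auto intro!: exI[of _ "-x"])
qed (auto simp: algebra_simps)

lemma a_inv_complex_field [simp]: "\<ominus>\<^bsub>complex_field\<^esub> c = - c"
proof -
  interpret cring complex_field by (rule cring_complex_field)
  show ?thesis by (rule minus_equality) auto
qed

lemma seminorm_uminus:
  assumes "Module.module complex_field M" "seminorm_on M p" "x \<in> carrier M"
  shows "p (\<ominus>\<^bsub>M\<^esub> x) = p x"
proof -
  interpret Module.module complex_field M by fact
  have "\<ominus>\<^bsub>M\<^esub> x = (- 1) \<odot>\<^bsub>M\<^esub> x"
    using smult_l_minus[of 1 x] smult_one[of x] assms by simp
  then show ?thesis using seminorm_on_smult[OF assms(2,3), of "-1"] by simp
qed

context seminormed_space
begin

lemma seminorm_zero: "seminorm_on V p \<Longrightarrow> p \<zero> = 0"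
  using seminorm_on_smult[of V p \<zero> 0] smult_l_null[of \<zero>] by simp

lemma seminorm_minus: "seminorm_on V p \<Longrightarrow> x \<in> carrier V \<Longrightarrow> p (\<ominus> x) = p x"
  by (rule seminorm_uminus[OF module_axioms])

lemma openin_iff:
  "openin (topol V) U \<longleftrightarrow> U \<subseteq> carrier V \<and>
     (\<forall>x\<in>U. \<exists>p\<in>\<P>. \<exists>e>0. \<forall>z\<in>carrier V. p z < e \<longrightarrow> x \<oplus> z \<in> U)"
  using topology by (simp add: topology_by_seminorms_def)

lemma topspace_carrier: "topspace (topol V) = carrier V"
proof -
  have "openin (topol V) (carrier V)"
    unfolding openin_iff using nonempty by (auto intro!: exI[of _ "1::real"])
  moreover have "topspace (topol V) \<subseteq> carrier V"
    using openin_iff[of "topspace (topol V)"] by auto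
  ultimately show ?thesis by (meson openin_subset subset_antisym)
qed

lemma continuous_map_realI:
  assumes "\<And>x e. x \<in> carrier V \<Longrightarrow> 0 < e \<Longrightarrow>
    \<exists>p\<in>\<P>. \<exists>d>0. \<forall>z\<in>carrier V. p z < d \<longrightarrow> \<bar>r (x \<oplus> z) - r x\<bar> < (e::real)"
  shows "continuous_map (topol V) euclideanreal r"
  unfolding continuous_map_def
proof (intro conjI allI impI)
  fix U :: "real set" assume "openin euclideanreal U"
  then have "open U" by simp
  show "openin (topol V) {x \<in> topspace (topol V). r x \<in> U}"
    unfolding openin_iff topspace_carrier
  proof (intro conjI ballI)
    fix x assume "x \<in> {x \<in> carrier V. r x \<in> U}"
    then have x: "x \<in> carrier V" "r x \<in> U" by auto
    obtain e where e: "e > 0" "\<And>t. \<bar>t - r x\<bar> < e \<Longrightarrow> t \<in> U"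
      using \<open>open U\<close> x(2) unfolding open_dist dist_real_def by blast
    show "\<exists>p\<in>\<P>. \<exists>e>0. \<forall>z\<in>carrier V. p z < e \<longrightarrow> x \<oplus> z \<in> {x \<in> carrier V. r x \<in> U}"
    proof -
      obtain p d where p: "p \<in> \<P>" "d > 0"
        "\<And>z. z \<in> carrier V \<Longrightarrow> p z < d \<Longrightarrow> \<bar>r (x \<oplus> z) - r x\<bar> < e"
        using assms[OF x(1) e(1)] by blast
      show ?thesis using p e(2) x(1) by (intro bexI[of _ p] exI[of _ d]) auto
    qed
  qed auto
qed auto

lemma continuous_seminormI:
  assumes "seminorm_on V r" "p \<in> \<P>" "\<And>x. x \<in> carrier V \<Longrightarrow> r x \<le> C * p x"
  shows "continuous_seminorm V r"
  unfolding continuous_seminorm_def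
proof (intro conjI continuous_map_realI)
  fix x and e :: real assume x: "x \<in> carrier V" and e: "0 < e"
  \<comment> \<open>\<open>\<bar>C\<bar> + 1\<close> is positive whatever the sign of
    \<open>C\<close>.\<close>
  define d where "d = e / (\<bar>C\<bar> + 1)"
  have d: "d > 0" using e by (simp add: d_def add_nonneg_pos)
  have "\<bar>r (x \<oplus> z) - r x\<bar> < e" if z: "z \<in> carrier V" "p z < d" for z
  proof -
    have "r (x \<oplus> z) \<le> r x + r z" using assms(1) x z by (simp add: seminorm_on_triangle)
    moreover have "x = (x \<oplus> z) \<oplus> (\<ominus> z)" using x z by (simp add: a_assoc r_neg)
    then have "r x \<le> r (x \<oplus> z) + r z"
      using seminorm_on_triangle[OF assms(1), of "x \<oplus> z" "\<ominus> z"] x z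
        seminorm_minus[OF assms(1) z(1)] by simp
    moreover have "r z < e"
    proof -
      have "0 \<le> p z" using seminorms[OF assms(2)] z by (simp add: seminorm_on_nonneg)
      then have "r z \<le> (\<bar>C\<bar> + 1) * p z"
        using assms(3)[OF z(1)] by (smt (verit) mult_right_mono)
      also have "\<dots> < (\<bar>C\<bar> + 1) * d" using z by (simp add: add_nonneg_pos)
      also have "\<dots> = e" by (simp add: d_def add_nonneg_pos)
      finally show ?thesis .
    qed
    ultimately show ?thesis by simp
  qed
  then show "\<exists>p\<in>\<P>. \<exists>d>0. \<forall>z\<in>carrier V. p z < d \<longrightarrow> \<bar>r (x \<oplus> z) - r x\<bar> < e"
    using d assms(2) by blast
qed (rule assms(1))

text \<open>By homogeneity a bound on one ball is a bound everywhere: \<open>x\<close> is scaled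
  into the ball \<open>p < e\<close>. This converts openness into inequalities.\<close>

lemma seminorm_le_of_small:
  assumes "seminorm_on V r" "seminorm_on V p" "e > 0"
    and small: "\<And>z. z \<in> carrier V \<Longrightarrow> p z < e \<Longrightarrow> r z < 1"
    and x: "x \<in> carrier V"
  shows "r x \<le> (1/e) * p x"
proof (rule field_le_epsilon)
  fix t :: real assume t: "t > 0"
  \<comment> \<open>The summand \<open>t * e\<close> keeps \<open>c\<close> positive when
    \<open>p x = 0\<close>; it disappears as \<open>t\<close> tends to 0.\<close>
  define c where "c = p x + t * e"
  have px: "p x \<ge> 0" using assms by (simp add: seminorm_on_nonneg)
  have c: "c > 0" using px t assms(3) by (simp add: c_def add_nonneg_pos)
  have "p (complex_of_real (e / c) \<odot> x) = (e / c) * p x"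
    using seminorm_on_smult[OF assms(2) x] c assms(3) by (simp add: norm_divide)
  also have "\<dots> < e" using c t assms(3) by (simp add: field_simps c_def)
  finally have "r (complex_of_real (e / c) \<odot> x) < 1" using small x by simp
  then have "(e / c) * r x < 1"
    using seminorm_on_smult[OF assms(1) x] c assms(3) by (simp add: norm_divide)
  then have "r x < c / e" using c assms(3) by (simp add: field_simps)
  then show "r x \<le> (1/e) * p x + t" using assms(3) by (simp add: c_def field_simps)
qed

text \<open>Converse of \<open>continuous_seminormI\<close>: the preimage of \<open>{..<1}\<close>
  is a neighbourhood of zero, hence contains a ball of one generating seminorm.\<close>

lemma continuous_seminormD:
  assumes "continuous_seminorm V r"
  obtains p C where "p \<in> \<P>" "C > 0" "\<And>x. x \<in> carrier V \<Longrightarrow> r x \<le> C * p x"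
proof -
  have r: "seminorm_on V r" and c: "continuous_map (topol V) euclideanreal r"
    using assms by (auto simp: continuous_seminorm_def)
  have "openin (topol V) {x \<in> topspace (topol V). r x \<in> {..<1}}"
    by (rule openin_continuous_map_preimage[OF c]) (simp del: lessThan_iff)
  moreover have "\<zero> \<in> {x \<in> topspace (topol V). r x \<in> {..<1}}"
    by (simp add: topspace_carrier seminorm_zero[OF r])
  ultimately obtain p e where p: "p \<in> \<P>" "e > 0"
    "\<And>z. z \<in> carrier V \<Longrightarrow> p z < e \<Longrightarrow> \<zero> \<oplus> z \<in> {x \<in> topspace (topol V). r x \<in> {..<1}}"
    unfolding openin_iff by blast
  then have "r z < 1" if "z \<in> carrier V" "p z < e" for z using that by auto
  from seminorm_le_of_small[OF r seminorms[OF p(1)] p(2) this]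
  show thesis using that[OF p(1), of "1/e"] p(2) by auto
qed

end

section \<open>Continuous maps, embeddings and generated topologies in terms of seminorms\<close>

lemma continuous_map_of_seminorm_bounds:
  assumes "seminormed_space V \<P>" "seminormed_space W \<Q>" and f: "clinear_map V W f"
    and bound: "\<And>q. q \<in> \<Q> \<Longrightarrow> \<exists>p\<in>\<P>. \<exists>C. \<forall>x\<in>carrier V. q (f x) \<le> C * p x"
  shows "continuous_map (topol V) (topol W) f"
proof -
  interpret V: seminormed_space V \<P> by fact
  interpret W: seminormed_space W \<Q> by fact
  have fc: "f x \<in> carrier W" if "x \<in> carrier V" for x using f that by (auto simp: clinear_map_def)
  have fa: "f (x \<oplus>\<^bsub>V\<^esub> y) = f x \<oplus>\<^bsub>W\<^esub> f y" if "x \<in> carrier V" "y \<in> carrier V" for x y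
    using f that by (auto simp: clinear_map_def)
  show ?thesis unfolding continuous_map_def
  proof (intro conjI allI impI)
    show "f \<in> topspace (topol V) \<rightarrow> topspace (topol W)"
      by (auto simp: V.topspace_carrier W.topspace_carrier fc)
    fix U assume U: "openin (topol W) U"
    show "openin (topol V) {x \<in> topspace (topol V). f x \<in> U}"
      unfolding V.openin_iff V.topspace_carrier
    proof (intro conjI ballI)
      fix x assume "x \<in> {x \<in> carrier V. f x \<in> U}"
      then have x: "x \<in> carrier V" "f x \<in> U" by auto
      obtain q e where q: "q \<in> \<Q>" "e > 0"
        "\<And>z. z \<in> carrier W \<Longrightarrow> q z < e \<Longrightarrow> f x \<oplus>\<^bsub>W\<^esub> z \<in> U"
        using U x(2) unfolding W.openin_iff by blast
      obtain p C where p: "p \<in> \<P>" "\<And>x. x \<in> carrier V \<Longrightarrow> q (f x) \<le> C * p x"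
        using bound[OF q(1)] by blast
      define d where "d = e / (\<bar>C\<bar> + 1)"
      have d: "d > 0" using q by (simp add: d_def add_nonneg_pos)
      have "q (f z) < e" if z: "z \<in> carrier V" "p z < d" for z
      proof -
        have "0 \<le> p z" using V.seminorms[OF p(1)] z by (simp add: seminorm_on_nonneg)
        then have "q (f z) \<le> (\<bar>C\<bar> + 1) * p z"
          using p(2)[OF z(1)] by (smt (verit) mult_right_mono)
        also have "\<dots> < (\<bar>C\<bar> + 1) * d" using z by (simp add: add_nonneg_pos)
        also have "\<dots> = e" by (simp add: d_def add_nonneg_pos)
        finally show ?thesis .
      qed
      then have "x \<oplus>\<^bsub>V\<^esub> z \<in> {x \<in> carrier V. f x \<in> U}" if "z \<in> carrier V" "p z < d" for z
        using that x q(3)[of "f z"] fa fc by simp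
      then show "\<exists>p\<in>\<P>. \<exists>e>0. \<forall>z\<in>carrier V. p z < e \<longrightarrow> x \<oplus>\<^bsub>V\<^esub> z \<in> {x \<in> carrier V. f x \<in> U}"
        using p(1) d by blast
    qed auto
  qed
qed

text \<open>Seminorms are pulled back along a topological embedding whose image may be a proper
  subspace. This serves both for an algebra inside \<open>lstar\<close> and for a space isomorphic
  to a power series space.\<close>

lemma seminormed_space_embedding:
  assumes "seminormed_space W \<Q>" "Module.module complex_field V" "topspace (topol V) = carrier V"
    and f: "clinear_map V W f" and inj: "inj_on f (carrier V)"
    and emb: "homeomorphic_map (topol V) (subtopology (topol W) (f ` carrier V)) f"
  shows "seminormed_space V ((\<lambda>q x. q (f x)) ` \<Q>)"
proof -
  interpret W: seminormed_space W \<Q> by fact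
  interpret V: Module.module complex_field V by fact
  have fc: "f x \<in> carrier W" if "x \<in> carrier V" for x using f that by (auto simp: clinear_map_def)
  have fa: "f (x \<oplus>\<^bsub>V\<^esub> y) = f x \<oplus>\<^bsub>W\<^esub> f y" if "x \<in> carrier V" "y \<in> carrier V" for x y
    using f that by (auto simp: clinear_map_def)
  have fs: "f (c \<odot>\<^bsub>V\<^esub> x) = c \<odot>\<^bsub>W\<^esub> f x" if "x \<in> carrier V" for x c
    using f that by (auto simp: clinear_map_def)
  have open_iff: "openin (topol V) U \<longleftrightarrow> (\<exists>O'. openin (topol W) O' \<and> f ` U = O' \<inter> f ` carrier V)"
    if "U \<subseteq> carrier V" for U
    using homeomorphic_map_openness[OF emb, of U] that
    unfolding assms(3) openin_subtopology by simp
  have "topology_by_seminorms V ((\<lambda>q x. q (f x)) ` \<Q>)"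
    unfolding topology_by_seminorms_def
  proof (intro allI iffI conjI ballI)
    fix U assume U: "openin (topol V) U"
    then show sub: "U \<subseteq> carrier V" using openin_subset assms(3) by auto
    obtain O' where O: "openin (topol W) O'" "f ` U = O' \<inter> f ` carrier V"
      using U open_iff[OF sub] by auto
    fix x assume x: "x \<in> U"
    then have "f x \<in> O'" using O(2) by blast
    then obtain q e where q: "q \<in> \<Q>" "e > 0"
        "\<And>z. z \<in> carrier W \<Longrightarrow> q z < e \<Longrightarrow> f x \<oplus>\<^bsub>W\<^esub> z \<in> O'"
      using O(1)[unfolded W.openin_iff] by meson
    have "x \<oplus>\<^bsub>V\<^esub> z \<in> U" if z: "z \<in> carrier V" "q (f z) < e" for z
    proof -
      have xz: "x \<oplus>\<^bsub>V\<^esub> z \<in> carrier V" using x sub z by auto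
      have "f (x \<oplus>\<^bsub>V\<^esub> z) = f x \<oplus>\<^bsub>W\<^esub> f z" using fa x sub z by blast
      then have "f (x \<oplus>\<^bsub>V\<^esub> z) \<in> O'" using q(3)[OF fc[OF z(1)] z(2)] by simp
      then have "f (x \<oplus>\<^bsub>V\<^esub> z) \<in> f ` U" using xz O(2) by blast
      then show ?thesis using inj_on_image_mem_iff[OF inj xz sub] by blast
    qed
    then show "\<exists>p\<in>(\<lambda>q x. q (f x)) ` \<Q>. \<exists>e>0. \<forall>z\<in>carrier V. p z < e \<longrightarrow> x \<oplus>\<^bsub>V\<^esub> z \<in> U"
      using q(1,2) by (intro bexI[of _ "\<lambda>x. q (f x)"] exI[of _ e]) auto
  next
    fix U assume a: "U \<subseteq> carrier V \<and>
       (\<forall>x\<in>U. \<exists>p\<in>(\<lambda>q x. q (f x)) ` \<Q>. \<exists>e>0. \<forall>z\<in>carrier V. p z < e \<longrightarrow> x \<oplus>\<^bsub>V\<^esub> z \<in> U)"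
    then have sub: "U \<subseteq> carrier V" by simp
    have "\<forall>x\<in>U. \<exists>q. q \<in> \<Q> \<and> (\<exists>e>0. \<forall>z\<in>carrier V. q (f z) < e \<longrightarrow> x \<oplus>\<^bsub>V\<^esub> z \<in> U)"
      using a by blast
    \<comment> \<open>Seminorm and radius are chosen for every point of \<open>U\<close>, because
      the open subset of \<open>W\<close> built below needs a ball around each image.\<close>
    then obtain q where q: "\<forall>x\<in>U. q x \<in> \<Q> \<and> (\<exists>e>0. \<forall>z\<in>carrier V. q x (f z) < e \<longrightarrow> x \<oplus>\<^bsub>V\<^esub> z \<in> U)"
      using bchoice[of U "\<lambda>x q. q \<in> \<Q> \<and> (\<exists>e>0. \<forall>z\<in>carrier V. q (f z) < e \<longrightarrow> x \<oplus>\<^bsub>V\<^esub> z \<in> U)"]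
      by auto
    then have "\<forall>x\<in>U. \<exists>e. e > 0 \<and> (\<forall>z\<in>carrier V. q x (f z) < e \<longrightarrow> x \<oplus>\<^bsub>V\<^esub> z \<in> U)" by auto
    then obtain e where e: "\<forall>x\<in>U. e x > 0 \<and> (\<forall>z\<in>carrier V. q x (f z) < e x \<longrightarrow> x \<oplus>\<^bsub>V\<^esub> z \<in> U)"
      using bchoice[of U "\<lambda>x e. e > 0 \<and> (\<forall>z\<in>carrier V. q x (f z) < e \<longrightarrow> x \<oplus>\<^bsub>V\<^esub> z \<in> U)"] by auto
    have qe: "\<And>x. x \<in> U \<Longrightarrow> q x \<in> \<Q>" "\<And>x. x \<in> U \<Longrightarrow> e x > (0::real)"
      "\<And>x z. x \<in> U \<Longrightarrow> z \<in> carrier V \<Longrightarrow> q x (f z) < e x \<Longrightarrow> x \<oplus>\<^bsub>V\<^esub> z \<in> U"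
      using q e by auto
    \<comment> \<open>An open subset of \<open>W\<close> that meets the image of \<open>f\<close>
      exactly in the image of \<open>U\<close>: the union of the chosen balls around the points
      \<open>f x\<close>.\<close>
    define O' where "O' = (\<Union>x\<in>U. {f x \<oplus>\<^bsub>W\<^esub> z | z. z \<in> carrier W \<and> q x z < e x})"
    have "openin (topol W) O'"
      unfolding O'_def
    proof (intro openin_Union ballI, clarify)
      fix x assume x: "x \<in> U"
      have sq: "seminorm_on W (q x)" using W.seminorms qe(1) x by blast
      show "openin (topol W) {f x \<oplus>\<^bsub>W\<^esub> z |z. z \<in> carrier W \<and> q x z < e x}"
        unfolding W.openin_iff
      proof (intro conjI subsetI ballI)
        fix y assume "y \<in> {f x \<oplus>\<^bsub>W\<^esub> z |z. z \<in> carrier W \<and> q x z < e x}"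
        then obtain z where z: "y = f x \<oplus>\<^bsub>W\<^esub> z" "z \<in> carrier W" "q x z < e x" by blast
        then show "y \<in> carrier W" using x sub fc by auto
        have "y \<oplus>\<^bsub>W\<^esub> z' \<in> {f x \<oplus>\<^bsub>W\<^esub> z |z. z \<in> carrier W \<and> q x z < e x}"
          if "z' \<in> carrier W" "q x z' < e x - q x z" for z'
        proof -
          have "y \<oplus>\<^bsub>W\<^esub> z' = f x \<oplus>\<^bsub>W\<^esub> (z \<oplus>\<^bsub>W\<^esub> z')"
            using z that x sub fc W.a_assoc by auto
          moreover have "q x (z \<oplus>\<^bsub>W\<^esub> z') < e x"
            using seminorm_on_triangle[OF sq z(2) that(1)] that by simp
          ultimately show ?thesis using z that by blast
        qed
        then show "\<exists>p\<in>\<Q>. \<exists>ea>0. \<forall>za\<in>carrier W. p za < ea \<longrightarrow>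
             y \<oplus>\<^bsub>W\<^esub> za \<in> {f x \<oplus>\<^bsub>W\<^esub> z |z. z \<in> carrier W \<and> q x z < e x}"
          using qe(1)[OF x] z(3) by (intro bexI[of _ "q x"] exI[of _ "e x - q x z"]) auto
      qed
    qed
    moreover have "f ` U = O' \<inter> f ` carrier V"
    proof (intro equalityI subsetI)
      fix y assume "y \<in> f ` U"
      then obtain x where x: "x \<in> U" "y = f x" by auto
      have "f x = f x \<oplus>\<^bsub>W\<^esub> \<zero>\<^bsub>W\<^esub>" using x sub fc by auto
      moreover have "q x \<zero>\<^bsub>W\<^esub> < e x"
        using W.seminorm_zero[OF W.seminorms[OF qe(1)[OF x(1)]]] qe(2)[OF x(1)] by simp
      ultimately have "y \<in> O'" unfolding O'_def using x W.zero_closed by blast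
      then show "y \<in> O' \<inter> f ` carrier V" using x sub by auto
    next
      fix y assume "y \<in> O' \<inter> f ` carrier V"
      then obtain w x z where w: "w \<in> carrier V" "y = f w" "x \<in> U" "y = f x \<oplus>\<^bsub>W\<^esub> z"
        "z \<in> carrier W" "q x z < e x" unfolding O'_def by auto
      have x: "x \<in> carrier V" using w sub by auto
      \<comment> \<open>Cancellation will identify \<open>z\<close> with \<open>f\<close> of this
        difference, so the ball condition in \<open>W\<close> becomes the one in
        \<open>V\<close>.\<close>
      have weq: "w = x \<oplus>\<^bsub>V\<^esub> (w \<ominus>\<^bsub>V\<^esub> x)"
        using w x by (metis V.a_assoc V.a_comm V.a_inv_closed V.l_neg V.minus_eq V.r_zero)
      have "f x \<oplus>\<^bsub>W\<^esub> z = f x \<oplus>\<^bsub>W\<^esub> f (w \<ominus>\<^bsub>V\<^esub> x)"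
        using fa[of x "w \<ominus>\<^bsub>V\<^esub> x"] weq w x by simp
      then have "z = f (w \<ominus>\<^bsub>V\<^esub> x)" using w x fc by simp
      then have "w \<in> U" using qe(3)[OF w(3), of "w \<ominus>\<^bsub>V\<^esub> x"] w x weq by simp
      then show "y \<in> f ` U" using w by auto
    qed
    ultimately show "openin (topol V) U" using open_iff[OF sub] by blast
  qed
  moreover have "seminorm_on V (\<lambda>x. q (f x))" if "q \<in> \<Q>" for q
    using W.seminorms[OF that] fc fa fs unfolding seminorm_on_def by simp
  ultimately show ?thesis
    using W.nonempty assms(2)
    by (auto intro!: seminormed_space.intro seminormed_space_axioms.intro)
qed

text \<open>In \<open>seminorm_topology\<close> the balls are only a subbasis, and subtraction is an
  explicit function \<open>dif\<close>. Directedness replaces finite intersections by single balls,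
  and \<open>dif\<close> is tied to the module only by cancellation.\<close>

lemma seminormed_space_seminorm_topology:
  assumes "Module.module complex_field V"
    and top: "topol V = seminorm_topology (carrier V) dif \<P>"
    and dif: "\<And>x y. x \<in> carrier V \<Longrightarrow> y \<in> carrier V \<Longrightarrow> dif x y \<in> carrier V \<and> y \<oplus>\<^bsub>V\<^esub> dif x y = x"
    and ne: "\<P> \<noteq> {}"
    and sem: "\<And>p. p \<in> \<P> \<Longrightarrow> seminorm_on V p"
    and dir: "\<And>p q. p \<in> \<P> \<Longrightarrow> q \<in> \<P> \<Longrightarrow> \<exists>r\<in>\<P>. \<forall>x\<in>carrier V. p x \<le> r x \<and> q x \<le> r x"
  shows "seminormed_space V \<P>"
proof -
  interpret V: Module.module complex_field V by fact
  have cancel: "b = c" if "x \<oplus>\<^bsub>V\<^esub> b = x \<oplus>\<^bsub>V\<^esub> c" "x \<in> carrier V" "b \<in> carrier V" "c \<in> carrier V" for x b c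
    using that by simp
  let ?b = "{{y \<in> carrier V. p (dif y x) < e} | p x e. p \<in> \<P> \<and> x \<in> carrier V \<and> 0 < e}"
  have "topology_by_seminorms V \<P>"
    unfolding topology_by_seminorms_def
  proof (intro allI iffI)
    fix U assume "openin (topol V) U"
    then have "generate_topology_on ?b U"
      unfolding top seminorm_topology_def openin_topology_generated_by_iff by simp
    then show "U \<subseteq> carrier V \<and>
        (\<forall>x\<in>U. \<exists>p\<in>\<P>. \<exists>e>0. \<forall>z\<in>carrier V. p z < e \<longrightarrow> x \<oplus>\<^bsub>V\<^esub> z \<in> U)"
    proof (induction rule: generate_topology_on.induct)
      case (Int a b)
      have "\<exists>p\<in>\<P>. \<exists>e>0. \<forall>z\<in>carrier V. p z < e \<longrightarrow> x \<oplus>\<^bsub>V\<^esub> z \<in> a \<inter> b" if x: "x \<in> a \<inter> b" for x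
      proof -
        obtain p e where p: "p \<in> \<P>" "e > 0" "\<forall>z\<in>carrier V. p z < e \<longrightarrow> x \<oplus>\<^bsub>V\<^esub> z \<in> a"
          using Int x by (meson IntD1)
        obtain q d where q: "q \<in> \<P>" "d > 0" "\<forall>z\<in>carrier V. q z < d \<longrightarrow> x \<oplus>\<^bsub>V\<^esub> z \<in> b"
          using Int x by (meson IntD2)
        obtain r where r: "r \<in> \<P>" "\<forall>x\<in>carrier V. p x \<le> r x \<and> q x \<le> r x"
          using dir[OF p(1) q(1)] by blast
        show ?thesis
        proof (intro bexI[of _ r] exI[of _ "min e d"] conjI ballI impI IntI)
          fix z assume z: "z \<in> carrier V" "r z < min e d"
          then have "p z < e" "q z < d" using r(2) by fastforce+
          then show "x \<oplus>\<^bsub>V\<^esub> z \<in> a" "x \<oplus>\<^bsub>V\<^esub> z \<in> b" using p q z by blast+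
        qed (use p q r in auto)
      qed
      then show ?case using Int by auto
    next
      case (UN K)
      have "\<exists>p\<in>\<P>. \<exists>e>0. \<forall>z\<in>carrier V. p z < e \<longrightarrow> x \<oplus>\<^bsub>V\<^esub> z \<in> \<Union>K"
        if k: "x \<in> k" "k \<in> K" for x k
      proof -
        obtain p e where "p \<in> \<P>" "e > 0" "\<forall>z\<in>carrier V. p z < e \<longrightarrow> x \<oplus>\<^bsub>V\<^esub> z \<in> k"
          using UN.IH[OF k(2)] k(1) by meson
        then show ?thesis using k(2) by blast
      qed
      then show ?case using UN by blast
    next
      case (Basis s)
      then obtain p x e where s: "s = {y \<in> carrier V. p (dif y x) < e}" "p \<in> \<P>" "x \<in> carrier V" "0 < e"
        by blast
      have "\<exists>p\<in>\<P>. \<exists>e>0. \<forall>z\<in>carrier V. p z < e \<longrightarrow> y \<oplus>\<^bsub>V\<^esub> z \<in> s" if y: "y \<in> s" for y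
      proof -
        have "y \<oplus>\<^bsub>V\<^esub> z \<in> s" if z: "z \<in> carrier V" "p z < e - p (dif y x)" for z
        proof -
          have yc: "y \<in> carrier V" "y \<oplus>\<^bsub>V\<^esub> z \<in> carrier V" using y s z by auto
          have "x \<oplus>\<^bsub>V\<^esub> dif (y \<oplus>\<^bsub>V\<^esub> z) x = x \<oplus>\<^bsub>V\<^esub> (dif y x \<oplus>\<^bsub>V\<^esub> z)"
            using dif[OF yc(2) s(3)] dif[OF yc(1) s(3)] z s(3) V.a_assoc[of x "dif y x" z] by simp
          \<comment> \<open>\<open>dif\<close> commutes with translations, so a ball around
            \<open>x\<close> contains a smaller ball around each of its points.\<close>
          then have "dif (y \<oplus>\<^bsub>V\<^esub> z) x = dif y x \<oplus>\<^bsub>V\<^esub> z"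
            by (rule cancel) (use dif[OF yc(2) s(3)] dif[OF yc(1) s(3)] z s(3) in auto)
          then show ?thesis
            using seminorm_on_triangle[OF sem[OF s(2)], of "dif y x" z] dif[OF yc(1) s(3)] z yc s(1)
            by auto
        qed
        moreover have "e - p (dif y x) > 0" using y s by auto
        ultimately show ?thesis using s(2) by blast
      qed
      then show ?case using s(1) by blast
    qed auto
  next
    fix U assume U: "U \<subseteq> carrier V \<and>
        (\<forall>x\<in>U. \<exists>p\<in>\<P>. \<exists>e>0. \<forall>z\<in>carrier V. p z < e \<longrightarrow> x \<oplus>\<^bsub>V\<^esub> z \<in> U)"
    show "openin (topol V) U"
    proof (subst openin_subopen, intro ballI)
      fix x assume x: "x \<in> U"
      then obtain p e where p: "p \<in> \<P>" "e > 0" "\<And>z. z \<in> carrier V \<Longrightarrow> p z < e \<Longrightarrow> x \<oplus>\<^bsub>V\<^esub> z \<in> U"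
        using U by blast
      have xc: "x \<in> carrier V" using x U by auto
      have "openin (topol V) {y \<in> carrier V. p (dif y x) < e}"
        unfolding top seminorm_topology_def
        by (rule topology_generated_by_Basis) (use p xc in blast)
      moreover have "dif x x = \<zero>\<^bsub>V\<^esub>" using dif[OF xc xc] xc by (metis V.add.l_cancel_one)
      then have "p (dif x x) = 0"
        using seminorm_on_smult[OF sem[OF p(1)], of "\<zero>\<^bsub>V\<^esub>" 0] V.smult_l_null[of "\<zero>\<^bsub>V\<^esub>"] by simp
      then have "x \<in> {y \<in> carrier V. p (dif y x) < e}" using xc p by auto
      moreover have "{y \<in> carrier V. p (dif y x) < e} \<subseteq> U"
      proof (intro subsetI)
        fix y assume "y \<in> {y \<in> carrier V. p (dif y x) < e}"
        then have y: "y \<in> carrier V" "p (dif y x) < e" by auto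
        show "y \<in> U" using p(3)[of "dif y x"] dif[OF y(1) xc] y(2) by simp
      qed
      ultimately show "\<exists>T. openin (topol V) T \<and> x \<in> T \<and> T \<subseteq> U" by blast
    qed
  qed
  then show ?thesis using ne sem assms(1)
    by (auto intro!: seminormed_space.intro seminormed_space_axioms.intro)
qed


section \<open>Weighted sequence spaces\<close>

type_synonym cseq = "nat \<Rightarrow> complex"

section \<open>The Hilbert space of square summable sequences\<close>

definition l2_norm :: "cseq \<Rightarrow> real" where
  "l2_norm a = sqrt (\<Sum>j. (cmod (a j))\<^sup>2)"

lemma l2_norm_nonneg [simp]: "a \<in> l2_space \<Longrightarrow> 0 \<le> l2_norm a"
  by (simp add: l2_norm_def l2_space_def suminf_nonneg)

lemma l2_norm_power2: "a \<in> l2_space \<Longrightarrow> (l2_norm a)\<^sup>2 = (\<Sum>j. (cmod (a j))\<^sup>2)"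
  by (simp add: l2_norm_def l2_space_def suminf_nonneg)

text \<open>Membership and norm estimate come together from bounded partial sums; the inequalities
  for \<open>L2_set\<close> over finite sets thus carry over to series.\<close>

lemma l2_boundedI:
  assumes "\<And>n. (\<Sum>j<n. (cmod (a j))\<^sup>2) \<le> M\<^sup>2" "0 \<le> M"
  shows "a \<in> l2_space" "l2_norm a \<le> M"
proof -
  have s: "summable (\<lambda>j. (cmod (a j))\<^sup>2)"
    by (rule summableI_nonneg_bounded[where x="M\<^sup>2"]) (use assms in auto)
  then show "a \<in> l2_space" by (simp add: l2_space_def)
  have "(\<Sum>j. (cmod (a j))\<^sup>2) \<le> M\<^sup>2" by (rule suminf_le_const[OF s]) (use assms in auto)
  then show "l2_norm a \<le> M" unfolding l2_norm_def using assms(2) by (simp add: real_le_lsqrt suminf_nonneg s)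
qed

lemma l2_sum_le:
  assumes "a \<in> l2_space"
  shows "(\<Sum>j<n. (cmod (a j))\<^sup>2) \<le> (l2_norm a)\<^sup>2"
  unfolding l2_norm_power2[OF assms]
  by (rule sum_le_suminf) (use assms in \<open>auto simp: l2_space_def\<close>)

lemma L2_set_le_l2_norm:
  assumes "a \<in> l2_space"
  shows "L2_set (\<lambda>j. cmod (a j)) {..<n} \<le> l2_norm a"
  unfolding L2_set_def using l2_sum_le[OF assms, of n] assms
  by (simp add: real_le_lsqrt sum_nonneg)

lemma l2_comparison:
  assumes "b \<in> l2_space" "\<And>j. cmod (a j) \<le> C * cmod (b j)" "0 \<le> C"
  shows "a \<in> l2_space" "l2_norm a \<le> C * l2_norm b"
proof -
  have "(\<Sum>j<n. (cmod (a j))\<^sup>2) \<le> (C * l2_norm b)\<^sup>2" for n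
  proof -
    have "(\<Sum>j<n. (cmod (a j))\<^sup>2) \<le> (\<Sum>j<n. C\<^sup>2 * (cmod (b j))\<^sup>2)"
      using power_mono[OF assms(2) norm_ge_zero, where n = 2]
      by (intro sum_mono) (simp add: power_mult_distrib)
    also have "\<dots> = C\<^sup>2 * (\<Sum>j<n. (cmod (b j))\<^sup>2)" by (simp add: sum_distrib_left)
    also have "\<dots> \<le> C\<^sup>2 * (l2_norm b)\<^sup>2" by (intro mult_left_mono l2_sum_le assms) auto
    finally show ?thesis by (simp add: power_mult_distrib)
  qed
  then show "a \<in> l2_space" "l2_norm a \<le> C * l2_norm b"
    using l2_boundedI[of a "C * l2_norm b"] l2_norm_nonneg[OF assms(1)] assms(3) by (blast intro: mult_nonneg_nonneg)+
qed

lemma l2_norm_coordinate: "a \<in> l2_space \<Longrightarrow> cmod (a j) \<le> l2_norm a"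
proof -
  assume a: "a \<in> l2_space"
  have "(cmod (a j))\<^sup>2 \<le> (\<Sum>i<Suc j. (cmod (a i))\<^sup>2)" by (rule member_le_sum) auto
  also have "\<dots> \<le> (l2_norm a)\<^sup>2" by (rule l2_sum_le[OF a])
  finally show ?thesis using l2_norm_nonneg[OF a] by (rule power2_le_imp_le)
qed

lemma l2_add:
  assumes "a \<in> l2_space" "b \<in> l2_space"
  shows "(\<lambda>j. a j + b j) \<in> l2_space" "l2_norm (\<lambda>j. a j + b j) \<le> l2_norm a + l2_norm b"
proof -
  have "(\<Sum>j<n. (cmod (a j + b j))\<^sup>2) \<le> (l2_norm a + l2_norm b)\<^sup>2" for n
  proof -
    have "L2_set (\<lambda>j. cmod (a j + b j)) {..<n} \<le> L2_set (\<lambda>j. cmod (a j) + cmod (b j)) {..<n}"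
      by (rule L2_set_mono) (auto intro: norm_triangle_ineq)
    also have "\<dots> \<le> L2_set (\<lambda>j. cmod (a j)) {..<n} + L2_set (\<lambda>j. cmod (b j)) {..<n}"
      by (rule L2_set_triangle_ineq)
    also have "\<dots> \<le> l2_norm a + l2_norm b" by (intro add_mono L2_set_le_l2_norm assms)
    finally have "(L2_set (\<lambda>j. cmod (a j + b j)) {..<n})\<^sup>2 \<le> (l2_norm a + l2_norm b)\<^sup>2"
      by (rule power_mono) (rule L2_set_nonneg)
    then show ?thesis by (simp add: L2_set_def sum_nonneg)
  qed
  then show "(\<lambda>j. a j + b j) \<in> l2_space" "l2_norm (\<lambda>j. a j + b j) \<le> l2_norm a + l2_norm b"
    using l2_boundedI[of "\<lambda>j. a j + b j" "l2_norm a + l2_norm b"]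
      add_nonneg_nonneg[OF l2_norm_nonneg[OF assms(1)] l2_norm_nonneg[OF assms(2)]] by blast+
qed

lemma l2_scale:
  assumes "a \<in> l2_space"
  shows "(\<lambda>j. c * a j) \<in> l2_space" "l2_norm (\<lambda>j. c * a j) = cmod c * l2_norm a"
proof -
  show "(\<lambda>j. c * a j) \<in> l2_space"
    using assms by (simp add: l2_space_def norm_mult power_mult_distrib summable_mult)
  have "(\<Sum>j. (cmod (c * a j))\<^sup>2) = (cmod c)\<^sup>2 * (\<Sum>j. (cmod (a j))\<^sup>2)"
    using assms by (simp add: l2_space_def norm_mult power_mult_distrib suminf_mult)
  then show "l2_norm (\<lambda>j. c * a j) = cmod c * l2_norm a"
    by (simp add: l2_norm_def real_sqrt_mult)
qed

lemma l2_inner_summable: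
  assumes "a \<in> l2_space" "b \<in> l2_space"
  shows "summable (\<lambda>j. cmod (a j * cnj (b j)))" "(\<Sum>j. cmod (a j * cnj (b j))) \<le> l2_norm a * l2_norm b"
    "summable (\<lambda>j. a j * cnj (b j))"
proof -
  have b: "(\<Sum>j<n. cmod (a j * cnj (b j))) \<le> l2_norm a * l2_norm b" for n
  proof -
    have "(\<Sum>j<n. cmod (a j * cnj (b j))) = (\<Sum>j<n. \<bar>cmod (a j)\<bar> * \<bar>cmod (b j)\<bar>)"
      by (simp add: norm_mult)
    also have "\<dots> \<le> L2_set (\<lambda>j. cmod (a j)) {..<n} * L2_set (\<lambda>j. cmod (b j)) {..<n}"
      by (rule L2_set_mult_ineq)
    also have "\<dots> \<le> l2_norm a * l2_norm b" by (intro mult_mono L2_set_le_l2_norm assms) (auto simp: L2_set_nonneg assms)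
    finally show ?thesis .
  qed
  show s: "summable (\<lambda>j. cmod (a j * cnj (b j)))"
    by (rule summableI_nonneg_bounded[OF _ b]) auto
  show "(\<Sum>j. cmod (a j * cnj (b j))) \<le> l2_norm a * l2_norm b"
    by (rule suminf_le_const[OF s b])
  show "summable (\<lambda>j. a j * cnj (b j))" by (rule summable_norm_cancel[OF s])
qed

lemma l2_Cauchy_Schwarz:
  assumes "a \<in> l2_space" "b \<in> l2_space"
  shows "cmod (l2_inner a b) \<le> l2_norm a * l2_norm b"
  unfolding l2_inner_def
  using summable_norm[OF l2_inner_summable(1)[OF assms]] l2_inner_summable(2)[OF assms] by linarith

lemma l2_inner_add_left:
  assumes "a \<in> l2_space" "b \<in> l2_space" "c \<in> l2_space"
  shows "l2_inner (\<lambda>j. a j + b j) c = l2_inner a c + l2_inner b c"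
  unfolding l2_inner_def using suminf_add[OF l2_inner_summable(3) l2_inner_summable(3), of a c b c] assms
  by (simp add: algebra_simps)

lemma l2_inner_scale_left:
  assumes "a \<in> l2_space" "b \<in> l2_space"
  shows "l2_inner (\<lambda>j. c * a j) b = c * l2_inner a b"
  unfolding l2_inner_def using suminf_mult[OF l2_inner_summable(3)[OF assms], of c]
  by (simp add: algebra_simps)

lemma l2_inner_cnj:
  assumes "a \<in> l2_space" "b \<in> l2_space"
  shows "l2_inner b a = cnj (l2_inner a b)"
proof -
  have "(\<lambda>j. a j * cnj (b j)) sums l2_inner a b"
    unfolding l2_inner_def using l2_inner_summable(3)[OF assms] by (rule summable_sums)
  then have "(\<lambda>j. cnj (a j * cnj (b j))) sums cnj (l2_inner a b)" by (simp only: sums_cnj)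
  then show ?thesis unfolding l2_inner_def[of b] by (simp add: mult.commute sums_unique[symmetric])
qed

lemma l2_inner_add_right:
  assumes "a \<in> l2_space" "b \<in> l2_space" "c \<in> l2_space"
  shows "l2_inner c (\<lambda>j. a j + b j) = l2_inner c a + l2_inner c b"
  using l2_inner_add_left[OF assms] l2_inner_cnj[OF l2_add(1)[OF assms(1,2)] assms(3)]
    l2_inner_cnj[OF assms(1,3)] l2_inner_cnj[OF assms(2,3)] by simp

lemma l2_inner_scale_right:
  assumes "a \<in> l2_space" "b \<in> l2_space"
  shows "l2_inner b (\<lambda>j. c * a j) = cnj c * l2_inner b a"
  using l2_inner_scale_left[OF assms, of c] l2_inner_cnj[OF l2_scale(1)[OF assms(1)] assms(2), of c]
    l2_inner_cnj[OF assms] by simp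

lemma l2_inner_self:
  assumes "a \<in> l2_space" shows "l2_inner a a = complex_of_real ((l2_norm a)\<^sup>2)"
proof -
  have "(\<lambda>j. (cmod (a j))\<^sup>2) sums (l2_norm a)\<^sup>2"
    unfolding l2_norm_power2[OF assms] using assms by (simp add: l2_space_def summable_sums)
  then have "(\<lambda>j. complex_of_real ((cmod (a j))\<^sup>2)) sums complex_of_real ((l2_norm a)\<^sup>2)"
    by (rule sums_of_real)
  then show ?thesis unfolding l2_inner_def by (simp add: sums_unique[symmetric] flip: complex_norm_square)
qed

definition unit_seq :: "nat \<Rightarrow> cseq" where
  "unit_seq j = (\<lambda>i. if i = j then 1 else 0)"

lemma unit_seq_eq [simp]: "unit_seq j j = 1" "i \<noteq> j \<Longrightarrow> unit_seq j i = 0"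
  by (auto simp: unit_seq_def)

lemma l2_inner_unit_right: "l2_inner a (unit_seq j) = a j"
proof -
  have "(\<lambda>i. a i * cnj (unit_seq j i)) sums (\<Sum>i\<in>{j}. a i * cnj (unit_seq j i))"
    by (rule sums_finite) auto
  then show ?thesis by (simp add: l2_inner_def sums_unique[symmetric])
qed

lemma l2_inner_unit_left: "l2_inner (unit_seq j) a = cnj (a j)"
proof -
  have "(\<lambda>i. unit_seq j i * cnj (a i)) sums (\<Sum>i\<in>{j}. unit_seq j i * cnj (a i))"
    by (rule sums_finite) auto
  then show ?thesis by (simp add: l2_inner_def sums_unique[symmetric])
qed


text \<open>The diagonal operator that carries the \<open>q\<close>-th norm of the power series
  space to the norm of l2, so that each graded estimate reduces to one for plain square summable
  sequences.\<close>

definition weigh :: "(nat \<Rightarrow> real) \<Rightarrow> nat \<Rightarrow> cseq \<Rightarrow> cseq" where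
  "weigh \<alpha> q \<xi> = (\<lambda>j. complex_of_real (exp (real q * \<alpha> j)) * \<xi> j)"

lemma norm_weigh: "cmod (weigh \<alpha> q \<xi> j) = exp (real q * \<alpha> j) * cmod (\<xi> j)"
  by (simp add: weigh_def norm_mult)

lemma norm_weigh_power2: "(cmod (weigh \<alpha> q \<xi> j))\<^sup>2 = (cmod (\<xi> j))\<^sup>2 * exp (2 * real q * \<alpha> j)"
proof -
  have "exp (2 * real q * \<alpha> j) = (exp (real q * \<alpha> j))\<^sup>2"
    by (simp add: power2_eq_square flip: exp_add)
  then show ?thesis by (simp add: norm_weigh power_mult_distrib)
qed

lemma psp_carrier_iff: "\<xi> \<in> psp_carrier \<alpha> \<longleftrightarrow> (\<forall>q. weigh \<alpha> q \<xi> \<in> l2_space)"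
  unfolding psp_carrier_def l2_space_def mem_Collect_eq norm_weigh_power2 ..

lemma psp_carrierD: "\<xi> \<in> psp_carrier \<alpha> \<Longrightarrow> weigh \<alpha> q \<xi> \<in> l2_space"
  by (simp add: psp_carrier_iff)

lemma psp_norm_eq: "psp_norm \<alpha> q \<xi> = l2_norm (weigh \<alpha> q \<xi>)"
  unfolding psp_norm_def l2_norm_def norm_weigh_power2 ..

lemma psp_norm_nonneg [simp]: "\<xi> \<in> psp_carrier \<alpha> \<Longrightarrow> 0 \<le> psp_norm \<alpha> q \<xi>"
  by (simp add: psp_norm_eq psp_carrierD)

lemma weigh_0 [simp]: "weigh \<alpha> 0 \<xi> = \<xi>"
  by (simp add: weigh_def)

lemma psp_l2: "\<xi> \<in> psp_carrier \<alpha> \<Longrightarrow> \<xi> \<in> l2_space"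
  using psp_carrierD[of \<xi> \<alpha> 0] by simp

lemma psp_norm_0: "psp_norm \<alpha> 0 \<xi> = l2_norm \<xi>"
  by (simp add: psp_norm_eq)

lemma weigh_add: "weigh \<alpha> q (\<lambda>j. \<xi> j + \<eta> j) = (\<lambda>j. weigh \<alpha> q \<xi> j + weigh \<alpha> q \<eta> j)"
  by (simp add: weigh_def algebra_simps)

lemma weigh_scale: "weigh \<alpha> q (\<lambda>j. c * \<xi> j) = (\<lambda>j. c * weigh \<alpha> q \<xi> j)"
  by (simp add: weigh_def algebra_simps)

lemma psp_add:
  assumes "\<xi> \<in> psp_carrier \<alpha>" "\<eta> \<in> psp_carrier \<alpha>"
  shows "(\<lambda>j. \<xi> j + \<eta> j) \<in> psp_carrier \<alpha>"
    "psp_norm \<alpha> q (\<lambda>j. \<xi> j + \<eta> j) \<le> psp_norm \<alpha> q \<xi> + psp_norm \<alpha> q \<eta>"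
  using assms by (auto simp: psp_carrier_iff psp_norm_eq weigh_add l2_add)

lemma psp_scale:
  assumes "\<xi> \<in> psp_carrier \<alpha>"
  shows "(\<lambda>j. c * \<xi> j) \<in> psp_carrier \<alpha>" "psp_norm \<alpha> q (\<lambda>j. c * \<xi> j) = cmod c * psp_norm \<alpha> q \<xi>"
  using assms by (auto simp: psp_carrier_iff psp_norm_eq weigh_scale l2_scale)

lemma psp_diff:
  assumes "\<xi> \<in> psp_carrier \<alpha>" "\<eta> \<in> psp_carrier \<alpha>"
  shows "(\<lambda>j. \<xi> j - \<eta> j) \<in> psp_carrier \<alpha>"
    "psp_norm \<alpha> q (\<lambda>j. \<xi> j - \<eta> j) \<le> psp_norm \<alpha> q \<xi> + psp_norm \<alpha> q \<eta>"
  using psp_add(1)[OF assms(1) psp_scale(1)[OF assms(2), of "-1"]]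
    psp_add(2)[OF assms(1) psp_scale(1)[OF assms(2), of "-1"], of q]
    psp_scale(2)[OF assms(2), of q "-1"] by auto

lemma psp_norm_uminus: "psp_norm \<alpha> q (\<lambda>j. \<eta> j - \<xi> j) = psp_norm \<alpha> q (\<lambda>j. \<xi> j - \<eta> j)"
  by (simp add: psp_norm_def norm_minus_commute)

lemma psp_zero [simp]: "(\<lambda>_. 0) \<in> psp_carrier \<alpha>" "psp_norm \<alpha> q (\<lambda>_. 0) = 0"
  by (auto simp: psp_carrier_def psp_norm_def)

lemma psp_sum:
  assumes "finite I" "\<And>i. i \<in> I \<Longrightarrow> F i \<in> psp_carrier \<alpha>"
  shows "(\<lambda>j. \<Sum>i\<in>I. F i j) \<in> psp_carrier \<alpha> \<and>
    psp_norm \<alpha> q (\<lambda>j. \<Sum>i\<in>I. F i j) \<le> (\<Sum>i\<in>I. psp_norm \<alpha> q (F i))"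
  using assms
proof (induction I rule: finite_induct)
  case (insert x A)
  then have x: "F x \<in> psp_carrier \<alpha>" and A: "(\<lambda>j. \<Sum>i\<in>A. F i j) \<in> psp_carrier \<alpha>"
    "psp_norm \<alpha> q (\<lambda>j. \<Sum>i\<in>A. F i j) \<le> (\<Sum>i\<in>A. psp_norm \<alpha> q (F i))" by auto
  show ?case using psp_add(1)[OF x A(1)] psp_add(2)[OF x A(1), of q] A(2) insert.hyps by simp
qed auto

lemma psp_coordinate:
  assumes "\<xi> \<in> psp_carrier \<alpha>"
  shows "exp (real q * \<alpha> j) * cmod (\<xi> j) \<le> psp_norm \<alpha> q \<xi>"
  using l2_norm_coordinate[OF psp_carrierD[OF assms], of q j] by (simp add: norm_weigh psp_norm_eq)

lemma psp_norm_mono: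
  assumes "\<xi> \<in> psp_carrier \<alpha>" "\<And>j. 0 \<le> \<alpha> j" "q \<le> r"
  shows "psp_norm \<alpha> q \<xi> \<le> psp_norm \<alpha> r \<xi>"
proof -
  have "l2_norm (weigh \<alpha> q \<xi>) \<le> 1 * l2_norm (weigh \<alpha> r \<xi>)"
    by (rule l2_comparison(2)[OF psp_carrierD[OF assms(1)]])
      (auto simp: norm_weigh assms intro!: mult_right_mono)
  then show ?thesis by (simp add: psp_norm_eq)
qed

text \<open>Cauchy-Schwarz for \<open>\<xi>\<close> and its weighted copy of index
  \<open>2 * q\<close>: the square of the weight of index \<open>q\<close> is the weight of index
  \<open>2 * q\<close> times 1. For \<open>s\<close> it says that the l2 norm is dominating.\<close>

lemma psp_interpolation:
  assumes "\<xi> \<in> psp_carrier \<alpha>"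
  shows "(psp_norm \<alpha> q \<xi>)\<^sup>2 \<le> psp_norm \<alpha> 0 \<xi> * psp_norm \<alpha> (2 * q) \<xi>"
proof -
  have "(psp_norm \<alpha> q \<xi>)\<^sup>2 = (\<Sum>j. (cmod (weigh \<alpha> q \<xi> j))\<^sup>2)"
    unfolding psp_norm_eq by (rule l2_norm_power2[OF psp_carrierD[OF assms]])
  also have "\<dots> = (\<Sum>j. cmod (\<xi> j * cnj (weigh \<alpha> (2 * q) \<xi> j)))"
    unfolding norm_weigh_power2 by (simp add: norm_mult norm_weigh power2_eq_square algebra_simps)
  also have "\<dots> \<le> l2_norm \<xi> * l2_norm (weigh \<alpha> (2 * q) \<xi>)"
    by (rule l2_inner_summable(2)[OF psp_l2[OF assms] psp_carrierD[OF assms]])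
  finally show ?thesis by (simp add: psp_norm_eq)
qed

section \<open>Unit vectors, tails, and passage between pointwise and square sum bounds\<close>

lemma psp_unit [simp]: "unit_seq j \<in> psp_carrier \<alpha>"
proof -
  have "(\<lambda>i. (cmod (unit_seq j i))\<^sup>2 * exp (2 * real q * \<alpha> i)) sums
     (\<Sum>i\<in>{j}. (cmod (unit_seq j i))\<^sup>2 * exp (2 * real q * \<alpha> i))" for q
    by (rule sums_finite) auto
  then show ?thesis unfolding psp_carrier_def summable_def by blast
qed

lemma psp_eqI_norm: "\<xi> \<in> psp_carrier \<alpha> \<Longrightarrow> psp_norm \<alpha> q \<xi> = 0 \<Longrightarrow> \<xi> = (\<lambda>_. 0)"
proof
  fix j assume "\<xi> \<in> psp_carrier \<alpha>" "psp_norm \<alpha> q \<xi> = 0"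
  then have "exp (real q * \<alpha> j) * cmod (\<xi> j) \<le> 0" using psp_coordinate[of \<xi> \<alpha> q j] by simp
  then show "\<xi> j = 0" by (smt (verit) exp_gt_zero mult_pos_pos norm_le_zero_iff zero_less_norm_iff)
qed

definition tail_seq :: "nat \<Rightarrow> cseq \<Rightarrow> cseq" where
  "tail_seq n \<xi> = (\<lambda>j. if j < n then 0 else \<xi> j)"

lemma head_plus_tail: "\<xi> = (\<lambda>j. (\<Sum>i<n. \<xi> i * unit_seq i j) + tail_seq n \<xi> j)"
proof
  fix j
  have "(\<Sum>i<n. \<xi> i * unit_seq i j) = (\<Sum>i<n. if i = j then \<xi> j else 0)"
    by (intro sum.cong) (auto simp: unit_seq_def)
  then show "\<xi> j = (\<Sum>i<n. \<xi> i * unit_seq i j) + tail_seq n \<xi> j"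
    by (simp add: tail_seq_def)
qed

lemma head_seq_psp: "(\<lambda>j. \<Sum>i<n. \<xi> i * unit_seq i j) \<in> psp_carrier \<alpha>"
  using psp_sum[of "{..<n}" "\<lambda>i j. \<xi> i * unit_seq i j" \<alpha>] psp_scale(1)[OF psp_unit] by auto

lemma tail_seq_psp:
  assumes "\<xi> \<in> psp_carrier \<alpha>"
  shows "tail_seq n \<xi> \<in> psp_carrier \<alpha>"
  unfolding psp_carrier_iff
proof
  fix q show "weigh \<alpha> q (tail_seq n \<xi>) \<in> l2_space"
    by (rule l2_comparison(1)[OF psp_carrierD[OF assms, of q], of _ 1]) (auto simp: norm_weigh tail_seq_def)
qed

text \<open>From position \<open>n\<close> on, \<open>exp (m \<alpha> j)\<close> is at least
  \<open>exp (m \<alpha> n)\<close>, so each further index of smoothness gains a factor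
  \<open>exp (- \<alpha> n)\<close>. This is the source of the approximation estimate
  \<open>jackson\<close>.\<close>

lemma tail_seq_decay:
  assumes "\<xi> \<in> psp_carrier \<alpha>" "incseq \<alpha>"
  shows "psp_norm \<alpha> q (tail_seq n \<xi>) \<le> exp (- real m * \<alpha> n) * psp_norm \<alpha> (q + m) \<xi>"
  unfolding psp_norm_eq
proof (rule l2_comparison(2)[OF psp_carrierD[OF assms(1)]])
  fix j
  show "cmod (weigh \<alpha> q (tail_seq n \<xi>) j) \<le> exp (- real m * \<alpha> n) * cmod (weigh \<alpha> (q + m) \<xi> j)"
  proof (cases "j < n")
    case False
    then have "\<alpha> n \<le> \<alpha> j" using assms(2) by (simp add: incseq_def)
    then have "real m * \<alpha> n \<le> real m * \<alpha> j" by (simp add: mult_left_mono)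
    then have "exp (real q * \<alpha> j) \<le> exp (- real m * \<alpha> n + real (q + m) * \<alpha> j)"
      by (simp add: algebra_simps)
    then have "exp (real q * \<alpha> j) * cmod (\<xi> j) \<le> exp (- real m * \<alpha> n + real (q + m) * \<alpha> j) * cmod (\<xi> j)"
      by (rule mult_right_mono) auto
    then show ?thesis using False unfolding exp_add by (simp add: norm_weigh tail_seq_def)
  qed (simp add: tail_seq_def norm_weigh)
qed auto

lemma tail_seq_tendsto:
  assumes "\<xi> \<in> psp_carrier \<alpha>"
  shows "(\<lambda>n. psp_norm \<alpha> q (tail_seq n \<xi>)) \<longlonglongrightarrow> 0"
proof -
  let ?f = "\<lambda>j. (cmod (\<xi> j))\<^sup>2 * exp (2 * real q * \<alpha> j)"
  have s: "summable ?f" using assms by (auto simp: psp_carrier_def)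
  \<comment> \<open>The norm of a tail is the square root of a remainder of the convergent series
    \<open>?f\<close>.\<close>
  have "psp_norm \<alpha> q (tail_seq n \<xi>) = sqrt (suminf ?f - (\<Sum>j<n. ?f j))" for n
  proof -
    have st: "summable (\<lambda>j. (cmod (tail_seq n \<xi> j))\<^sup>2 * exp (2 * real q * \<alpha> j))"
      using tail_seq_psp[OF assms] by (auto simp: psp_carrier_def)
    have "(\<Sum>j. (cmod (tail_seq n \<xi> j))\<^sup>2 * exp (2 * real q * \<alpha> j))
       = (\<Sum>j. ?f (j + n))"
      using suminf_split_initial_segment[OF st, of n] by (simp add: tail_seq_def)
    then show ?thesis using suminf_split_initial_segment[OF s, of n] by (simp add: psp_norm_def)
  qed
  moreover have "(\<lambda>n. sqrt (suminf ?f - (\<Sum>j<n. ?f j))) \<longlonglongrightarrow> sqrt (suminf ?f - suminf ?f)"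
    by (intro tendsto_intros summable_LIMSEQ s)
  ultimately show ?thesis by simp
qed

text \<open>A pointwise bound with weight \<open>q + k\<close> gives a square sum with weight
  \<open>q\<close>; the remaining factor \<open>exp (- 2 k \<alpha> j)\<close> is summable for
  suitable \<open>k\<close> by nuclearity. In this way supremum norms and Hilbert norms define the
  same space.\<close>

lemma weighted_power2_le:
  assumes "cmod (\<xi> j) \<le> D * exp (- real (q + k) * \<alpha> j)"
  shows "(cmod (\<xi> j))\<^sup>2 * exp (2 * real q * \<alpha> j) \<le> D\<^sup>2 * exp (- 2 * real k * \<alpha> j)"
proof -
  have "(cmod (\<xi> j))\<^sup>2 * exp (2 * real q * \<alpha> j)
      \<le> (D * exp (- real (q + k) * \<alpha> j))\<^sup>2 * exp (2 * real q * \<alpha> j)"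
    by (intro mult_right_mono power_mono assms) auto
  also have "\<dots> = D\<^sup>2 * exp (- 2 * real k * \<alpha> j)"
    by (simp add: power_mult_distrib power2_eq_square algebra_simps flip: exp_add)
  finally show ?thesis .
qed

lemma summable_of_coordinate_bounds:
  assumes "summable (\<lambda>j. exp (- 2 * real k * \<alpha> j))"
    and D: "\<And>j. cmod (\<xi> j) \<le> D * exp (- real (q + k) * \<alpha> j)"
  shows "summable (\<lambda>j. (cmod (\<xi> j))\<^sup>2 * exp (2 * real q * \<alpha> j))"
  by (rule summable_comparison_test'[OF summable_mult[OF assms(1), of "D\<^sup>2"], of 0])
    (use weighted_power2_le[of \<xi> _ D q k \<alpha>, OF D] in auto)

lemma psp_of_coordinate_bounds:
  assumes "summable (\<lambda>j. exp (- 2 * real k * \<alpha> j))"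
    and "\<And>q. \<exists>D. \<forall>j. cmod (\<xi> j) \<le> D * exp (- real q * \<alpha> j)"
  shows "\<xi> \<in> psp_carrier \<alpha>"
  unfolding psp_carrier_def
proof (intro CollectI allI)
  fix q
  obtain D where "\<And>j. cmod (\<xi> j) \<le> D * exp (- real (q + k) * \<alpha> j)"
    using assms(2)[of "q + k"] by blast
  then show "summable (\<lambda>j. (cmod (\<xi> j))\<^sup>2 * exp (2 * real q * \<alpha> j))"
    by (rule summable_of_coordinate_bounds[OF assms(1)])
qed

lemma psp_norm_of_coordinate_bounds:
  assumes "summable (\<lambda>j. exp (- 2 * real k * \<alpha> j))" "0 \<le> D"
    and D: "\<And>j. cmod (\<xi> j) \<le> D * exp (- real (q + k) * \<alpha> j)"
  shows "psp_norm \<alpha> q \<xi> \<le> D * sqrt (\<Sum>j. exp (- 2 * real k * \<alpha> j))"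
proof -
  have "(\<Sum>j. (cmod (\<xi> j))\<^sup>2 * exp (2 * real q * \<alpha> j)) \<le> (\<Sum>j. D\<^sup>2 * exp (- 2 * real k * \<alpha> j))"
    by (rule suminf_le[OF weighted_power2_le[of \<xi> _ D q k \<alpha>, OF D] summable_of_coordinate_bounds[OF assms(1) D]
          summable_mult[OF assms(1)]])
  also have "\<dots> = D\<^sup>2 * (\<Sum>j. exp (- 2 * real k * \<alpha> j))" by (rule suminf_mult[OF assms(1)])
  finally have "psp_norm \<alpha> q \<xi> \<le> sqrt (D\<^sup>2 * (\<Sum>j. exp (- 2 * real k * \<alpha> j)))"
    unfolding psp_norm_def by (rule real_sqrt_le_mono)
  then show ?thesis using assms(2) by (simp add: real_sqrt_mult)
qed

text \<open>Finite sequences are dense: the head of \<open>\<xi>\<close> is mapped to zero and the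
  tail tends to zero. Identities between continuous linear expressions are later checked on unit
  vectors by means of this.\<close>

lemma psp_functional_zero:
  assumes add: "\<And>\<xi> \<eta>. \<xi> \<in> psp_carrier \<alpha> \<Longrightarrow> \<eta> \<in> psp_carrier \<alpha> \<Longrightarrow> \<phi> (\<lambda>j. \<xi> j + \<eta> j) = \<phi> \<xi> + (\<phi> \<eta> :: complex)"
    and scale: "\<And>\<xi> c. \<xi> \<in> psp_carrier \<alpha> \<Longrightarrow> \<phi> (\<lambda>j. c * \<xi> j) = c * \<phi> \<xi>"
    and bound: "\<And>\<xi>. \<xi> \<in> psp_carrier \<alpha> \<Longrightarrow> cmod (\<phi> \<xi>) \<le> C * psp_norm \<alpha> q \<xi>"
    and unit: "\<And>j. \<phi> (unit_seq j) = 0" and \<xi>: "\<xi> \<in> psp_carrier \<alpha>"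
  shows "\<phi> \<xi> = 0"
proof -
  have head: "\<phi> (\<lambda>j. \<Sum>i<n. \<xi> i * unit_seq i j) = 0" for n
  proof (induction n)
    case 0
    then show ?case using scale[of "\<lambda>_. 0" 0] by simp
  next
    case (Suc n)
    have "\<phi> (\<lambda>j. (\<Sum>i<n. \<xi> i * unit_seq i j) + \<xi> n * unit_seq n j) = 0"
      using add[OF head_seq_psp psp_scale(1)[OF psp_unit]] Suc scale[OF psp_unit] unit by simp
    then show ?case by simp
  qed
  have "cmod (\<phi> \<xi>) \<le> C * psp_norm \<alpha> q (tail_seq n \<xi>)" for n
  proof -
    have "\<phi> \<xi> = \<phi> (\<lambda>j. \<Sum>i<n. \<xi> i * unit_seq i j) + \<phi> (tail_seq n \<xi>)"
      by (subst head_plus_tail[of \<xi> n]) (rule add[OF head_seq_psp tail_seq_psp[OF \<xi>]])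
    then show ?thesis using bound[OF tail_seq_psp[OF \<xi>]] head by simp
  qed
  moreover have "(\<lambda>n. C * psp_norm \<alpha> q (tail_seq n \<xi>)) \<longlonglongrightarrow> C * 0"
    by (intro tendsto_intros tail_seq_tendsto \<xi>)
  ultimately have "cmod (\<phi> \<xi>) \<le> C * 0"
    by (intro LIMSEQ_le_const[of "\<lambda>n. C * psp_norm \<alpha> q (tail_seq n \<xi>)"]) auto
  then show ?thesis by simp
qed


section \<open>Power series spaces\<close>

lemma psp_sel [simp]:
  "carrier (power_series_space \<alpha>) = psp_carrier \<alpha>"
  "\<zero>\<^bsub>power_series_space \<alpha>\<^esub> = (\<lambda>_. 0)"
  "\<xi> \<oplus>\<^bsub>power_series_space \<alpha>\<^esub> \<eta> = (\<lambda>j. \<xi> j + \<eta> j)"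
  "c \<odot>\<^bsub>power_series_space \<alpha>\<^esub> \<xi> = (\<lambda>j. c * \<xi> j)"
  "topol (power_series_space \<alpha>) =
     seminorm_topology (psp_carrier \<alpha>) (\<lambda>\<xi> \<eta> j. \<xi> j - \<eta> j) (range (psp_norm \<alpha>))"
  by (simp_all add: power_series_space_def)

lemma module_power_series_space: "Module.module complex_field (power_series_space \<alpha>)"
proof (intro moduleI abelian_groupI cring_complex_field)
  fix x assume "x \<in> carrier (power_series_space \<alpha>)"
  then show "\<exists>y\<in>carrier (power_series_space \<alpha>).
      y \<oplus>\<^bsub>power_series_space \<alpha>\<^esub> x = \<zero>\<^bsub>power_series_space \<alpha>\<^esub>"
    by (intro bexI[of _ "\<lambda>j. (- 1) * x j"]) (auto intro: psp_scale(1)[of x \<alpha> "-1", simplified])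
qed (auto simp: psp_add psp_scale algebra_simps)

lemma seminorm_on_psp_norm: "seminorm_on (power_series_space \<alpha>) (psp_norm \<alpha> q)"
  by (auto simp: seminorm_on_def psp_scale psp_add)

lemma seminormed_space_psp:
  assumes "\<And>j. 0 \<le> \<alpha> j"
  shows "seminormed_space (power_series_space \<alpha>) (range (psp_norm \<alpha>))"
proof (rule seminormed_space_seminorm_topology[OF module_power_series_space])
  show "topol (power_series_space \<alpha>) = seminorm_topology (carrier (power_series_space \<alpha>))
      (\<lambda>\<xi> \<eta> j. \<xi> j - \<eta> j) (range (psp_norm \<alpha>))" by simp
  fix p q assume "p \<in> range (psp_norm \<alpha>)" "q \<in> range (psp_norm \<alpha>)"
  then obtain m n where "p = psp_norm \<alpha> m" "q = psp_norm \<alpha> n" by auto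
  then show "\<exists>r\<in>range (psp_norm \<alpha>). \<forall>x\<in>carrier (power_series_space \<alpha>). p x \<le> r x \<and> q x \<le> r x"
    by (intro bexI[of _ "psp_norm \<alpha> (max m n)"]) (auto intro!: psp_norm_mono assms)
qed (auto simp: seminorm_on_psp_norm psp_diff)

lemma seminormed_space_via_psp:
  assumes "\<And>j. 0 \<le> \<alpha> j" "Module.module complex_field V" "topspace (topol V) = carrier V"
    and iso: "tvs_isomorphism V (power_series_space \<alpha>) \<Phi>"
  shows "seminormed_space V ((\<lambda>q x. q (\<Phi> x)) ` range (psp_norm \<alpha>))"
proof (rule seminormed_space_embedding[OF seminormed_space_psp[OF assms(1)] assms(2,3)])
  interpret P: seminormed_space "power_series_space \<alpha>" "range (psp_norm \<alpha>)"
    by (rule seminormed_space_psp[OF assms(1)])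
  have bij: "bij_betw \<Phi> (carrier V) (carrier (power_series_space \<alpha>))"
    using iso unfolding tvs_isomorphism_def by blast
  show "clinear_map V (power_series_space \<alpha>) \<Phi>" using iso unfolding tvs_isomorphism_def by blast
  show "inj_on \<Phi> (carrier V)" using bij by (rule bij_betw_imp_inj_on)
  have "subtopology (topol (power_series_space \<alpha>)) (\<Phi> ` carrier V) = topol (power_series_space \<alpha>)"
    unfolding bij_betw_imp_surj_on[OF bij]
    by (rule subtopology_superset) (simp only: P.topspace_carrier order_refl)
  then show "homeomorphic_map (topol V) (subtopology (topol (power_series_space \<alpha>)) (\<Phi> ` carrier V)) \<Phi>"
    using iso unfolding tvs_isomorphism_def by simp
qed

lemma a_inv_psp:
  assumes "\<xi> \<in> psp_carrier \<alpha>"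
  shows "\<ominus>\<^bsub>power_series_space \<alpha>\<^esub> \<xi> = (\<lambda>j. - \<xi> j)"
proof -
  interpret Module.module complex_field "power_series_space \<alpha>" by (rule module_power_series_space)
  have "(\<lambda>j. - \<xi> j) \<in> psp_carrier \<alpha>" using psp_scale(1)[OF assms, of "-1"] by simp
  then show ?thesis using assms by (intro minus_equality) auto
qed

lemma a_minus_psp:
  assumes "\<xi> \<in> psp_carrier \<alpha>" "\<eta> \<in> psp_carrier \<alpha>"
  shows "\<xi> \<ominus>\<^bsub>power_series_space \<alpha>\<^esub> \<eta> = (\<lambda>j. \<xi> j - \<eta> j)"
  using assms by (simp add: a_minus_def a_inv_psp)

lemma finsum_psp:
  assumes "\<And>n. F n \<in> psp_carrier \<alpha>"
  shows "finsum (power_series_space \<alpha>) F {..<N::nat} = (\<lambda>j. \<Sum>n<N. F n j)"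
proof -
  interpret Module.module complex_field "power_series_space \<alpha>" by (rule module_power_series_space)
  show ?thesis
  proof (induction N)
    case (Suc N)
    have "finsum (power_series_space \<alpha>) F {..<Suc N}
      = F N \<oplus>\<^bsub>power_series_space \<alpha>\<^esub> finsum (power_series_space \<alpha>) F {..<N}"
      unfolding lessThan_Suc by (rule finsum_insert) (use assms in auto)
    then show ?case using Suc by (simp add: add.commute)
  qed simp
qed

text \<open>The trace of the diagonal operator with entries \<open>exp (- k \<alpha>\<^sub>j)\<close> is computed from a
  nuclear representation of the linking map between the \<open>k\<close>-th and the \<open>0\<close>-th local space.\<close>

lemma nuclear_imp_summable:
  assumes pos: "\<And>j. 0 \<le> \<alpha> j" and nuc: "nuclear_space (power_series_space \<alpha>)"
  obtains k :: nat where "summable (\<lambda>j. exp (- real k * \<alpha> j))"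
proof -
  interpret seminormed_space "power_series_space \<alpha>" "range (psp_norm \<alpha>)"
    by (rule seminormed_space_psp[OF pos])
  have "continuous_seminorm (power_series_space \<alpha>) (psp_norm \<alpha> 0)"
    by (rule continuous_seminormI[of _ "psp_norm \<alpha> 0" 1]) (auto simp: seminorm_on_psp_norm)
  then obtain q where q: "continuous_seminorm (power_series_space \<alpha>) q"
    and ex: "\<exists>(l :: nat \<Rightarrow> complex) (f :: nat \<Rightarrow> cseq \<Rightarrow> complex) (y :: nat \<Rightarrow> cseq).
             summable (\<lambda>n. cmod (l n)) \<and>
             (\<forall>n. linear_functional (power_series_space \<alpha>) (f n) \<and> (\<forall>x\<in>psp_carrier \<alpha>. cmod (f n x) \<le> q x)) \<and>
             (\<forall>n. y n \<in> psp_carrier \<alpha> \<and> psp_norm \<alpha> 0 (y n) \<le> 1) \<and>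
             (\<forall>x\<in>psp_carrier \<alpha>. (\<lambda>N. psp_norm \<alpha> 0 (x \<ominus>\<^bsub>power_series_space \<alpha>\<^esub>
        finsum (power_series_space \<alpha>) (\<lambda>n. (l n * f n x) \<odot>\<^bsub>power_series_space \<alpha>\<^esub> y n) {..<N})) \<longlonglongrightarrow> 0)"
    using nuc[unfolded nuclear_space_def psp_sel(1), rule_format, of "psp_norm \<alpha> 0"] by blast
  from ex obtain l f y where l: "summable (\<lambda>n. cmod (l n))"
    and f: "\<And>n. linear_functional (power_series_space \<alpha>) (f n)"
    and fq: "\<And>n x. x \<in> psp_carrier \<alpha> \<Longrightarrow> cmod (f n x) \<le> q x"
    and y: "\<And>n. y n \<in> psp_carrier \<alpha>" "\<And>n. psp_norm \<alpha> 0 (y n) \<le> 1"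
    and lim: "\<And>x. x \<in> psp_carrier \<alpha> \<Longrightarrow> (\<lambda>N. psp_norm \<alpha> 0 (x \<ominus>\<^bsub>power_series_space \<alpha>\<^esub>
        finsum (power_series_space \<alpha>) (\<lambda>n. (l n * f n x) \<odot>\<^bsub>power_series_space \<alpha>\<^esub> y n) {..<N})) \<longlonglongrightarrow> 0"
    by blast
  obtain p C where p: "p \<in> range (psp_norm \<alpha>)" "C > 0" "\<And>x. x \<in> psp_carrier \<alpha> \<Longrightarrow> q x \<le> C * p x"
    using continuous_seminormD[OF q] by auto
  then obtain k where k: "\<And>x. x \<in> psp_carrier \<alpha> \<Longrightarrow> q x \<le> C * psp_norm \<alpha> k x" by auto
  \<comment> \<open>Convergence in l2 gives convergence of coordinates. For
    \<open>x = unit_seq j\<close> the coordinate \<open>j\<close> of the representation converges to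
    1, the diagonal entry of the identity.\<close>
  have coord: "(\<lambda>N. \<Sum>n<N. l n * f n x * y n j) \<longlonglongrightarrow> x j" if x: "x \<in> psp_carrier \<alpha>" for x j
  proof -
    have s: "(\<lambda>j. \<Sum>n<N. l n * f n x * y n j) \<in> psp_carrier \<alpha>" for N
      using psp_sum[of "{..<N}" "\<lambda>n j. l n * f n x * y n j" \<alpha>] psp_scale(1)[OF y(1)] by auto
    have eq: "x \<ominus>\<^bsub>power_series_space \<alpha>\<^esub>
        finsum (power_series_space \<alpha>) (\<lambda>n. (l n * f n x) \<odot>\<^bsub>power_series_space \<alpha>\<^esub> y n) {..<N}
        = (\<lambda>j. x j - (\<Sum>n<N. l n * f n x * y n j))" for N
      by (subst finsum_psp) (auto simp: psp_scale y a_minus_psp x s)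
    have z: "(\<lambda>N. psp_norm \<alpha> 0 (\<lambda>j. x j - (\<Sum>n<N. l n * f n x * y n j))) \<longlonglongrightarrow> 0"
      using lim[OF x] unfolding eq .
    have "cmod (x j - (\<Sum>n<N. l n * f n x * y n j))
        \<le> psp_norm \<alpha> 0 (\<lambda>j. x j - (\<Sum>n<N. l n * f n x * y n j))" for N
      using psp_coordinate[OF psp_diff(1)[OF x s[of N]], of 0 j] by simp
    then have "(\<lambda>N. x j - (\<Sum>n<N. l n * f n x * y n j)) \<longlonglongrightarrow> 0"
      by (intro Lim_null_comparison[OF always_eventually z] allI)
    from tendsto_diff[OF tendsto_const[of "x j"] this] show ?thesis by simp
  qed
  have fadd: "f n (\<lambda>j. a j + b j) = f n a + f n b" if "a \<in> psp_carrier \<alpha>" "b \<in> psp_carrier \<alpha>" for n a b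
    using f[of n] that by (auto simp: linear_functional_def)
  have fscale: "f n (\<lambda>j. c * a j) = c * f n a" if "a \<in> psp_carrier \<alpha>" for n a c
    using f[of n] that by (auto simp: linear_functional_def)
  \<comment> \<open>\<open>g n J\<close> is the diagonal operator, cut off at \<open>J\<close>,
    applied to \<open>y n\<close>. Its \<open>k\<close>-th norm is at most the l2 norm of
    \<open>y n\<close>, because the weights of index \<open>k\<close> cancel the diagonal
    entries.\<close>
  define g where "g n J = (\<lambda>i. \<Sum>j<J. complex_of_real (exp (- real k * \<alpha> j)) * y n j * unit_seq j i)" for n J
  have g: "g n J \<in> psp_carrier \<alpha>" for n J
    using head_seq_psp[of "\<lambda>j. complex_of_real (exp (- real k * \<alpha> j)) * y n j" J] by (simp add: g_def)
  have fg: "f n (g n J) = (\<Sum>j<J. complex_of_real (exp (- real k * \<alpha> j)) * y n j * f n (unit_seq j))" for n J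
  proof (induction J)
    case 0
    show ?case using fscale[of "\<lambda>_. 0" n 0] by (simp add: g_def)
  next
    case (Suc J)
    have "g n (Suc J) = (\<lambda>i. g n J i + complex_of_real (exp (- real k * \<alpha> J)) * y n J * unit_seq J i)"
      by (simp add: g_def)
    then show ?case using fadd[OF g psp_scale(1)[OF psp_unit]] fscale[OF psp_unit] Suc by simp
  qed
  have gk: "psp_norm \<alpha> k (g n J) \<le> 1" for n J
  proof -
    have gi: "g n J i = (if i < J then complex_of_real (exp (- real k * \<alpha> i)) * y n i else 0)" for i
    proof -
      have "g n J i = (\<Sum>j<J. if j = i then complex_of_real (exp (- real k * \<alpha> i)) * y n i else 0)"
        unfolding g_def by (intro sum.cong) (auto simp: unit_seq_def)
      then show ?thesis by simp
    qed
    have "l2_norm (weigh \<alpha> k (g n J)) \<le> 1 * l2_norm (y n)"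
      by (rule l2_comparison(2)[OF psp_l2[OF y(1)]])
        (auto simp: norm_weigh gi norm_mult norm_divide exp_minus field_simps)
    then show ?thesis using y(2)[of n] by (simp add: psp_norm_eq)
  qed
  have fgC: "cmod (f n (g n J)) \<le> C" for n J
  proof -
    have "cmod (f n (g n J)) \<le> C * psp_norm \<alpha> k (g n J)"
      using fq[OF g, of n n J] k[OF g, of n J] by linarith
    also have "\<dots> \<le> C * 1" using gk p(2) by (intro mult_left_mono) auto
    finally show ?thesis by simp
  qed
  have "(\<Sum>j<J. exp (- real k * \<alpha> j)) \<le> C * (\<Sum>n. cmod (l n))" for J
  proof -
    have "(\<lambda>N. \<Sum>j<J. complex_of_real (exp (- real k * \<alpha> j)) * (\<Sum>n<N. l n * f n (unit_seq j) * y n j))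
        \<longlonglongrightarrow> (\<Sum>j<J. complex_of_real (exp (- real k * \<alpha> j)) * unit_seq j j)"
      by (intro tendsto_intros coord psp_unit)
    \<comment> \<open>Exchanging the sums evaluates the partial trace through the numbers
      \<open>l n * f n (g n J)\<close>, which are bounded by \<open>C * cmod (l n)\<close>
      independently of \<open>J\<close>.\<close>
    moreover have "(\<Sum>j<J. complex_of_real (exp (- real k * \<alpha> j)) * (\<Sum>n<N. l n * f n (unit_seq j) * y n j))
        = (\<Sum>n<N. l n * f n (g n J))" for N
      unfolding fg sum_distrib_left by (subst sum.swap) (simp add: algebra_simps)
    ultimately have "(\<lambda>N. \<Sum>n<N. l n * f n (g n J)) \<longlonglongrightarrow> complex_of_real (\<Sum>j<J. exp (- real k * \<alpha> j))"
      by simp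
    then have "(\<lambda>N. cmod (\<Sum>n<N. l n * f n (g n J))) \<longlonglongrightarrow> cmod (complex_of_real (\<Sum>j<J. exp (- real k * \<alpha> j)))"
      by (rule tendsto_norm)
    moreover have "cmod (\<Sum>n<N. l n * f n (g n J)) \<le> C * (\<Sum>n. cmod (l n))" for N
    proof -
      have "cmod (\<Sum>n<N. l n * f n (g n J)) \<le> (\<Sum>n<N. C * cmod (l n))"
        using fgC by (intro sum_norm_le) (simp add: norm_mult mult.commute[of C] mult_left_mono)
      also have "\<dots> = C * (\<Sum>n<N. cmod (l n))" by (simp add: sum_distrib_left)
      also have "\<dots> \<le> C * (\<Sum>n. cmod (l n))"
        using p(2) by (intro mult_left_mono sum_le_suminf l) auto
      finally show ?thesis .
    qed
    ultimately have "cmod (complex_of_real (\<Sum>j<J. exp (- real k * \<alpha> j))) \<le> C * (\<Sum>n. cmod (l n))"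
      by (intro LIMSEQ_le_const2) auto
    then show ?thesis by (simp add: sum_nonneg del: of_real_sum)
  qed
  then have "summable (\<lambda>j. exp (- real k * \<alpha> j))"
    by (intro summableI_nonneg_bounded) auto
  then show thesis by (rule that)
qed

text \<open>Completeness in the form needed for Baire type arguments: the \<open>n\<close>-th ball
  uses its own norm, of index \<open>r n \<ge> n\<close>, and the coordinatewise limit of the
  centres lies in all these closed balls.\<close>

lemma psp_nested_balls:
  assumes pos: "\<And>j. 0 \<le> \<alpha> j"
    and S: "\<And>n. S n \<in> psp_carrier \<alpha>" and r: "\<And>n. n \<le> r n" and d: "\<And>n. 0 \<le> \<delta> n" "\<delta> \<longlonglongrightarrow> 0"
    and nest: "\<And>m n. n \<le> m \<Longrightarrow> psp_norm \<alpha> (r n) (\<lambda>j. S m j - S n j) \<le> \<delta> n"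
  obtains y where "y \<in> psp_carrier \<alpha>" "\<And>n. psp_norm \<alpha> (r n) (\<lambda>j. y j - S n j) \<le> \<delta> n"
proof -
  have c1: "cmod (S m j - S n j) \<le> \<delta> n" if "n \<le> m" for m n j
  proof -
    have "cmod (S m j - S n j) \<le> exp (real (r n) * \<alpha> j) * cmod (S m j - S n j)"
      using mult_right_mono[of 1 "exp (real (r n) * \<alpha> j)" "cmod (S m j - S n j)"] pos[of j] by simp
    also have "\<dots> \<le> \<delta> n"
      using psp_coordinate[OF psp_diff(1)[OF S S], of "r n" j m n] nest[OF that] by simp
    finally show ?thesis .
  qed
  have "Cauchy (\<lambda>n. S n j)" for j
  proof (rule CauchyI)
    fix e :: real assume "e > 0"
    then have "\<forall>\<^sub>F n in sequentially. \<delta> n < e / 2" using d(2) by (intro order_tendstoD(2)) auto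
    then obtain N where N: "\<delta> N < e / 2" by (auto simp: eventually_sequentially)
    have "norm (S m j - S n j) < e" if "N \<le> m" "N \<le> n" for m n
    proof -
      have "norm (S m j - S n j) \<le> norm (S m j - S N j) + norm (S n j - S N j)"
        using norm_triangle_ineq4[of "S m j - S N j" "S n j - S N j"] by simp
      then show ?thesis using c1[OF that(1), of j] c1[OF that(2), of j] N by linarith
    qed
    then show "\<exists>M. \<forall>m\<ge>M. \<forall>n\<ge>M. norm (S m j - S n j) < e" by blast
  qed
  then have "\<exists>l. (\<lambda>n. S n j) \<longlonglongrightarrow> l" for j by (simp add: Cauchy_convergent_iff convergent_def)
  then obtain y where y: "\<And>j. (\<lambda>n. S n j) \<longlonglongrightarrow> y j" by metis
  \<comment> \<open>Finite sums are continuous in the coordinates, so the bound by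
    \<open>\<delta> n\<close> survives the limit in \<open>m\<close>; bounded partial sums then
    yield square summability.\<close>
  have fin: "(\<Sum>j<J. (cmod (weigh \<alpha> (r n) (\<lambda>j. y j - S n j) j))\<^sup>2) \<le> (\<delta> n)\<^sup>2" for n J
  proof (rule LIMSEQ_le_const2)
    show "(\<lambda>m. \<Sum>j<J. (cmod (weigh \<alpha> (r n) (\<lambda>j. S m j - S n j) j))\<^sup>2) \<longlonglongrightarrow>
      (\<Sum>j<J. (cmod (weigh \<alpha> (r n) (\<lambda>j. y j - S n j) j))\<^sup>2)"
      unfolding weigh_def by (intro tendsto_intros y)
    have "(\<Sum>j<J. (cmod (weigh \<alpha> (r n) (\<lambda>j. S m j - S n j) j))\<^sup>2) \<le> (\<delta> n)\<^sup>2" if "n \<le> m" for m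
    proof -
      have "(\<Sum>j<J. (cmod (weigh \<alpha> (r n) (\<lambda>j. S m j - S n j) j))\<^sup>2) \<le> (psp_norm \<alpha> (r n) (\<lambda>j. S m j - S n j))\<^sup>2"
        unfolding psp_norm_eq by (rule l2_sum_le[OF psp_carrierD[OF psp_diff(1)[OF S S]]])
      also have "\<dots> \<le> (\<delta> n)\<^sup>2" by (intro power_mono nest that) (simp add: psp_diff S)
      finally show ?thesis .
    qed
    then show "\<exists>N. \<forall>m\<ge>N. (\<Sum>j<J. (cmod (weigh \<alpha> (r n) (\<lambda>j. S m j - S n j) j))\<^sup>2) \<le> (\<delta> n)\<^sup>2" by blast
  qed
  note yb = l2_boundedI[OF fin d(1)]
  have "weigh \<alpha> q y \<in> l2_space" for q
  proof -
    \<comment> \<open>The ball around \<open>S q\<close> controls the norm of index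
      \<open>r q\<close>, which is at least \<open>q\<close>.\<close>
    have "weigh \<alpha> q (\<lambda>j. y j - S q j) \<in> l2_space"
      by (rule l2_comparison(1)[OF yb(1)[of q], of _ 1])
        (use r[of q] pos in \<open>auto simp: norm_weigh intro!: mult_right_mono\<close>)
    from l2_add(1)[OF this psp_carrierD[OF S[of q], of q]] show ?thesis by (simp flip: weigh_add)
  qed
  then have "y \<in> psp_carrier \<alpha>" by (simp add: psp_carrier_iff)
  then show thesis using that yb(2) by (simp add: psp_norm_eq)
qed

text \<open>Banach-Steinhaus for a family of arbitrary size. If no common bound exists, balls can be
  nested so that on each next one some \<open>Q i\<close> exceeds a growing number \<open>n\<close>;
  their common point contradicts pointwise boundedness.\<close>

lemma psp_uniform_boundedness:
  assumes pos: "\<And>j. 0 \<le> \<alpha> j"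
    and sem: "\<And>i. i \<in> I \<Longrightarrow> seminorm_on (power_series_space \<alpha>) (Q i)"
    and cont: "\<And>i. i \<in> I \<Longrightarrow> \<exists>C r. \<forall>\<xi>\<in>psp_carrier \<alpha>. Q i \<xi> \<le> C * psp_norm \<alpha> r \<xi>"
    and ptw: "\<And>\<xi>. \<xi> \<in> psp_carrier \<alpha> \<Longrightarrow> \<exists>M. \<forall>i\<in>I. Q i \<xi> \<le> M"
  shows "\<exists>C r. 0 < C \<and> (\<forall>i\<in>I. \<forall>\<xi>\<in>psp_carrier \<alpha>. Q i \<xi> \<le> C * psp_norm \<alpha> r \<xi>)"
proof (rule ccontr)
  interpret V: seminormed_space "power_series_space \<alpha>" "range (psp_norm \<alpha>)"
    by (rule seminormed_space_psp[OF pos])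
  assume contra: "\<not> ?thesis"
  define D where "D \<xi> \<eta> = (\<lambda>j. \<xi> j - \<eta> j)" for \<xi> \<eta> :: cseq
  have D: "D \<xi> \<eta> \<in> psp_carrier \<alpha>" if "\<xi> \<in> psp_carrier \<alpha>" "\<eta> \<in> psp_carrier \<alpha>" for \<xi> \<eta>
    using psp_diff(1)[OF that] by (simp add: D_def)
  have Qtri: "Q i \<xi> \<le> Q i \<eta> + Q i (D \<xi> \<eta>)" if "i \<in> I" "\<xi> \<in> psp_carrier \<alpha>" "\<eta> \<in> psp_carrier \<alpha>" for i \<xi> \<eta>
    using seminorm_on_triangle[OF sem[OF that(1)], of \<eta> "D \<xi> \<eta>"] D[OF that(2,3)] that by (simp add: D_def)
  have Qtri2: "Q i (D \<xi> \<eta>) \<le> Q i \<xi> + Q i \<eta>" if "i \<in> I" "\<xi> \<in> psp_carrier \<alpha>" "\<eta> \<in> psp_carrier \<alpha>" for i \<xi> \<eta>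
    using seminorm_on_triangle[OF sem[OF that(1)], of \<xi> "\<lambda>j. (-1) * \<eta> j"] psp_scale(1)[OF that(3), of "-1"]
      seminorm_on_smult[OF sem[OF that(1)], of \<eta> "-1"] that by (simp add: D_def)
  have Dtri: "psp_norm \<alpha> r (D a c) \<le> psp_norm \<alpha> r (D a b) + psp_norm \<alpha> r (D b c)"
    if "a \<in> psp_carrier \<alpha>" "b \<in> psp_carrier \<alpha>" "c \<in> psp_carrier \<alpha>" for r a b c
    using psp_add(2)[OF D[OF that(1,2)] D[OF that(2,3)], of r] by (simp add: D_def)
  \<comment> \<open>A state consists of a centre, the index of a norm and a radius, and describes a
    closed ball.\<close>
  define ok where "ok n t \<longleftrightarrow> (case t of (S, r, \<delta>) \<Rightarrow> S \<in> psp_carrier \<alpha> \<and> n \<le> r \<and> 0 < \<delta> \<and> \<delta> \<le> (1/2)^n)"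
    for n :: nat and t :: "cseq \<times> nat \<times> real"
  define big where "big n t \<longleftrightarrow> (case t of (S, r, \<delta>) \<Rightarrow>
     \<exists>i\<in>I. \<forall>y\<in>psp_carrier \<alpha>. psp_norm \<alpha> r (D y S) \<le> \<delta> \<longrightarrow> real n < Q i y)"
    for n :: nat and t :: "cseq \<times> nat \<times> real"
  define nested where "nested t t' \<longleftrightarrow> (case t of (S, r, \<delta>) \<Rightarrow> case t' of (S', r', \<delta>') \<Rightarrow>
     \<forall>y\<in>psp_carrier \<alpha>. psp_norm \<alpha> r' (D y S') \<le> \<delta>' \<longrightarrow> psp_norm \<alpha> r (D y S) \<le> \<delta>)"
    for t t' :: "cseq \<times> nat \<times> real"
  have step: "\<exists>t'. ok (Suc n) t' \<and> nested t t' \<and> big n t'" if t: "ok n t" for n t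
  proof -
    obtain S r \<delta> where t_eq: "t = (S, r, \<delta>)" by (cases t)
    have S: "S \<in> psp_carrier \<alpha>" and \<delta>: "0 < \<delta>" using t by (auto simp: ok_def t_eq)
    \<comment> \<open>Otherwise all \<open>Q i\<close> are bounded by \<open>n\<close> near
      \<open>S\<close>, hence by a common constant near zero after translation, and homogeneity
      would give the bound that was assumed not to exist.\<close>
    have "\<exists>i\<in>I. \<exists>y\<in>psp_carrier \<alpha>. psp_norm \<alpha> r (D y S) < \<delta> \<and> real n < Q i y"
    proof (rule ccontr)
      assume "\<not> ?thesis"
      then have small: "Q i y \<le> real n" if "i \<in> I" "y \<in> psp_carrier \<alpha>" "psp_norm \<alpha> r (D y S) < \<delta>" for i y
        using that by (meson not_le)
      obtain M where M: "\<And>i. i \<in> I \<Longrightarrow> Q i S \<le> M" using ptw[OF S] by blast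
      define K where "K = real n + \<bar>M\<bar> + 1"
      have K: "K > 0" by (simp add: K_def add_nonneg_pos)
      have "Q i z \<le> (K / \<delta>) * psp_norm \<alpha> r z" if i: "i \<in> I" and z: "z \<in> psp_carrier \<alpha>" for i z
      proof -
        have "(1 / K) * Q i z \<le> (1 / \<delta>) * psp_norm \<alpha> r z"
        proof (rule V.seminorm_le_of_small[of "\<lambda>z. (1 / K) * Q i z" "psp_norm \<alpha> r" \<delta>])
          show "seminorm_on (power_series_space \<alpha>) (\<lambda>z. (1 / K) * Q i z)"
            using sem[OF i] K unfolding seminorm_on_def by (auto simp: field_simps)
          fix w assume w: "w \<in> carrier (power_series_space \<alpha>)" "psp_norm \<alpha> r w < \<delta>"
          define y where "y = (\<lambda>j. S j + w j)"
          have y: "y \<in> psp_carrier \<alpha>" "D y S = w" using w S by (auto simp: y_def D_def psp_add)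
          have "Q i w \<le> Q i y + Q i S" using Qtri2[OF i y(1) S] y(2) by simp
          also have "\<dots> < K" using small[OF i y(1)] y(2) w(2) M[OF i] by (simp add: K_def)
          finally show "(1 / K) * Q i w < 1" using K by (simp add: field_simps)
        qed (use z \<delta> in \<open>auto simp: seminorm_on_psp_norm\<close>)
        then show ?thesis using K \<delta> by (simp add: field_simps)
      qed
      moreover have "0 < K / \<delta>" using K \<delta> by simp
      ultimately show False using contra by blast
    qed
    then obtain i S' where i: "i \<in> I" and S': "S' \<in> psp_carrier \<alpha>" "psp_norm \<alpha> r (D S' S) < \<delta>" "real n < Q i S'"
      by blast
    obtain C p where C: "\<And>\<xi>. \<xi> \<in> psp_carrier \<alpha> \<Longrightarrow> Q i \<xi> \<le> C * psp_norm \<alpha> p \<xi>" using cont[OF i] by blast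
    \<comment> \<open>\<open>p\<close> is an index for which \<open>Q i\<close> is continuous, and
      \<open>Suc n\<close> makes the indices unbounded. The three terms of the radius below force
      the radii to 0, keep the new ball inside the old one, and keep \<open>Q i\<close> above
      \<open>n\<close>; the factor 2 gives strictness on the closed ball.\<close>
    define r' where "r' = max (Suc n) (max r p)"
    define \<delta>' where "\<delta>' = min ((1/2)^Suc n) (min (\<delta> - psp_norm \<alpha> r (D S' S)) ((Q i S' - real n) / (2 * (\<bar>C\<bar> + 1))))"
    have \<delta>': "0 < \<delta>'" using S' by (simp add: \<delta>'_def add_nonneg_pos)
    have "nested t (S', r', \<delta>')"
      unfolding nested_def t_eq prod.case
    proof (intro ballI impI)
      fix y assume y: "y \<in> psp_carrier \<alpha>" "psp_norm \<alpha> r' (D y S') \<le> \<delta>'"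
      have "psp_norm \<alpha> r (D y S') \<le> psp_norm \<alpha> r' (D y S')"
        by (rule psp_norm_mono[OF D[OF y(1) S'(1)] pos]) (simp add: r'_def)
      then have "psp_norm \<alpha> r (D y S') \<le> \<delta> - psp_norm \<alpha> r (D S' S)" using y(2) by (simp add: \<delta>'_def)
      then show "psp_norm \<alpha> r (D y S) \<le> \<delta>" using Dtri[OF y(1) S'(1) S, of r] by simp
    qed
    moreover have "big n (S', r', \<delta>')"
      unfolding big_def prod.case
    proof (intro bexI[OF _ i] ballI impI)
      fix y assume y: "y \<in> psp_carrier \<alpha>" "psp_norm \<alpha> r' (D y S') \<le> \<delta>'"
      have Dc: "D S' y \<in> psp_carrier \<alpha>" by (rule D[OF S'(1) y(1)])
      have "psp_norm \<alpha> p (D S' y) \<le> psp_norm \<alpha> r' (D S' y)"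
        by (rule psp_norm_mono[OF Dc pos]) (simp add: r'_def)
      also have "\<dots> = psp_norm \<alpha> r' (D y S')" unfolding D_def by (rule psp_norm_uminus)
      finally have pd: "psp_norm \<alpha> p (D S' y) \<le> (Q i S' - real n) / (2 * (\<bar>C\<bar> + 1))" using y(2) by (simp add: \<delta>'_def)
      have "Q i (D S' y) \<le> C * psp_norm \<alpha> p (D S' y)" by (rule C[OF Dc])
      also have "\<dots> \<le> (\<bar>C\<bar> + 1) * psp_norm \<alpha> p (D S' y)"
        by (intro mult_right_mono psp_norm_nonneg[OF Dc]) auto
      also have "\<dots> \<le> (\<bar>C\<bar> + 1) * ((Q i S' - real n) / (2 * (\<bar>C\<bar> + 1)))"
        by (intro mult_left_mono pd) auto
      also have "\<dots> = (Q i S' - real n) / 2" by (simp add: field_simps add_nonneg_eq_0_iff)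
      also have "\<dots> < Q i S' - real n" using S'(3) by (simp add: field_simps)
      finally show "real n < Q i y" using Qtri[OF i S'(1) y(1)] by simp
    qed
    moreover have "\<delta>' \<le> (1/2)^Suc n" unfolding \<delta>'_def by (rule min.cobounded1)
    then have "ok (Suc n) (S', r', \<delta>')" using S'(1) \<delta>' by (simp add: ok_def r'_def)
    ultimately show ?thesis by blast
  qed
  have ok0: "\<exists>t. ok 0 t" by (intro exI[of _ "((\<lambda>_. 0), 0, 1)"]) (simp add: ok_def)
  have "\<exists>T. \<forall>n. ok n (T n) \<and> (nested (T n) (T (Suc n)) \<and> big n (T (Suc n)))"
    by (rule dependent_nat_choice[OF ok0 step])
  then obtain T where T: "\<And>n. ok n (T n)" "\<And>n. nested (T n) (T (Suc n)) \<and> big n (T (Suc n))"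
    by blast
  define S where "S n = fst (T n)" for n
  define r where "r n = fst (snd (T n))" for n
  define \<delta> where "\<delta> n = snd (snd (T n))" for n
  have Tn: "T n = (S n, r n, \<delta> n)" for n by (simp add: S_def r_def \<delta>_def)
  have Sn: "S n \<in> psp_carrier \<alpha>" and rn: "n \<le> r n" and dn: "0 < \<delta> n" "\<delta> n \<le> (1/2)^n" for n
    using T(1)[of n] by (auto simp: ok_def Tn)
  have nest: "psp_norm \<alpha> (r n) (D y (S n)) \<le> \<delta> n"
    if "n \<le> m" "y \<in> psp_carrier \<alpha>" "psp_norm \<alpha> (r m) (D y (S m)) \<le> \<delta> m" for n m y
    using that
  proof (induction m rule: dec_induct)
    case (step m)
    then show ?case using T(2)[of m] unfolding nested_def Tn by auto
  qed auto
  have "psp_norm \<alpha> (r m) (D (S m) (S m)) \<le> \<delta> m" for m using dn(1)[of m] by (simp add: D_def)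
  then have "psp_norm \<alpha> (r n) (D (S m) (S n)) \<le> \<delta> n" if "n \<le> m" for m n
    by (rule nest[OF that Sn])
  moreover have "\<delta> \<longlonglongrightarrow> 0"
  proof (rule tendsto_sandwich[of "\<lambda>_. 0" _ _ "\<lambda>n. (1/2)^n"])
    show "(\<lambda>n. (1 / 2) ^ n :: real) \<longlonglongrightarrow> 0" by (rule LIMSEQ_power_zero) simp
  qed (use dn in \<open>auto simp: less_imp_le\<close>)
  ultimately obtain y where y: "y \<in> psp_carrier \<alpha>" "\<And>n. psp_norm \<alpha> (r n) (D y (S n)) \<le> \<delta> n"
    using psp_nested_balls[where S=S and r=r and \<delta>=\<delta>, OF pos Sn rn less_imp_le[OF dn(1)]]
    unfolding D_def by blast
  obtain M where M: "\<And>i. i \<in> I \<Longrightarrow> Q i y \<le> M" using ptw[OF y(1)] by blast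
  obtain n where n: "M < real n" using reals_Archimedean2 by blast
  have "big n (T (Suc n))" using T(2) by blast
  then obtain i where "i \<in> I" "real n < Q i y" unfolding big_def Tn using y by auto
  then show False using M n by fastforce
qed


section \<open>The algebra of operators on rapidly decreasing sequences\<close>

text \<open>With these exponents \<open>s\<close> is itself a power series space, so all estimates
  above apply to it. The shift by one makes the logarithm nonnegative from index 0 on.\<close>

definition s_exponent :: "nat \<Rightarrow> real" where
  "s_exponent j = ln (real (Suc j))"

lemma exp_s_exponent: "exp (real q * s_exponent j) = real (Suc j) ^ q"
  by (simp add: s_exponent_def exp_of_nat_mult del: of_nat_Suc)

lemma exp_2_s_exponent: "exp (2 * real q * s_exponent j) = real (Suc j) ^ (2 * q)"
  using exp_s_exponent[of "2 * q" j] by simp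

lemma s_space_eq: "s_space = psp_carrier s_exponent"
  by (simp add: s_space_def psp_carrier_def exp_2_s_exponent)

lemma s_norm_eq: "s_norm q = psp_norm s_exponent q"
  by (simp add: s_norm_def psp_norm_def exp_2_s_exponent fun_eq_iff)

lemma s_exponent_nonneg: "0 \<le> s_exponent j"
  by (simp add: s_exponent_def)

lemma exp_mult_le_imp: "exp a * u \<le> M \<Longrightarrow> u \<le> M * exp (- a)" for a u M :: real
  by (simp add: exp_minus field_simps)

lemma summable_s_exponent: "summable (\<lambda>j. exp (- 2 * real 1 * s_exponent j))"
proof -
  have e: "(\<lambda>j. exp (- 2 * real 1 * s_exponent j)) = (\<lambda>j. inverse (real (Suc j) ^ 2))"
    using exp_s_exponent[of 2] by (simp add: exp_minus)
  show ?thesis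
    unfolding e
    unfolding summable_Suc_iff[of "\<lambda>j. inverse (real j ^ 2)"]
    by (rule inverse_power_summable) simp
qed

lemma s_l2: "\<xi> \<in> s_space \<Longrightarrow> \<xi> \<in> l2_space"
  unfolding s_space_eq by (rule psp_l2)

lemma unit_seq_s [simp]: "unit_seq j \<in> s_space"
  by (simp add: s_space_eq)

lemma s_add: "\<xi> \<in> s_space \<Longrightarrow> \<eta> \<in> s_space \<Longrightarrow> (\<lambda>j. \<xi> j + \<eta> j) \<in> s_space"
  and s_scale: "\<xi> \<in> s_space \<Longrightarrow> (\<lambda>j. c * \<xi> j) \<in> s_space"
  and s_zero: "(\<lambda>_. 0) \<in> s_space"
  unfolding s_space_eq by (simp_all add: psp_add psp_scale)

lemma s_norm_add: "\<xi> \<in> s_space \<Longrightarrow> \<eta> \<in> s_space \<Longrightarrow> s_norm q (\<lambda>j. \<xi> j + \<eta> j) \<le> s_norm q \<xi> + s_norm q \<eta>"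
  and s_norm_scale: "\<xi> \<in> s_space \<Longrightarrow> s_norm q (\<lambda>j. c * \<xi> j) = cmod c * s_norm q \<xi>"
  and s_norm_nonneg: "\<xi> \<in> s_space \<Longrightarrow> 0 \<le> s_norm q \<xi>"
  and s_norm_mono: "\<xi> \<in> s_space \<Longrightarrow> q \<le> r \<Longrightarrow> s_norm q \<xi> \<le> s_norm r \<xi>"
  unfolding s_space_eq s_norm_eq by (simp_all add: psp_add psp_scale psp_norm_mono s_exponent_nonneg)

lemma s_norm_0: "s_norm 0 \<xi> = l2_norm \<xi>"
  by (simp add: s_norm_eq psp_norm_0)

lemma s_coordinate: "\<xi> \<in> s_space \<Longrightarrow> real (Suc j) ^ q * cmod (\<xi> j) \<le> s_norm q \<xi>"
  using psp_coordinate[of \<xi> s_exponent q j] by (simp only: s_space_eq s_norm_eq exp_s_exponent)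

section \<open>Operators with formal adjoints and their algebraic operations\<close>

lemma lstar_sel [simp]:
  "carrier lstar = lstar_carrier"
  "x \<otimes>\<^bsub>lstar\<^esub> y = compose s_space x y"
  "\<zero>\<^bsub>lstar\<^esub> = (\<lambda>\<xi>\<in>s_space. (\<lambda>_. 0))"
  "x \<oplus>\<^bsub>lstar\<^esub> y = (\<lambda>\<xi>\<in>s_space. (\<lambda>j. x \<xi> j + y \<xi> j))"
  "c \<odot>\<^bsub>lstar\<^esub> x = (\<lambda>\<xi>\<in>s_space. (\<lambda>j. c * x \<xi> j))"
  "star lstar x = restrict (adjoint_op x) s_space"
  by (simp_all add: lstar_def)

lemma l2_inner_s_eqI:
  assumes "\<And>\<xi>. \<xi> \<in> s_space \<Longrightarrow> l2_inner \<xi> a = l2_inner \<xi> b"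
  shows "a = b"
proof
  fix j show "a j = b j" using assms[OF unit_seq_s[of j]] by (simp add: l2_inner_unit_left)
qed

lemma adjoint_op_eqI:
  assumes "\<zeta> \<in> l2_space" "\<And>\<xi>. \<xi> \<in> s_space \<Longrightarrow> l2_inner (x \<xi>) \<eta> = l2_inner \<xi> \<zeta>"
  shows "adjoint_op x \<eta> = \<zeta>"
  unfolding adjoint_op_def
proof (rule the_equality)
  fix \<zeta>' assume "\<zeta>' \<in> l2_space \<and> (\<forall>\<xi>\<in>s_space. l2_inner (x \<xi>) \<eta> = l2_inner \<xi> \<zeta>')"
  then show "\<zeta>' = \<zeta>" using assms(2) by (intro l2_inner_s_eqI) auto
qed (use assms in auto)

text \<open>A map of \<open>s\<close> into itself with a formal adjoint \<open>y\<close> is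
  automatically linear, since its coordinates are scalar products with the vectors
  \<open>y (unit_seq k)\<close>. For concrete operators only adjointness has to be verified.\<close>

lemma lstarI:
  assumes x: "x \<in> s_space \<rightarrow>\<^sub>E s_space" and y: "\<And>\<eta>. \<eta> \<in> s_space \<Longrightarrow> y \<eta> \<in> s_space"
    and adj: "\<And>\<xi> \<eta>. \<xi> \<in> s_space \<Longrightarrow> \<eta> \<in> s_space \<Longrightarrow> l2_inner (x \<xi>) \<eta> = l2_inner \<xi> (y \<eta>)"
  shows "x \<in> lstar_carrier" "\<And>\<eta>. \<eta> \<in> s_space \<Longrightarrow> adjoint_op x \<eta> = y \<eta>"
proof -
  show a: "adjoint_op x \<eta> = y \<eta>" if "\<eta> \<in> s_space" for \<eta>
    using that adj y s_l2 by (intro adjoint_op_eqI) auto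
  have xc: "x \<xi> \<in> s_space" if "\<xi> \<in> s_space" for \<xi> using x that by auto
  have coord: "x \<xi> k = l2_inner \<xi> (y (unit_seq k))" if "\<xi> \<in> s_space" for \<xi> k
    using adj[OF that unit_seq_s[of k]] by (simp add: l2_inner_unit_right)
  have "x (\<lambda>j. \<xi> j + \<eta> j) = (\<lambda>j. x \<xi> j + x \<eta> j)" if "\<xi> \<in> s_space" "\<eta> \<in> s_space" for \<xi> \<eta>
    using that by (simp add: fun_eq_iff coord s_add l2_inner_add_left s_l2 y)
  moreover have "x (\<lambda>j. c * \<xi> j) = (\<lambda>j. c * x \<xi> j)" if "\<xi> \<in> s_space" for \<xi> c
    using that by (simp add: fun_eq_iff coord s_scale l2_inner_scale_left s_l2 y)
  moreover have "\<eta> \<in> adjoint_domain x" if "\<eta> \<in> s_space" for \<eta>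
    using that adj y s_l2 unfolding adjoint_domain_def by blast
  ultimately show "x \<in> lstar_carrier"
    using x a y unfolding lstar_carrier_def by auto
qed

lemma lstarD:
  assumes "x \<in> lstar_carrier"
  shows lstar_extensional: "x \<in> s_space \<rightarrow>\<^sub>E s_space"
    and lstar_apply: "\<xi> \<in> s_space \<Longrightarrow> x \<xi> \<in> s_space"
    and lstar_add: "\<xi> \<in> s_space \<Longrightarrow> \<eta> \<in> s_space \<Longrightarrow> x (\<lambda>j. \<xi> j + \<eta> j) = (\<lambda>j. x \<xi> j + x \<eta> j)"
    and lstar_scale: "\<xi> \<in> s_space \<Longrightarrow> x (\<lambda>j. c * \<xi> j) = (\<lambda>j. c * x \<xi> j)"
    and lstar_adjoint_apply: "\<xi> \<in> s_space \<Longrightarrow> adjoint_op x \<xi> \<in> s_space"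
    and lstar_adjoint: "\<xi> \<in> s_space \<Longrightarrow> \<eta> \<in> s_space \<Longrightarrow> l2_inner (x \<xi>) \<eta> = l2_inner \<xi> (adjoint_op x \<eta>)"
proof -
  show "x \<in> s_space \<rightarrow>\<^sub>E s_space" "\<xi> \<in> s_space \<Longrightarrow> x \<xi> \<in> s_space"
    "\<xi> \<in> s_space \<Longrightarrow> \<eta> \<in> s_space \<Longrightarrow> x (\<lambda>j. \<xi> j + \<eta> j) = (\<lambda>j. x \<xi> j + x \<eta> j)"
    "\<xi> \<in> s_space \<Longrightarrow> x (\<lambda>j. c * \<xi> j) = (\<lambda>j. c * x \<xi> j)"
    "\<xi> \<in> s_space \<Longrightarrow> adjoint_op x \<xi> \<in> s_space"
    using assms unfolding lstar_carrier_def by auto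
  show "l2_inner (x \<xi>) \<eta> = l2_inner \<xi> (adjoint_op x \<eta>)" if "\<xi> \<in> s_space" "\<eta> \<in> s_space"
  proof -
    have "\<eta> \<in> adjoint_domain x" using assms that unfolding lstar_carrier_def by auto
    then obtain \<zeta> where z: "\<zeta> \<in> l2_space" "\<forall>\<xi>\<in>s_space. l2_inner (x \<xi>) \<eta> = l2_inner \<xi> \<zeta>"
      unfolding adjoint_domain_def by blast
    then have "adjoint_op x \<eta> = \<zeta>" by (intro adjoint_op_eqI) auto
    then show ?thesis using z that by simp
  qed
qed

lemma lstar_eqI:
  assumes "x \<in> s_space \<rightarrow>\<^sub>E s_space" "y \<in> s_space \<rightarrow>\<^sub>E s_space" "\<And>\<xi> j. \<xi> \<in> s_space \<Longrightarrow> x \<xi> j = y \<xi> j"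
  shows "x = y"
  by (rule PiE_ext[OF assms(1,2)]) (use assms(3) in auto)

lemma lstar_add_closed:
  assumes "x \<in> lstar_carrier" "y \<in> lstar_carrier"
  shows "x \<oplus>\<^bsub>lstar\<^esub> y \<in> lstar_carrier"
    "\<eta> \<in> s_space \<Longrightarrow> adjoint_op (x \<oplus>\<^bsub>lstar\<^esub> y) \<eta> = (\<lambda>j. adjoint_op x \<eta> j + adjoint_op y \<eta> j)"
proof -
  have a: "x \<oplus>\<^bsub>lstar\<^esub> y \<in> s_space \<rightarrow>\<^sub>E s_space" using assms by (auto simp: lstarD s_add)
  have b: "(\<lambda>j. adjoint_op x \<eta> j + adjoint_op y \<eta> j) \<in> s_space" if "\<eta> \<in> s_space" for \<eta>
    using that assms by (simp add: lstarD s_add)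
  have c: "l2_inner ((x \<oplus>\<^bsub>lstar\<^esub> y) \<xi>) \<eta> = l2_inner \<xi> (\<lambda>j. adjoint_op x \<eta> j + adjoint_op y \<eta> j)"
    if "\<xi> \<in> s_space" "\<eta> \<in> s_space" for \<xi> \<eta>
    using that assms by (simp add: l2_inner_add_left l2_inner_add_right s_l2 lstarD(2,5,6))
  show "x \<oplus>\<^bsub>lstar\<^esub> y \<in> lstar_carrier" by (rule lstarI(1)[OF a b c])
  show "\<eta> \<in> s_space \<Longrightarrow> adjoint_op (x \<oplus>\<^bsub>lstar\<^esub> y) \<eta> = (\<lambda>j. adjoint_op x \<eta> j + adjoint_op y \<eta> j)"
    by (rule lstarI(2)[OF a b c])
qed

lemma lstar_smult_closed:
  assumes "x \<in> lstar_carrier"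
  shows "c \<odot>\<^bsub>lstar\<^esub> x \<in> lstar_carrier"
    "\<eta> \<in> s_space \<Longrightarrow> adjoint_op (c \<odot>\<^bsub>lstar\<^esub> x) \<eta> = (\<lambda>j. cnj c * adjoint_op x \<eta> j)"
proof -
  have a: "c \<odot>\<^bsub>lstar\<^esub> x \<in> s_space \<rightarrow>\<^sub>E s_space" using assms by (auto simp: lstarD s_scale)
  have b: "(\<lambda>j. cnj c * adjoint_op x \<eta> j) \<in> s_space" if "\<eta> \<in> s_space" for \<eta>
    using that assms by (simp add: lstarD s_scale)
  have d: "l2_inner ((c \<odot>\<^bsub>lstar\<^esub> x) \<xi>) \<eta> = l2_inner \<xi> (\<lambda>j. cnj c * adjoint_op x \<eta> j)"
    if "\<xi> \<in> s_space" "\<eta> \<in> s_space" for \<xi> \<eta>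
    using that assms by (simp add: l2_inner_scale_left l2_inner_scale_right s_l2 lstarD(2,5,6))
  show "c \<odot>\<^bsub>lstar\<^esub> x \<in> lstar_carrier" by (rule lstarI(1)[OF a b d])
  show "\<eta> \<in> s_space \<Longrightarrow> adjoint_op (c \<odot>\<^bsub>lstar\<^esub> x) \<eta> = (\<lambda>j. cnj c * adjoint_op x \<eta> j)"
    by (rule lstarI(2)[OF a b d])
qed

lemma lstar_zero_closed: "\<zero>\<^bsub>lstar\<^esub> \<in> lstar_carrier"
  by (rule lstarI(1)[of _ "\<lambda>_ _. 0"]) (auto simp: s_zero l2_inner_def)

lemma lstar_star_closed:
  assumes "x \<in> lstar_carrier"
  shows "star lstar x \<in> lstar_carrier"
    and "\<eta> \<in> s_space \<Longrightarrow> adjoint_op (star lstar x) \<eta> = x \<eta>"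
proof -
  have a: "star lstar x \<in> s_space \<rightarrow>\<^sub>E s_space" using assms by (auto simp: lstarD)
  have c: "l2_inner (star lstar x \<xi>) \<eta> = l2_inner \<xi> (x \<eta>)" if "\<xi> \<in> s_space" "\<eta> \<in> s_space" for \<xi> \<eta>
    using lstar_adjoint[OF assms that(2,1)] that assms
      l2_inner_cnj[OF s_l2[OF lstar_apply[OF assms that(2)]] s_l2[OF that(1)]]
      l2_inner_cnj[OF s_l2[OF that(2)] s_l2[OF lstar_adjoint_apply[OF assms that(1)]]] by simp
  show "star lstar x \<in> lstar_carrier" by (rule lstarI(1)[OF a lstar_apply[OF assms] c])
  show "\<eta> \<in> s_space \<Longrightarrow> adjoint_op (star lstar x) \<eta> = x \<eta>"
    by (rule lstarI(2)[OF a lstar_apply[OF assms] c])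
qed

lemma module_lstar: "Module.module complex_field lstar"
proof (intro moduleI abelian_groupI cring_complex_field)
  fix x assume x: "x \<in> carrier lstar"
  show "\<exists>y\<in>carrier lstar. y \<oplus>\<^bsub>lstar\<^esub> x = \<zero>\<^bsub>lstar\<^esub>"
    using lstar_smult_closed(1)[of x "-1"] x
    by (intro bexI[of _ "(-1) \<odot>\<^bsub>lstar\<^esub> x"]) (auto simp: fun_eq_iff restrict_def)
  show "\<zero>\<^bsub>lstar\<^esub> \<oplus>\<^bsub>lstar\<^esub> x = x" "\<one>\<^bsub>complex_field\<^esub> \<odot>\<^bsub>lstar\<^esub> x = x"
    using x lstar_extensional[of x] by (auto simp: fun_eq_iff restrict_def PiE_def extensional_def)
next
  show "\<And>x y. x \<in> carrier lstar \<Longrightarrow> y \<in> carrier lstar \<Longrightarrow> x \<oplus>\<^bsub>lstar\<^esub> y \<in> carrier lstar"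
    "\<zero>\<^bsub>lstar\<^esub> \<in> carrier lstar"
    "\<And>a x. a \<in> carrier complex_field \<Longrightarrow> x \<in> carrier lstar \<Longrightarrow> a \<odot>\<^bsub>lstar\<^esub> x \<in> carrier lstar"
    using lstar_add_closed(1) lstar_zero_closed lstar_smult_closed(1) by (simp_all only: lstar_sel(1))
qed (auto simp: fun_eq_iff restrict_def algebra_simps)

text \<open>A closed graph argument in disguise: each coordinate of \<open>x \<xi>\<close> is
  continuous in \<open>\<xi>\<close> because of the adjoint, the weighted coordinates are bounded
  for fixed \<open>\<xi>\<close> because \<open>x \<xi>\<close> lies in \<open>s\<close>, and
  uniform boundedness makes the estimate independent of the coordinate.\<close>

lemma lstar_bounded:
  assumes x: "x \<in> lstar_carrier"
  shows "\<exists>C r. 0 < C \<and> (\<forall>\<xi>\<in>s_space. s_norm N (x \<xi>) \<le> C * s_norm r \<xi>)"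
proof -
  \<comment> \<open>The exponent is \<open>N + 1\<close> because passing from a supremum to the
    \<open>N\<close>-th Hilbert norm costs one index in \<open>s\<close>.\<close>
  let ?Q = "\<lambda>k \<xi>. real (Suc k) ^ (N + 1) * cmod (x \<xi> k)"
  have "\<exists>C r. 0 < C \<and> (\<forall>k\<in>UNIV. \<forall>\<xi>\<in>psp_carrier s_exponent. ?Q k \<xi> \<le> C * psp_norm s_exponent r \<xi>)"
  proof (rule psp_uniform_boundedness[OF s_exponent_nonneg])
    fix k
    show "seminorm_on (power_series_space s_exponent) (?Q k)"
      unfolding seminorm_on_def psp_sel
    proof (intro conjI ballI allI)
      fix \<xi> \<eta> c assume "\<xi> \<in> psp_carrier s_exponent" 
      then have \<xi>: "\<xi> \<in> s_space" by (simp add: s_space_eq)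
      show "?Q k (\<lambda>j. c * \<xi> j) = cmod c * ?Q k \<xi>"
        by (simp add: lstar_scale[OF x \<xi>] norm_mult del: of_nat_Suc)
      assume "\<eta> \<in> psp_carrier s_exponent"
      then have \<eta>: "\<eta> \<in> s_space" by (simp add: s_space_eq)
      have "?Q k (\<lambda>j. \<xi> j + \<eta> j) \<le> real (Suc k) ^ (N + 1) * (cmod (x \<xi> k) + cmod (x \<eta> k))"
        unfolding lstar_add[OF x \<xi> \<eta>] by (intro mult_left_mono norm_triangle_ineq) simp
      then show "?Q k (\<lambda>j. \<xi> j + \<eta> j) \<le> ?Q k \<xi> + ?Q k \<eta>" by (simp only: distrib_left)
    qed auto
    have "?Q k \<xi> \<le> (real (Suc k) ^ (N + 1) * l2_norm (adjoint_op x (unit_seq k))) * psp_norm s_exponent 0 \<xi>"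
      if "\<xi> \<in> psp_carrier s_exponent" for \<xi>
    proof -
      have \<xi>: "\<xi> \<in> s_space" using that by (simp add: s_space_eq)
      have "x \<xi> k = l2_inner \<xi> (adjoint_op x (unit_seq k))"
        using lstar_adjoint[OF x \<xi> unit_seq_s[of k]] by (simp add: l2_inner_unit_right)
      then have "cmod (x \<xi> k) \<le> l2_norm \<xi> * l2_norm (adjoint_op x (unit_seq k))"
        using l2_Cauchy_Schwarz[OF s_l2[OF \<xi>] s_l2[OF lstar_adjoint_apply[OF x unit_seq_s[of k]]]] by simp
      then have "?Q k \<xi> \<le> real (Suc k) ^ (N + 1) * (l2_norm \<xi> * l2_norm (adjoint_op x (unit_seq k)))"
        by (intro mult_left_mono) auto
      then show ?thesis by (simp add: psp_norm_0 algebra_simps del: of_nat_Suc)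
    qed
    then show "\<exists>C r. \<forall>\<xi>\<in>psp_carrier s_exponent. ?Q k \<xi> \<le> C * psp_norm s_exponent r \<xi>" by blast
  next
    fix \<xi> assume "\<xi> \<in> psp_carrier s_exponent"
    then have "\<xi> \<in> s_space" by (simp add: s_space_eq)
    then show "\<exists>M. \<forall>k\<in>UNIV. ?Q k \<xi> \<le> M" using s_coordinate[OF lstar_apply[OF x]] by blast
  qed
  then obtain C r where C: "0 < C" and Q: "\<And>k \<xi>. \<xi> \<in> s_space \<Longrightarrow> ?Q k \<xi> \<le> C * s_norm r \<xi>"
    by (auto simp only: s_space_eq s_norm_eq)
  define K where "K = sqrt (\<Sum>j. exp (- 2 * real 1 * s_exponent j))"
  have "s_norm N (x \<xi>) \<le> (C * (K + 1)) * s_norm r \<xi>" if \<xi>: "\<xi> \<in> s_space" for \<xi>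
  proof -
    have nn: "0 \<le> C * s_norm r \<xi>" using C s_norm_nonneg[OF \<xi>] by simp
    have "s_norm N (x \<xi>) \<le> (C * s_norm r \<xi>) * K"
      unfolding K_def s_norm_eq
    proof (rule psp_norm_of_coordinate_bounds[OF summable_s_exponent])
      fix j
      have "exp (real (N + 1) * s_exponent j) * cmod (x \<xi> j) \<le> C * psp_norm s_exponent r \<xi>"
        using Q[OF \<xi>, of j] by (simp only: exp_s_exponent s_norm_eq)
      then show "cmod (x \<xi> j) \<le> C * psp_norm s_exponent r \<xi> * exp (- real (N + 1) * s_exponent j)"
        unfolding mult_minus_left by (rule exp_mult_le_imp)
    qed (use nn in \<open>simp add: s_norm_eq\<close>)
    also have "\<dots> \<le> (C * s_norm r \<xi>) * (K + 1)" using nn by (intro mult_left_mono) auto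
    finally show ?thesis by (simp add: algebra_simps)
  qed
  moreover have "0 \<le> K" unfolding K_def by (intro real_sqrt_ge_zero suminf_nonneg summable_s_exponent) auto
  then have "0 < C * (K + 1)" using C by simp
  ultimately show ?thesis by blast
qed

section \<open>The seminorms and the topology of the operator algebra\<close>

lemma s_boundedD: "s_bounded B \<Longrightarrow> \<xi> \<in> B \<Longrightarrow> \<xi> \<in> s_space"
  by (auto simp: s_bounded_def)

text \<open>Makes the suprema in \<open>lstar_seminorm\<close> meaningful: continuous operators map
  bounded sets to bounded sets, and the adjoint, restricted to \<open>s\<close>, is again an element
  of \<open>lstar_carrier\<close>.\<close>

lemma lstar_image_bdd_above:
  assumes "x \<in> lstar_carrier" "s_bounded B"
  shows "bdd_above ((\<lambda>\<xi>. s_norm N (x \<xi>)) ` B)" "bdd_above ((\<lambda>\<xi>. s_norm N (adjoint_op x \<xi>)) ` B)"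
proof -
  have *: "bdd_above ((\<lambda>\<xi>. s_norm N (y \<xi>)) ` B)" if y: "y \<in> lstar_carrier" for y
  proof -
    obtain C r where C: "0 < C" "\<And>\<xi>. \<xi> \<in> s_space \<Longrightarrow> s_norm N (y \<xi>) \<le> C * s_norm r \<xi>"
      using lstar_bounded[OF y, of N] by blast
    obtain M where M: "\<And>\<xi>. \<xi> \<in> B \<Longrightarrow> s_norm r \<xi> \<le> M"
      using assms(2) unfolding s_bounded_def bdd_above_def by blast
    show ?thesis
    proof (rule bdd_aboveI2)
      fix \<xi> assume b: "\<xi> \<in> B"
      show "s_norm N (y \<xi>) \<le> C * M"
        using C(2)[OF s_boundedD[OF assms(2) b]] mult_left_mono[OF M[OF b], of C] C(1) by linarith
    qed
  qed
  show "bdd_above ((\<lambda>\<xi>. s_norm N (x \<xi>)) ` B)" by (rule *[OF assms(1)])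
  have "(\<lambda>\<xi>. s_norm N (adjoint_op x \<xi>)) ` B = (\<lambda>\<xi>. s_norm N (star lstar x \<xi>)) ` B"
    using s_boundedD[OF assms(2)] by (intro image_cong) auto
  then show "bdd_above ((\<lambda>\<xi>. s_norm N (adjoint_op x \<xi>)) ` B)"
    using *[OF lstar_star_closed(1)[OF assms(1)]] by simp
qed

lemma lstar_seminorm_upper:
  assumes "x \<in> lstar_carrier" "s_bounded B" "\<xi> \<in> B"
  shows "s_norm N (x \<xi>) \<le> lstar_seminorm N B x" "s_norm N (adjoint_op x \<xi>) \<le> lstar_seminorm N B x"
  unfolding lstar_seminorm_def
  using cSUP_upper[OF assms(3) lstar_image_bdd_above(1)[OF assms(1,2)], of N]
    cSUP_upper[OF assms(3) lstar_image_bdd_above(2)[OF assms(1,2)], of N] by auto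

lemma lstar_seminorm_least:
  assumes "B \<noteq> {}" "\<And>\<xi>. \<xi> \<in> B \<Longrightarrow> s_norm N (x \<xi>) \<le> M" "\<And>\<xi>. \<xi> \<in> B \<Longrightarrow> s_norm N (adjoint_op x \<xi>) \<le> M"
  shows "lstar_seminorm N B x \<le> M"
  unfolding lstar_seminorm_def using assms by (auto intro!: cSUP_least)

lemma lstar_seminorm_nonneg:
  assumes "x \<in> lstar_carrier" "s_bounded B" "B \<noteq> {}"
  shows "0 \<le> lstar_seminorm N B x"
proof -
  obtain \<xi> where b: "\<xi> \<in> B" using assms by blast
  show ?thesis
    using lstar_seminorm_upper(1)[OF assms(1,2) b, of N]
      s_norm_nonneg[OF lstar_apply[OF assms(1) s_boundedD[OF assms(2) b]], of N] by linarith
qed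

lemma seminorm_on_lstar_seminorm:
  assumes B: "s_bounded B" "B \<noteq> {}"
  shows "seminorm_on lstar (lstar_seminorm N B)"
proof -
  have scale_le: "lstar_seminorm N B (c \<odot>\<^bsub>lstar\<^esub> x) \<le> cmod c * lstar_seminorm N B x"
    if x: "x \<in> lstar_carrier" for c x
  proof (rule lstar_seminorm_least[OF B(2)])
    fix \<xi> assume b: "\<xi> \<in> B"
    note \<xi> = s_boundedD[OF B(1) b]
    show "s_norm N ((c \<odot>\<^bsub>lstar\<^esub> x) \<xi>) \<le> cmod c * lstar_seminorm N B x"
      using lstar_seminorm_upper(1)[OF x B(1) b, of N] \<xi>
      by (simp add: s_norm_scale lstar_apply[OF x \<xi>] mult_left_mono)
    show "s_norm N (adjoint_op (c \<odot>\<^bsub>lstar\<^esub> x) \<xi>) \<le> cmod c * lstar_seminorm N B x"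
      unfolding lstar_smult_closed(2)[OF x \<xi>]
      using lstar_seminorm_upper(2)[OF x B(1) b, of N]
      by (simp add: s_norm_scale lstar_adjoint_apply[OF x \<xi>] mult_left_mono)
  qed
  have scale: "lstar_seminorm N B (c \<odot>\<^bsub>lstar\<^esub> x) = cmod c * lstar_seminorm N B x"
    if x: "x \<in> lstar_carrier" for c x
  proof (cases "c = 0")
    case True
    then show ?thesis
      using scale_le[OF x, of c] lstar_seminorm_nonneg[OF lstar_smult_closed(1)[OF x] B, of N c] by simp
  next
    case False
    interpret Module.module complex_field lstar by (rule module_lstar)
    have "inverse c \<odot>\<^bsub>lstar\<^esub> (c \<odot>\<^bsub>lstar\<^esub> x) = x"
      using smult_assoc1[of "inverse c" c x] smult_one[of x] x False by (simp del: lstar_sel(5))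
    then have "lstar_seminorm N B x \<le> cmod (inverse c) * lstar_seminorm N B (c \<odot>\<^bsub>lstar\<^esub> x)"
      using scale_le[OF lstar_smult_closed(1)[OF x], of "inverse c" c] by simp
    then have "cmod c * lstar_seminorm N B x \<le> lstar_seminorm N B (c \<odot>\<^bsub>lstar\<^esub> x)"
      using False by (simp add: norm_divide field_simps del: lstar_sel)
    then show ?thesis using scale_le[OF x, of c] by simp
  qed
  have add: "lstar_seminorm N B (x \<oplus>\<^bsub>lstar\<^esub> y) \<le> lstar_seminorm N B x + lstar_seminorm N B y"
    if x: "x \<in> lstar_carrier" and y: "y \<in> lstar_carrier" for x y
  proof (rule lstar_seminorm_least[OF B(2)])
    fix \<xi> assume b: "\<xi> \<in> B"
    note \<xi> = s_boundedD[OF B(1) b]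
    show "s_norm N ((x \<oplus>\<^bsub>lstar\<^esub> y) \<xi>) \<le> lstar_seminorm N B x + lstar_seminorm N B y"
      using lstar_seminorm_upper(1)[OF x B(1) b, of N] lstar_seminorm_upper(1)[OF y B(1) b, of N] \<xi>
        s_norm_add[OF lstar_apply[OF x \<xi>] lstar_apply[OF y \<xi>], of N] by simp
    show "s_norm N (adjoint_op (x \<oplus>\<^bsub>lstar\<^esub> y) \<xi>) \<le> lstar_seminorm N B x + lstar_seminorm N B y"
      unfolding lstar_add_closed(2)[OF x y \<xi>]
      using lstar_seminorm_upper(2)[OF x B(1) b, of N] lstar_seminorm_upper(2)[OF y B(1) b, of N]
        s_norm_add[OF lstar_adjoint_apply[OF x \<xi>] lstar_adjoint_apply[OF y \<xi>], of N] by simp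
  qed
  show ?thesis
    unfolding seminorm_on_def lstar_sel(1) using lstar_seminorm_nonneg[OF _ B] scale add by blast
qed

lemma lstar_seminorm_mono:
  assumes "x \<in> lstar_carrier" "s_bounded B'" "B \<subseteq> B'" "B \<noteq> {}" "N \<le> N'"
  shows "lstar_seminorm N B x \<le> lstar_seminorm N' B' x"
proof (rule lstar_seminorm_least[OF assms(4)])
  fix \<xi> assume "\<xi> \<in> B"
  then have b: "\<xi> \<in> B'" using assms by blast
  note \<xi> = s_boundedD[OF assms(2) b]
  show "s_norm N (x \<xi>) \<le> lstar_seminorm N' B' x"
    using s_norm_mono[OF lstar_apply[OF assms(1) \<xi>] assms(5)] lstar_seminorm_upper(1)[OF assms(1,2) b, of N'] by simp
  show "s_norm N (adjoint_op x \<xi>) \<le> lstar_seminorm N' B' x"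
    using s_norm_mono[OF lstar_adjoint_apply[OF assms(1) \<xi>] assms(5)] lstar_seminorm_upper(2)[OF assms(1,2) b, of N'] by simp
qed

lemma s_bounded_Un: "s_bounded A \<Longrightarrow> s_bounded B \<Longrightarrow> s_bounded (A \<union> B)"
  by (auto simp: s_bounded_def image_Un)

lemma s_bounded_singleton: "\<xi> \<in> s_space \<Longrightarrow> s_bounded {\<xi>}"
  by (auto simp: s_bounded_def)

abbreviation lstar_seminorms :: "((cseq \<Rightarrow> cseq) \<Rightarrow> real) set" where
  "lstar_seminorms \<equiv> {lstar_seminorm N B | N B. s_bounded B \<and> B \<noteq> {}}"

lemma seminormed_space_lstar: "seminormed_space lstar lstar_seminorms"
proof (rule seminormed_space_seminorm_topology[OF module_lstar])
  show "topol lstar = seminorm_topology (carrier lstar)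
      (\<lambda>x y. \<lambda>\<xi>\<in>s_space. (\<lambda>j. x \<xi> j - y \<xi> j)) lstar_seminorms" by (simp add: lstar_def)
  show "lstar_seminorms \<noteq> {}" using s_bounded_singleton[OF s_zero] by blast
  show "seminorm_on lstar p" if "p \<in> lstar_seminorms" for p using that seminorm_on_lstar_seminorm by blast
next
  fix x y assume xy: "x \<in> carrier lstar" "y \<in> carrier lstar"
  let ?d = "\<lambda>\<xi>\<in>s_space. (\<lambda>j. x \<xi> j - y \<xi> j)"
  have "?d = x \<oplus>\<^bsub>lstar\<^esub> ((-1) \<odot>\<^bsub>lstar\<^esub> y)" by (auto simp: fun_eq_iff restrict_def)
  then have "?d \<in> carrier lstar" using lstar_add_closed(1)[OF _ lstar_smult_closed(1)] xy by (simp del: lstar_sel(4,5))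
  moreover have "y \<oplus>\<^bsub>lstar\<^esub> ?d = x"
    using xy lstar_extensional[of x] by (auto simp: fun_eq_iff restrict_def PiE_def extensional_def)
  ultimately show "?d \<in> carrier lstar \<and> y \<oplus>\<^bsub>lstar\<^esub> ?d = x" by blast
next
  fix p q assume "p \<in> lstar_seminorms" "q \<in> lstar_seminorms"
  then obtain N B N' B' where e: "p = lstar_seminorm N B" "q = lstar_seminorm N' B'"
    "s_bounded B" "B \<noteq> {}" "s_bounded B'" "B' \<noteq> {}" by blast
  show "\<exists>r\<in>lstar_seminorms. \<forall>x\<in>carrier lstar. p x \<le> r x \<and> q x \<le> r x"
  proof (intro bexI[of _ "lstar_seminorm (max N N') (B \<union> B')"] ballI conjI)
    show "lstar_seminorm (max N N') (B \<union> B') \<in> lstar_seminorms" using s_bounded_Un[OF e(3,5)] e(4) by blast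
    fix x assume "x \<in> carrier lstar"
    then show "p x \<le> lstar_seminorm (max N N') (B \<union> B') x" "q x \<le> lstar_seminorm (max N N') (B \<union> B') x"
      unfolding e(1,2) by (auto intro!: lstar_seminorm_mono s_bounded_Un e)
  qed
qed

text \<open>The points are separated by the sets where \<open>p (z \<ominus> y)\<close> lies below
  and above half its value at \<open>x\<close>.\<close>

lemma (in seminormed_space) Hausdorff_if_separating:
  assumes "\<And>x. x \<in> carrier V \<Longrightarrow> x \<noteq> \<zero> \<Longrightarrow> \<exists>p\<in>\<P>. p x \<noteq> 0"
  shows "Hausdorff_space (topol V)"
  unfolding Hausdorff_space_def topspace_carrier
proof (intro allI impI, elim conjE)
  fix x y assume xy: "x \<in> carrier V" "y \<in> carrier V" "x \<noteq> y"
  have "(x \<ominus> y) \<oplus> y = x" using xy by (simp add: minus_eq a_assoc l_neg)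
  then have "x \<ominus> y \<noteq> \<zero>" using xy by auto
  then obtain p where p: "p \<in> \<P>" "p (x \<ominus> y) \<noteq> 0" using assms[of "x \<ominus> y"] xy by auto
  note sp = seminorms[OF p(1)]
  define d where "d = p (x \<ominus> y)"
  have d: "d > 0" using p(2) seminorm_on_nonneg[OF sp, of "x \<ominus> y"] xy by (simp add: d_def)
  define r where "r z = p (z \<ominus> y)" for z
  have c: "continuous_map (topol V) euclideanreal r"
  proof (rule continuous_map_realI)
    fix u and e :: real assume u: "u \<in> carrier V" and e: "0 < e"
    have "\<bar>r (u \<oplus> z) - r u\<bar> < e" if z: "z \<in> carrier V" "p z < e" for z
    proof -
      have e1: "(u \<oplus> z) \<ominus> y = (u \<ominus> y) \<oplus> z" using u z xy by (simp add: minus_eq a_assoc a_comm a_lcomm)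
      have "u \<ominus> y = ((u \<ominus> y) \<oplus> z) \<oplus> (\<ominus> z)" using u z xy by (simp add: a_assoc r_neg)
      then have "p (u \<ominus> y) \<le> p ((u \<ominus> y) \<oplus> z) + p z"
        using seminorm_on_triangle[OF sp, of "(u \<ominus> y) \<oplus> z" "\<ominus> z"] seminorm_minus[OF sp z(1)] u z xy by simp
      moreover have "p ((u \<ominus> y) \<oplus> z) \<le> p (u \<ominus> y) + p z"
        using seminorm_on_triangle[OF sp, of "u \<ominus> y" z] u z xy by simp
      ultimately show ?thesis using z(2) by (simp add: r_def e1)
    qed
    then show "\<exists>p\<in>\<P>. \<exists>d>0. \<forall>z\<in>carrier V. p z < d \<longrightarrow> \<bar>r (u \<oplus> z) - r u\<bar> < e" using p(1) e by blast
  qed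
  have "openin (topol V) {z \<in> topspace (topol V). r z \<in> {d/2<..}}"
    "openin (topol V) {z \<in> topspace (topol V). r z \<in> {..<d/2}}"
    by (rule openin_continuous_map_preimage[OF c]; simp)+
  moreover have "x \<in> {z \<in> topspace (topol V). r z \<in> {d/2<..}}" using xy d by (simp add: topspace_carrier r_def d_def)
  moreover have "y \<in> {z \<in> topspace (topol V). r z \<in> {..<d/2}}"
    using xy d by (simp add: topspace_carrier r_def seminorm_zero[OF sp] minus_eq r_neg)
  moreover have "disjnt {z \<in> topspace (topol V). r z \<in> {d/2<..}} {z \<in> topspace (topol V). r z \<in> {..<d/2}}"
    by (auto simp: disjnt_def)
  ultimately show "\<exists>U W. openin (topol V) U \<and> openin (topol V) W \<and> x \<in> U \<and> y \<in> W \<and> disjnt U W"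
    by blast
qed

lemma Hausdorff_lstar: "Hausdorff_space (topol lstar)"
proof -
  interpret seminormed_space lstar lstar_seminorms by (rule seminormed_space_lstar)
  show ?thesis
  proof (rule Hausdorff_if_separating)
    fix x assume x: "x \<in> carrier lstar" "x \<noteq> \<zero>\<^bsub>lstar\<^esub>"
    then have xc: "x \<in> lstar_carrier" by simp
    have "\<exists>\<xi>\<in>s_space. x \<xi> \<noteq> (\<lambda>_. 0)"
    proof (rule ccontr)
      assume "\<not> ?thesis"
      then have "x = \<zero>\<^bsub>lstar\<^esub>"
        by (intro lstar_eqI lstar_extensional[OF xc] lstar_extensional[OF lstar_zero_closed]) auto
      then show False using x by simp
    qed
    then obtain \<xi> where \<xi>: "\<xi> \<in> s_space" "x \<xi> \<noteq> (\<lambda>_. 0)" by blast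
    then have "s_norm 0 (x \<xi>) \<noteq> 0"
      using psp_eqI_norm[of "x \<xi>" s_exponent 0] lstar_apply[OF xc \<xi>(1)] by (auto simp: s_space_eq s_norm_eq)
    then have "lstar_seminorm 0 {\<xi>} x \<noteq> 0"
      using lstar_seminorm_upper(1)[OF xc s_bounded_singleton[OF \<xi>(1)], of \<xi> 0]
        s_norm_nonneg[OF lstar_apply[OF xc \<xi>(1)], of 0] by auto
    then show "\<exists>p\<in>lstar_seminorms. p x \<noteq> 0" using s_bounded_singleton[OF \<xi>(1)] by blast
  qed
qed

text \<open>The implication from (i) to (ii): the range of a continuous projection is the set where
  it agrees with the identity, and such a set is closed in a Hausdorff space.\<close>

lemma complemented_in_lstar_closed:
  assumes "complemented_in S lstar"
  shows "closedin (topol lstar) S"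
proof -
  interpret seminormed_space lstar lstar_seminorms by (rule seminormed_space_lstar)
  obtain P where P: "clinear_map lstar lstar P" "continuous_map (topol lstar) (topol lstar) P"
    "\<And>x. x \<in> carrier lstar \<Longrightarrow> P (P x) = P x" "P ` carrier lstar = S"
    using assms unfolding complemented_in_def by blast
  have "closedin (topol lstar) {x \<in> topspace (topol lstar). P x = id x}"
    by (rule closedin_continuous_maps_eq[OF Hausdorff_lstar P(2) continuous_map_id])
  moreover have "{x \<in> topspace (topol lstar). P x = id x} = S"
  proof (intro equalityI subsetI)
    fix x assume "x \<in> S"
    then obtain y where "y \<in> carrier lstar" "x = P y" using P(4) by blast
    then show "x \<in> {x \<in> topspace (topol lstar). P x = id x}"
      using P(1,3) unfolding topspace_carrier clinear_map_def by auto
  next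
    fix x assume "x \<in> {x \<in> topspace (topol lstar). P x = id x}"
    then have "x \<in> carrier lstar" "P x = x" unfolding topspace_carrier by auto
    then show "x \<in> S" using P(4) by (metis image_eqI)
  qed
  ultimately show ?thesis by simp
qed


section \<open>Scalar products and bounded sets\<close>

locale inner_product_module = Module.module complex_field V
  for V :: "('a, 'm) tvs_scheme" (structure) +
  fixes ip :: "'a \<Rightarrow> 'a \<Rightarrow> complex"
  assumes scalar_product: "scalar_product V ip"
begin

lemma ip_add_left: "\<lbrakk>x \<in> carrier V; y \<in> carrier V; z \<in> carrier V\<rbrakk> \<Longrightarrow> ip (x \<oplus> y) z = ip x z + ip y z"
  and ip_smult_left: "\<lbrakk>x \<in> carrier V; z \<in> carrier V\<rbrakk> \<Longrightarrow> ip (c \<odot> x) z = c * ip x z"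
  and ip_cnj: "\<lbrakk>x \<in> carrier V; y \<in> carrier V\<rbrakk> \<Longrightarrow> ip y x = cnj (ip x y)"
  and ip_pos: "\<lbrakk>x \<in> carrier V; x \<noteq> \<zero>\<rbrakk> \<Longrightarrow> 0 < Re (ip x x)"
  using scalar_product unfolding scalar_product_def linear_functional_def by blast+

lemma ip_zero_left: "z \<in> carrier V \<Longrightarrow> ip \<zero> z = 0"
  using ip_smult_left[of \<zero> z 0] smult_l_null[of \<zero>] by simp

lemma ip_add_right: "\<lbrakk>x \<in> carrier V; y \<in> carrier V; z \<in> carrier V\<rbrakk> \<Longrightarrow> ip z (x \<oplus> y) = ip z x + ip z y"
  using ip_add_left[of x y z] ip_cnj[of "x \<oplus> y" z] ip_cnj[of x z] ip_cnj[of y z] by simp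

lemma ip_smult_right: "\<lbrakk>x \<in> carrier V; z \<in> carrier V\<rbrakk> \<Longrightarrow> ip z (c \<odot> x) = cnj c * ip z x"
  using ip_smult_left[of x z c] ip_cnj[of "c \<odot> x" z] ip_cnj[of x z] by simp

lemma ip_self_nonneg: "x \<in> carrier V \<Longrightarrow> 0 \<le> Re (ip x x)"
  using ip_pos[of x] ip_zero_left[of \<zero>] by (cases "x = \<zero>") auto

lemma ip_self_real: "x \<in> carrier V \<Longrightarrow> ip x x = complex_of_real (Re (ip x x))"
  using ip_cnj[of x x] by (simp add: complex_eq_iff)

lemma ip_Cauchy_Schwarz_power2:
  assumes x: "x \<in> carrier V" and y: "y \<in> carrier V"
  shows "(cmod (ip x y))\<^sup>2 \<le> Re (ip x x) * Re (ip y y)"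
proof (cases "y = \<zero>")
  case True
  then have "ip x y = 0" using ip_cnj[of y x] ip_zero_left[of x] x y by simp
  then show ?thesis using ip_zero_left[of y] y True by simp
next
  case False
  define a b t where "a = Re (ip x x)" and "b = Re (ip y y)" and "t = ip x y"
  have b: "b > 0" using ip_pos[OF y False] by (simp add: b_def)
  have xx: "ip x x = complex_of_real a" and yy: "ip y y = complex_of_real b"
    using ip_self_real x y by (simp_all add: a_def b_def)
  have yx: "ip y x = cnj t" using ip_cnj[OF x y] by (simp add: t_def)
  \<comment> \<open>The component of \<open>x\<close> orthogonal to \<open>y\<close>, multiplied by
    \<open>b\<close> to avoid a division.\<close>
  define z where "z = (complex_of_real b \<odot> x) \<oplus> ((- t) \<odot> y)"
  have zc: "z \<in> carrier V" using x y by (simp add: z_def)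
  have ip_z: "ip z v = complex_of_real b * ip x v - t * ip y v" if "v \<in> carrier V" for v
    using x y that by (simp add: z_def ip_add_left ip_smult_left)
  have zx: "ip z x = complex_of_real (b * a - (cmod t)\<^sup>2)"
    using ip_z[OF x] complex_norm_square[of t] by (simp add: xx yx)
  have zy: "ip z y = 0" using ip_z[OF y] by (simp add: yy flip: t_def)
  have "ip x z = cnj (ip z x)" "ip y z = cnj (ip z y)" using ip_cnj[OF zc x] ip_cnj[OF zc y] by auto
  then have "ip z z = complex_of_real (b * (b * a - (cmod t)\<^sup>2))"
    using ip_z[OF zc] by (simp add: zx zy)
  then have "0 \<le> b * (b * a - (cmod t)\<^sup>2)" using ip_self_nonneg[OF zc] by (simp del: of_real_mult of_real_diff)
  then have "0 \<le> b * a - (cmod t)\<^sup>2" using b by (simp add: zero_le_mult_iff)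
  then show ?thesis by (simp add: a_def b_def t_def mult.commute)
qed

abbreviation nrm :: "'a \<Rightarrow> real" where "nrm x \<equiv> sqrt (Re (ip x x))"

lemma ip_Cauchy_Schwarz:
  assumes "x \<in> carrier V" "y \<in> carrier V"
  shows "cmod (ip x y) \<le> nrm x * nrm y"
proof -
  have "sqrt ((cmod (ip x y))\<^sup>2) \<le> sqrt (Re (ip x x) * Re (ip y y))"
    by (intro real_sqrt_le_mono ip_Cauchy_Schwarz_power2 assms)
  then show ?thesis by (simp add: real_sqrt_mult)
qed

lemma seminorm_on_nrm: "seminorm_on V nrm"
  unfolding seminorm_on_def
proof (intro conjI ballI allI)
  fix x assume x: "x \<in> carrier V"
  show "0 \<le> nrm x" using ip_self_nonneg[OF x] by simp
  fix c
  have "ip (c \<odot> x) (c \<odot> x) = complex_of_real ((cmod c)\<^sup>2) * ip x x"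
    using x complex_norm_square[of c] by (simp add: ip_smult_left ip_smult_right mult.commute)
  then have "Re (ip (c \<odot> x) (c \<odot> x)) = (cmod c)\<^sup>2 * Re (ip x x)" by simp
  then show "nrm (c \<odot> x) = cmod c * nrm x" by (simp add: real_sqrt_mult)
next
  fix x y assume x: "x \<in> carrier V" and y: "y \<in> carrier V"
  have "Re (ip (x \<oplus> y) (x \<oplus> y)) = Re (ip x x) + 2 * Re (ip x y) + Re (ip y y)"
    using x y ip_cnj[OF x y] by (simp add: ip_add_left ip_add_right)
  also have "\<dots> \<le> Re (ip x x) + 2 * (nrm x * nrm y) + Re (ip y y)"
    using ip_Cauchy_Schwarz[OF x y] complex_Re_le_cmod[of "ip x y"] by linarith
  also have "\<dots> = (nrm x + nrm y)\<^sup>2"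
    using ip_self_nonneg[OF x] ip_self_nonneg[OF y] by (simp add: power2_sum)
  finally show "nrm (x \<oplus> y) \<le> nrm x + nrm y"
    using ip_self_nonneg[OF x] ip_self_nonneg[OF y] by (intro real_le_lsqrt) (auto intro: ip_self_nonneg x y)
qed

end

section \<open>Bounded sets of rapidly decreasing sequences, and operators on them\<close>

lemma s_boundedI:
  assumes "\<And>q. \<exists>D. \<forall>\<xi>\<in>B. \<forall>j. real (Suc j) ^ q * cmod (\<xi> j) \<le> D"
  shows "s_bounded B"
proof -
  have b: "\<exists>D\<ge>0. \<forall>\<xi>\<in>B. \<forall>j. cmod (\<xi> j) \<le> D * exp (- real q * s_exponent j)" for q
  proof -
    obtain D where D: "\<forall>\<xi>\<in>B. \<forall>j. real (Suc j) ^ q * cmod (\<xi> j) \<le> D" using assms by blast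
    have "cmod (\<xi> j) \<le> \<bar>D\<bar> * exp (- real q * s_exponent j)" if "\<xi> \<in> B" for \<xi> j
    proof -
      have "exp (real q * s_exponent j) * cmod (\<xi> j) \<le> \<bar>D\<bar>"
        unfolding exp_s_exponent using D that by (meson abs_ge_self order_trans)
      then show ?thesis unfolding mult_minus_left by (rule exp_mult_le_imp)
    qed
    then show ?thesis by (intro exI[of _ "\<bar>D\<bar>"]) auto
  qed
  have "B \<subseteq> s_space"
    unfolding s_space_eq
  proof
    fix \<xi> assume "\<xi> \<in> B"
    then show "\<xi> \<in> psp_carrier s_exponent" using b
      by (intro psp_of_coordinate_bounds[OF summable_s_exponent]) blast
  qed
  moreover have "bdd_above (s_norm q ` B)" for q
  proof -
    obtain D where D: "0 \<le> D" "\<forall>\<xi>\<in>B. \<forall>j. cmod (\<xi> j) \<le> D * exp (- real (q + 1) * s_exponent j)"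
      using b[of "q + 1"] by blast
    show ?thesis unfolding s_norm_eq
      by (rule bdd_aboveI2[where M = "D * sqrt (\<Sum>j. exp (- 2 * real 1 * s_exponent j))"],
          rule psp_norm_of_coordinate_bounds[OF summable_s_exponent D(1)]) (use D(2) in blast)
  qed
  ultimately show ?thesis by (simp add: s_bounded_def)
qed

lemma s_bounded_box:
  assumes "\<And>q. \<exists>D. \<forall>j. real (Suc j) ^ q * w j \<le> D"
  shows "s_bounded {\<xi>. \<forall>j. cmod (\<xi> j) \<le> w j}"
proof (rule s_boundedI)
  fix q
  obtain D where D: "\<And>j. real (Suc j) ^ q * w j \<le> D" using assms by blast
  show "\<exists>D. \<forall>\<xi>\<in>{\<xi>. \<forall>j. cmod (\<xi> j) \<le> w j}. \<forall>j. real (Suc j) ^ q * cmod (\<xi> j) \<le> D"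
  proof (intro exI[of _ D] ballI allI)
    fix \<xi> :: cseq and j assume "\<xi> \<in> {\<xi>. \<forall>j. cmod (\<xi> j) \<le> w j}"
    then have "real (Suc j) ^ q * cmod (\<xi> j) \<le> real (Suc j) ^ q * w j" by (intro mult_left_mono) auto
    then show "real (Suc j) ^ q * cmod (\<xi> j) \<le> D" using D[of j] by linarith
  qed
qed

text \<open>Each \<open>B n\<close> is divided by a number \<open>L n\<close> that exceeds its
  bounds for the weights up to \<open>n\<close>. For a given weight \<open>q\<close> all sets with
  \<open>n \<ge> q\<close> are then bounded by 1, and only finitely many others contribute to the
  constant, so the union of the shrunken sets is bounded.\<close>

lemma s_bounded_countable_absorb:
  assumes B: "\<And>n::nat. s_bounded (B n)"
  obtains w :: "nat \<Rightarrow> real" where "\<And>j. 0 \<le> w j" "\<And>q. \<exists>D. \<forall>j. real (Suc j) ^ q * w j \<le> D"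
    "\<And>n. \<exists>C>0. \<forall>\<xi>\<in>B n. \<forall>j. cmod (\<xi> j) \<le> C * w j"
proof -
  have "\<exists>m. \<forall>\<xi>\<in>B n. s_norm q \<xi> \<le> m" for n q
    using B[of n] unfolding s_bounded_def bdd_above_def by blast
  then obtain m where m: "\<And>n q \<xi>. \<xi> \<in> B n \<Longrightarrow> s_norm q \<xi> \<le> m n q" by metis
  define M where "M n q = max 0 (m n q)" for n q
  have M0: "0 \<le> M n q" for n q by (simp add: M_def)
  have M: "real (Suc j) ^ q * cmod (\<xi> j) \<le> M n q" if "\<xi> \<in> B n" for n q \<xi> j
    using s_coordinate[OF s_boundedD[OF B that], of j q] m[OF that, of q] by (simp add: M_def)
  define L where "L n = 1 + (\<Sum>q\<le>n. M n q)" for n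
  have L1: "1 \<le> L n" for n by (simp add: L_def sum_nonneg M0)
  have LM: "M n q \<le> L n" if "q \<le> n" for n q
    using member_le_sum[of q "{..n}" "M n"] that M0 by (simp add: L_def)
  \<comment> \<open>The inserted 0 makes the set nonempty and its supremum nonnegative, even if all
    \<open>B n\<close> are empty.\<close>
  define A where "A j = insert 0 {cmod (\<xi> j) / L n | n \<xi>. \<xi> \<in> B n}" for j
  define w where "w j = Sup (A j)" for j
  have A_le: "a \<le> (1 + (\<Sum>n<q. M n q)) / real (Suc j) ^ q" if aj: "a \<in> A j" for a j q
  proof (cases "a = 0")
    case True
    then show ?thesis by (simp add: sum_nonneg M0)
  next
    case False
    then obtain n \<xi> where a: "\<xi> \<in> B n" "a = cmod (\<xi> j) / L n" using aj by (auto simp: A_def)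
    have "M n q / L n \<le> 1 + (\<Sum>n<q. M n q)"
    proof (cases "q \<le> n")
      case True
      have "M n q / L n \<le> 1" using LM[OF True] L1[of n] by simp
      then show ?thesis using sum_nonneg[of "{..<q}" "\<lambda>n. M n q"] M0 by fastforce
    next
      case False
      have "M n q / L n \<le> M n q / 1" using L1[of n] M0[of n q] by (intro divide_left_mono) auto
      also have "\<dots> \<le> (\<Sum>n<q. M n q)" using member_le_sum[of n "{..<q}" "\<lambda>n. M n q"] False M0 by simp
      finally show ?thesis by simp
    qed
    moreover have "real (Suc j) ^ q * a \<le> M n q / L n"
      using M[OF a(1), of j q] L1[of n] unfolding a(2) by (simp add: divide_right_mono del: of_nat_Suc)
    ultimately have "real (Suc j) ^ q * a \<le> 1 + (\<Sum>n<q. M n q)" by linarith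
    then show ?thesis by (simp add: field_simps del: of_nat_Suc)
  qed
  have bdd: "bdd_above (A j)" for j using A_le[of _ j 0] by (intro bdd_aboveI) auto
  have w0: "0 \<le> w j" for j unfolding w_def by (rule cSup_upper[OF _ bdd]) (simp add: A_def)
  moreover have "\<exists>D. \<forall>j. real (Suc j) ^ q * w j \<le> D" for q
  proof (intro exI allI)
    fix j
    have "w j \<le> (1 + (\<Sum>n<q. M n q)) / real (Suc j) ^ q"
      unfolding w_def by (rule cSup_least[OF _ A_le]) (simp_all add: A_def)
    then show "real (Suc j) ^ q * w j \<le> 1 + (\<Sum>n<q. M n q)" by (simp add: field_simps del: of_nat_Suc)
  qed
  moreover have "\<exists>C>0. \<forall>\<xi>\<in>B n. \<forall>j. cmod (\<xi> j) \<le> C * w j" for n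
  proof (intro exI[of _ "L n"] conjI ballI allI)
    show "0 < L n" using L1[of n] by linarith
    fix \<xi> j assume "\<xi> \<in> B n"
    then have "cmod (\<xi> j) / L n \<le> w j" unfolding w_def by (intro cSup_upper[OF _ bdd]) (auto simp: A_def)
    then show "cmod (\<xi> j) \<le> L n * w j" using \<open>0 < L n\<close> by (simp add: field_simps)
  qed
  ultimately show thesis by (rule that)
qed

text \<open>\<open>\<xi>\<close> is expanded in unit vectors, and the continuity of \<open>x\<close>
  makes the contribution of the tails vanish. A bound on a whole box thereby follows from the images
  of the unit vectors.\<close>

lemma lstar_series_bound:
  assumes x: "x \<in> lstar_carrier" and \<xi>: "\<xi> \<in> s_space" and c: "summable c"
    and bound: "\<And>j. cmod (\<xi> j) * s_norm q (x (unit_seq j)) \<le> T * c j" and c0: "\<And>j. 0 \<le> c j" and T: "0 \<le> T"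
  shows "s_norm q (x \<xi>) \<le> T * suminf c"
proof -
  obtain C r where C: "0 < C" "\<And>\<xi>. \<xi> \<in> s_space \<Longrightarrow> s_norm q (x \<xi>) \<le> C * s_norm r \<xi>"
    using lstar_bounded[OF x, of q] by blast
  have hs: "(\<lambda>j. \<Sum>i<n. \<xi> i * unit_seq i j) \<in> s_space" for n
    unfolding s_space_eq by (rule head_seq_psp)
  have ts: "tail_seq n \<xi> \<in> s_space" for n using \<xi> unfolding s_space_eq by (rule tail_seq_psp)
  have head: "s_norm q (x (\<lambda>j. \<Sum>i<n. \<xi> i * unit_seq i j)) \<le> (\<Sum>i<n. T * c i)" for n
  proof (induction n)
    case 0
    have "x (\<lambda>j. 0) = (\<lambda>j. 0)" using lstar_scale[OF x s_zero, of 0] by simp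
    then show ?case by (simp add: s_norm_def)
  next
    case (Suc n)
    have us: "(\<lambda>j. \<xi> n * unit_seq n j) \<in> s_space" by (rule s_scale[OF unit_seq_s])
    have "x (\<lambda>j. \<Sum>i<Suc n. \<xi> i * unit_seq i j)
      = (\<lambda>j. x (\<lambda>j. \<Sum>i<n. \<xi> i * unit_seq i j) j + \<xi> n * x (unit_seq n) j)"
      using lstar_add[OF x hs[of n] us] lstar_scale[OF x unit_seq_s[of n], of "\<xi> n"] by simp
    moreover have "s_norm q (\<lambda>j. x (\<lambda>j. \<Sum>i<n. \<xi> i * unit_seq i j) j + \<xi> n * x (unit_seq n) j)
      \<le> s_norm q (x (\<lambda>j. \<Sum>i<n. \<xi> i * unit_seq i j)) + cmod (\<xi> n) * s_norm q (x (unit_seq n))"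
      using s_norm_add[OF lstar_apply[OF x hs[of n]] s_scale[OF lstar_apply[OF x unit_seq_s[of n]]], of q "\<xi> n"]
        s_norm_scale[OF lstar_apply[OF x unit_seq_s[of n]], of q "\<xi> n"] by simp
    ultimately show ?case using Suc bound[of n] by simp
  qed
  have b: "s_norm q (x \<xi>) \<le> T * suminf c + C * s_norm r (tail_seq n \<xi>)" for n
  proof -
    have "x \<xi> = (\<lambda>j. x (\<lambda>j. \<Sum>i<n. \<xi> i * unit_seq i j) j + x (tail_seq n \<xi>) j)"
      by (subst head_plus_tail[of \<xi> n]) (rule lstar_add[OF x hs ts])
    then have "s_norm q (x \<xi>) \<le> s_norm q (x (\<lambda>j. \<Sum>i<n. \<xi> i * unit_seq i j)) + s_norm q (x (tail_seq n \<xi>))"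
      using s_norm_add[OF lstar_apply[OF x hs] lstar_apply[OF x ts], of q n n] by simp
    also have "\<dots> \<le> (\<Sum>i<n. T * c i) + C * s_norm r (tail_seq n \<xi>)"
      by (intro add_mono head C(2) ts)
    also have "(\<Sum>i<n. T * c i) \<le> T * suminf c"
      unfolding sum_distrib_left[symmetric] using c0 T by (intro mult_left_mono sum_le_suminf c) auto
    finally show ?thesis by simp
  qed
  have "(\<lambda>n. T * suminf c + C * s_norm r (tail_seq n \<xi>)) \<longlonglongrightarrow> T * suminf c + C * 0"
    unfolding s_norm_eq using \<xi> by (intro tendsto_intros tail_seq_tendsto) (simp add: s_space_eq)
  then have "s_norm q (x \<xi>) \<le> T * suminf c + C * 0"
    by (rule LIMSEQ_le_const) (use b in blast)
  then show ?thesis by simp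
qed

text \<open>Both squared norms come from the same operator, the composition of \<open>x\<close> with
  its adjoint in either order. This is where commutativity of the algebra will enter. Only the norm
  of index 0 has this symmetry, so higher norms have to be reached by interpolation.\<close>

lemma lstar_normal_norm:
  assumes x: "x \<in> lstar_carrier" and comm: "compose s_space (star lstar x) x = compose s_space x (star lstar x)"
    and \<xi>: "\<xi> \<in> s_space"
  shows "l2_norm (adjoint_op x \<xi>) = l2_norm (x \<xi>)"
proof -
  note xs = lstar_apply[OF x \<xi>] and as = lstar_adjoint_apply[OF x \<xi>]
  have "adjoint_op x (x \<xi>) = x (adjoint_op x \<xi>)"
    using fun_cong[OF comm, of \<xi>] \<xi> xs as by (simp add: compose_def)
  then have "l2_inner (x \<xi>) (x \<xi>) = l2_inner \<xi> (x (adjoint_op x \<xi>))"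
    using lstar_adjoint[OF x \<xi> xs] by simp
  also have "\<dots> = cnj (l2_inner (x (adjoint_op x \<xi>)) \<xi>)"
    by (rule l2_inner_cnj[OF s_l2[OF lstar_apply[OF x as]] s_l2[OF \<xi>]])
  also have "l2_inner (x (adjoint_op x \<xi>)) \<xi> = l2_inner (adjoint_op x \<xi>) (adjoint_op x \<xi>)"
    by (rule lstar_adjoint[OF x as \<xi>])
  finally have "complex_of_real ((l2_norm (x \<xi>))\<^sup>2) = complex_of_real ((l2_norm (adjoint_op x \<xi>))\<^sup>2)"
    by (simp add: l2_inner_self s_l2 xs as)
  then have "(l2_norm (x \<xi>))\<^sup>2 = (l2_norm (adjoint_op x \<xi>))\<^sup>2" by (simp only: of_real_eq_iff)
  then show ?thesis using s_l2[OF xs] s_l2[OF as] by (simp add: power2_eq_iff_nonneg)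
qed


section \<open>Subalgebras of the operator algebra are DN-algebras\<close>

lemma subalgebra_of_sel [simp]:
  "carrier (subalgebra_of A S) = S" "topol (subalgebra_of A S) = subtopology (topol A) S"
  "x \<oplus>\<^bsub>subalgebra_of A S\<^esub> y = x \<oplus>\<^bsub>A\<^esub> y" "c \<odot>\<^bsub>subalgebra_of A S\<^esub> x = c \<odot>\<^bsub>A\<^esub> x"
  "x \<otimes>\<^bsub>subalgebra_of A S\<^esub> y = x \<otimes>\<^bsub>A\<^esub> y" "star (subalgebra_of A S) x = star A x"
  by (simp_all add: subalgebra_of_def)

lemma lstar_adjoint_scale:
  assumes "x \<in> lstar_carrier" "\<xi> \<in> s_space"
  shows "adjoint_op x (\<lambda>j. c * \<xi> j) = (\<lambda>j. c * adjoint_op x \<xi> j)"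
  using lstar_scale[OF lstar_star_closed(1)[OF assms(1)] assms(2), of c] assms(2) s_scale[OF assms(2), of c] by simp

lemma lstar_seminorm_absorb:
  assumes x: "x \<in> lstar_carrier" and B: "s_bounded B" "B \<noteq> {}" and B': "s_bounded B'" and C: "0 < C"
    and absorb: "\<And>\<xi>. \<xi> \<in> B \<Longrightarrow> (\<lambda>j. complex_of_real (1 / C) * \<xi> j) \<in> B'"
  shows "lstar_seminorm N B x \<le> C * lstar_seminorm N B' x"
proof (rule lstar_seminorm_least[OF B(2)])
  fix \<xi> assume b: "\<xi> \<in> B"
  note \<xi> = s_boundedD[OF B(1) b]
  let ?\<eta> = "\<lambda>j. complex_of_real (1 / C) * \<xi> j"
  have e1: "s_norm N (x ?\<eta>) = (1 / C) * s_norm N (x \<xi>)"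
    unfolding lstar_scale[OF x \<xi>] using C by (subst s_norm_scale[OF lstar_apply[OF x \<xi>]]) (simp add: norm_divide)
  show "s_norm N (x \<xi>) \<le> C * lstar_seminorm N B' x"
    using lstar_seminorm_upper(1)[OF x B' absorb[OF b], of N, unfolded e1] C by (simp add: field_simps)
  have e2: "s_norm N (adjoint_op x ?\<eta>) = (1 / C) * s_norm N (adjoint_op x \<xi>)"
    unfolding lstar_adjoint_scale[OF x \<xi>] using C
    by (subst s_norm_scale[OF lstar_adjoint_apply[OF x \<xi>]]) (simp add: norm_divide)
  show "s_norm N (adjoint_op x \<xi>) \<le> C * lstar_seminorm N B' x"
    using lstar_seminorm_upper(2)[OF x B' absorb[OF b], of N, unfolded e2] C by (simp add: field_simps)
qed

locale lstar_embedded = unital_commutative_frechet_star_algebra E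
  for E :: "('a, 'm) star_tvs_scheme" (structure) +
  fixes S f
  assumes sub: "star_subalgebra S lstar"
    and iso: "tvs_isomorphism E (subalgebra_of lstar S) f"
    and f_mult: "\<lbrakk>x \<in> carrier E; y \<in> carrier E\<rbrakk> \<Longrightarrow> f (x \<otimes> y) = compose s_space (f x) (f y)"
    and f_star: "x \<in> carrier E \<Longrightarrow> f (star E x) = star lstar (f x)"
begin

lemma f_S: "x \<in> carrier E \<Longrightarrow> f x \<in> S"
  and f_add: "\<lbrakk>x \<in> carrier E; y \<in> carrier E\<rbrakk> \<Longrightarrow> f (x \<oplus> y) = f x \<oplus>\<^bsub>lstar\<^esub> f y"
  and f_smult: "x \<in> carrier E \<Longrightarrow> f (c \<odot> x) = c \<odot>\<^bsub>lstar\<^esub> f x"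
  using iso unfolding tvs_isomorphism_def clinear_map_def subalgebra_of_sel by auto

lemma f_lstar: "x \<in> carrier E \<Longrightarrow> f x \<in> lstar_carrier"
  using f_S sub unfolding star_subalgebra_def by auto

lemma f_image: "f ` carrier E = S"
  using iso unfolding tvs_isomorphism_def bij_betw_def by simp

lemma clinear_f: "clinear_map E lstar f"
  unfolding clinear_map_def lstar_sel(1) using f_lstar f_add f_smult by blast

lemma seminormed_E: "seminormed_space E ((\<lambda>q x. q (f x)) ` lstar_seminorms)"
proof (rule seminormed_space_embedding[OF seminormed_space_lstar module_axioms topspace_eq clinear_f])
  show "inj_on f (carrier E)" using iso unfolding tvs_isomorphism_def bij_betw_def by simp
  show "homeomorphic_map (topol E) (subtopology (topol lstar) (f ` carrier E)) f"
    using iso unfolding f_image tvs_isomorphism_def by simp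
qed

sublocale E: seminormed_space E "(\<lambda>q x. q (f x)) ` lstar_seminorms"
  by (rule seminormed_E)

lemma continuous_lstar_seminorm:
  assumes "s_bounded B" "B \<noteq> {}"
  shows "continuous_seminorm E (\<lambda>x. lstar_seminorm N B (f x))"
proof -
  have "(\<lambda>x. lstar_seminorm N B (f x)) \<in> (\<lambda>q x. q (f x)) ` lstar_seminorms" using assms by blast
  then show ?thesis by (intro E.continuous_seminormI[OF E.seminorms, of _ _ 1]) auto
qed

lemma unit_norm_adjoint:
  assumes "x \<in> carrier E" "\<xi> \<in> s_space"
  shows "l2_norm (adjoint_op (f x) \<xi>) = l2_norm (f x \<xi>)"
proof (rule lstar_normal_norm[OF f_lstar[OF assms(1)] _ assms(2)])
  show "compose s_space (star lstar (f x)) (f x) = compose s_space (f x) (star lstar (f x))"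
    using f_mult[of x "star E x"] f_mult[of "star E x" x] mult_commute[of x "star E x"]
      star_closed[OF assms(1)] f_star[OF assms(1)] assms(1) by simp
qed

text \<open>Metrizability gives a countable base at zero, each member of which contains a ball of a
  seminorm with some bounded set \<open>B n\<close>. Absorbing all \<open>B n\<close> in one box
  leaves a fundamental system in which only the index \<open>q\<close> varies.\<close>

lemma fundamental_weight:
  obtains w :: "nat \<Rightarrow> real" where "\<And>j. 0 \<le> w j" "\<And>q. \<exists>D. \<forall>j. real (Suc j) ^ q * w j \<le> D"
    "fundamental_system E (\<lambda>q x. lstar_seminorm q {\<xi>. \<forall>j. cmod (\<xi> j) \<le> w j} (f x))"
proof -
  have "first_countable (topol E)" by (rule metrizable_imp_first_countable[OF metrizable])
  then obtain \<B> where \<B>: "countable \<B>" "\<And>V. V \<in> \<B> \<Longrightarrow> openin (topol E) V"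
    "\<And>U. openin (topol E) U \<Longrightarrow> \<zero> \<in> U \<Longrightarrow> \<exists>V\<in>\<B>. \<zero> \<in> V \<and> V \<subseteq> U"
    unfolding first_countable_def topspace_eq using zero_closed by meson
  define \<A> where "\<A> = {V \<in> \<B>. \<zero> \<in> V}"
  have cA: "countable \<A>" using \<B>(1) by (simp add: \<A>_def)
  moreover from cA have "\<A> \<noteq> {}" using \<B>(3)[of "carrier E"] openin_topspace[of "topol E"] topspace_eq by (auto simp: \<A>_def)
  ultimately have rg: "range (from_nat_into \<A>) = \<A>" by (rule range_from_nat_into[rotated])
  have "\<exists>N B e. s_bounded B \<and> B \<noteq> {} \<and> e > 0 \<and>
      (\<forall>z\<in>carrier E. lstar_seminorm N B (f z) < e \<longrightarrow> z \<in> from_nat_into \<A> n)" for n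
  proof -
    have "from_nat_into \<A> n \<in> \<A>" using rg by blast
    then have o: "openin (topol E) (from_nat_into \<A> n)" "\<zero> \<in> from_nat_into \<A> n"
      using \<B>(2) by (auto simp: \<A>_def)
    then obtain p e where p: "p \<in> (\<lambda>q x. q (f x)) ` lstar_seminorms" "e > 0"
      "\<forall>z\<in>carrier E. p z < e \<longrightarrow> \<zero> \<oplus> z \<in> from_nat_into \<A> n"
      using o(1)[unfolded E.openin_iff] by meson
    then obtain N B where "p = (\<lambda>x. lstar_seminorm N B (f x))" "s_bounded B" "B \<noteq> {}" by blast
    then show ?thesis using p(2,3) by (intro exI[of _ N] exI[of _ B] exI[of _ e]) auto
  qed
  from choice[OF allI[OF this]] obtain N where "\<forall>n. \<exists>B e. s_bounded B \<and> B \<noteq> {} \<and> e > 0 \<and>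
      (\<forall>z\<in>carrier E. lstar_seminorm (N n) B (f z) < e \<longrightarrow> z \<in> from_nat_into \<A> n)" ..
  from choice[OF this] obtain B where "\<forall>n. \<exists>e. s_bounded (B n) \<and> B n \<noteq> {} \<and> e > 0 \<and>
      (\<forall>z\<in>carrier E. lstar_seminorm (N n) (B n) (f z) < e \<longrightarrow> z \<in> from_nat_into \<A> n)" ..
  from choice[OF this] obtain e where "\<forall>n. s_bounded (B n) \<and> B n \<noteq> {} \<and> e n > 0 \<and>
      (\<forall>z\<in>carrier E. lstar_seminorm (N n) (B n) (f z) < e n \<longrightarrow> z \<in> from_nat_into \<A> n)" ..
  then have NBe: "\<And>n. s_bounded (B n)" "\<And>n. B n \<noteq> {}" "\<And>n. e n > (0::real)"
    "\<And>n z. z \<in> carrier E \<Longrightarrow> lstar_seminorm (N n) (B n) (f z) < e n \<Longrightarrow> z \<in> from_nat_into \<A> n"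
    by blast+
  obtain w where w: "\<And>j. 0 \<le> w j" "\<And>q. \<exists>D. \<forall>j. real (Suc j) ^ q * w j \<le> D"
    "\<And>n. \<exists>C>0. \<forall>\<xi>\<in>B n. \<forall>j. cmod (\<xi> j) \<le> C * w j"
    using s_bounded_countable_absorb[of B] NBe(1) by blast
  define W where "W = {\<xi>. \<forall>j. cmod (\<xi> j) \<le> w j}"
  have Wb: "s_bounded W" unfolding W_def by (rule s_bounded_box[OF w(2)])
  have "(\<lambda>_. 0) \<in> W" using w(1) by (simp add: W_def)
  then have W0: "W \<noteq> {}" by blast
  have "fundamental_system E (\<lambda>q x. lstar_seminorm q W (f x))"
    unfolding fundamental_system_def
  proof (intro conjI allI ballI impI)
    show "continuous_seminorm E (\<lambda>x. lstar_seminorm q W (f x))" for q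
      by (rule continuous_lstar_seminorm[OF Wb W0])
    show "lstar_seminorm q W (f x) \<le> lstar_seminorm (Suc q) W (f x)" if "x \<in> carrier E" for q x
      by (rule lstar_seminorm_mono[OF f_lstar[OF that] Wb subset_refl W0]) simp
    fix U assume U: "openin (topol E) U \<and> \<zero> \<in> U"
    then obtain V where "V \<in> \<A>" "V \<subseteq> U" using \<B>(3)[of U] by (auto simp: \<A>_def)
    then obtain n where n: "from_nat_into \<A> n \<subseteq> U" using from_nat_into_surj[OF cA] by blast
    obtain C where C: "C > 0" "\<And>\<xi> j. \<xi> \<in> B n \<Longrightarrow> cmod (\<xi> j) \<le> C * w j" using w(3)[of n] by blast
    show "\<exists>q. \<exists>e>0. {x \<in> carrier E. lstar_seminorm q W (f x) < e} \<subseteq> U"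
    proof (intro exI[of _ "N n"] exI[of _ "e n / C"] conjI subsetI)
      show "0 < e n / C" using NBe(3) C(1) by simp
      fix x assume "x \<in> {x \<in> carrier E. lstar_seminorm (N n) W (f x) < e n / C}"
      then have x: "x \<in> carrier E" "lstar_seminorm (N n) W (f x) < e n / C" by auto
      have "lstar_seminorm (N n) (B n) (f x) \<le> C * lstar_seminorm (N n) W (f x)"
      proof (rule lstar_seminorm_absorb[OF f_lstar[OF x(1)] NBe(1,2) Wb C(1)])
        fix \<xi> assume "\<xi> \<in> B n"
        from C(2)[OF this] show "(\<lambda>j. complex_of_real (1 / C) * \<xi> j) \<in> W"
          using C(1) by (auto simp: W_def norm_mult norm_divide field_simps)
      qed
      also have "\<dots> < e n" using x(2) C(1) by (simp add: field_simps)
      finally show "x \<in> U" using NBe(4)[OF x(1)] n by blast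
    qed
  qed
  then show thesis using that[OF w(1,2)] by (simp add: W_def)
qed

lemma DN_algebra_E: "DN_algebra E"
proof -
  obtain w :: "nat \<Rightarrow> real" where w: "\<And>j. 0 \<le> w j" "\<And>q. \<exists>D. \<forall>j. real (Suc j) ^ q * w j \<le> D"
    and fund: "fundamental_system E (\<lambda>q x. lstar_seminorm q {\<xi>. \<forall>j. cmod (\<xi> j) \<le> w j} (f x))"
    using fundamental_weight by blast
  define W where "W = {\<xi>. \<forall>j. cmod (\<xi> j) \<le> w j}"
  have Wb: "s_bounded W" unfolding W_def by (rule s_bounded_box[OF w(2)])
  have "(\<lambda>_. 0) \<in> W" using w(1) by (simp add: W_def)
  then have W0: "W \<noteq> {}" by blast
  define P where "P q x = lstar_seminorm q W (f x)" for q x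
  have fundP: "fundamental_system E P" using fund unfolding P_def W_def .
  define c where "c j = inverse (real (Suc j) ^ 2)" for j
  have c_pos: "0 < c j" for j by (simp add: c_def)
  have c_sum: "summable c"
    unfolding c_def summable_Suc_iff[of "\<lambda>j. inverse (real j ^ 2)"]
    by (rule inverse_power_summable) simp
  \<comment> \<open>The exponent 4 gives \<open>w j = (c j)^2 * u j\<close>. Interpolation takes a
    square root of this product, which leaves the summable factor \<open>c j\<close>.\<close>
  define u where "u j = w j * real (Suc j) ^ 4" for j
  have u0: "0 \<le> u j" for j using w(1) by (simp add: u_def)
  \<comment> \<open>There is one more factor \<open>j + 1\<close> than in \<open>u\<close>: then
    \<open>u j * l2_norm (a x j)\<close> is at most \<open>K x / (j + 1)\<close>, and the series for
    the scalar product converges and is continuous.\<close>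
  define W' where "W' = range (\<lambda>j i. complex_of_real (u j * real (Suc j)) * unit_seq j i)"
  have Wb': "s_bounded W'"
  proof (rule s_boundedI)
    fix q
    \<comment> \<open>Of the five powers, four come from \<open>u\<close> and one from the
      additional factor in \<open>W'\<close>.\<close>
    obtain D where D: "\<And>j. real (Suc j) ^ (q + 5) * w j \<le> D" using w(2)[of "q + 5"] by blast
    have D0: "0 \<le> D" using D[of 0] w(1)[of 0] by simp
    show "\<exists>D. \<forall>\<xi>\<in>W'. \<forall>j. real (Suc j) ^ q * cmod (\<xi> j) \<le> D"
    proof (intro exI[of _ D] ballI allI)
      fix \<xi> i assume "\<xi> \<in> W'"
      then obtain j where \<xi>: "\<xi> = (\<lambda>i. complex_of_real (u j * real (Suc j)) * unit_seq j i)" by (auto simp: W'_def)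
      show "real (Suc i) ^ q * cmod (\<xi> i) \<le> D"
      proof (cases "i = j")
        case True
        have "cmod (\<xi> i) = u j * real (Suc j)" unfolding \<xi> True using u0[of j] by (simp add: norm_mult del: of_nat_Suc)
        then have "real (Suc i) ^ q * cmod (\<xi> i) = real (Suc j) ^ (q + 5) * w j"
          unfolding True u_def by (simp add: power_add algebra_simps eval_nat_numeral del: of_nat_Suc)
        then show ?thesis using D[of j] by simp
      qed (simp add: \<xi> D0)
    qed
  qed
  have W0': "W' \<noteq> {}" by (simp add: W'_def)
  define K where "K x = lstar_seminorm 0 W' (f x)" for x
  have K0: "0 \<le> K x" if "x \<in> carrier E" for x
    unfolding K_def by (rule lstar_seminorm_nonneg[OF f_lstar[OF that] Wb' W0'])
  define a where "a x j = f x (unit_seq j)" for x j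
  have as: "a x j \<in> s_space" if "x \<in> carrier E" for x j
    unfolding a_def by (rule lstar_apply[OF f_lstar[OF that] unit_seq_s])
  note al = s_l2[OF as]
  have uaK: "u j * l2_norm (a x j) \<le> K x * (1 / real (Suc j))" if x: "x \<in> carrier E" for x j
  proof -
    have "(\<lambda>i. complex_of_real (u j * real (Suc j)) * unit_seq j i) \<in> W'" by (auto simp: W'_def)
    from lstar_seminorm_upper(1)[OF f_lstar[OF x] Wb' this, of 0]
    have "(u j * real (Suc j)) * l2_norm (a x j) \<le> K x"
      unfolding lstar_scale[OF f_lstar[OF x] unit_seq_s] s_norm_scale[OF lstar_apply[OF f_lstar[OF x] unit_seq_s]]
      using u0[of j] by (simp add: K_def a_def s_norm_0 norm_mult del: of_nat_Suc of_real_mult)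
    then show ?thesis by (simp add: field_simps del: of_nat_Suc)
  qed
  define t where "t x y j = complex_of_real ((u j)\<^sup>2) * l2_inner (a x j) (a y j)" for x y j
  have t_bound: "cmod (t x y j) \<le> K x * K y * c j" if x: "x \<in> carrier E" and y: "y \<in> carrier E" for x y j
  proof -
    have "cmod (t x y j) = (u j)\<^sup>2 * cmod (l2_inner (a x j) (a y j))" by (simp add: t_def norm_mult norm_power)
    also have "\<dots> \<le> (u j)\<^sup>2 * (l2_norm (a x j) * l2_norm (a y j))"
      by (intro mult_left_mono l2_Cauchy_Schwarz al x y) auto
    also have "\<dots> = (u j * l2_norm (a x j)) * (u j * l2_norm (a y j))" by (simp add: power2_eq_square)
    also have "\<dots> \<le> (K x * (1 / real (Suc j))) * (K y * (1 / real (Suc j)))"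
      by (intro mult_mono uaK x y mult_nonneg_nonneg u0 l2_norm_nonneg al K0) auto
    also have "\<dots> = K x * K y * c j" by (simp add: c_def power2_eq_square field_simps)
    finally show ?thesis .
  qed
  have t_sum: "summable (t x y)" if "x \<in> carrier E" "y \<in> carrier E" for x y
    by (rule summable_comparison_test'[OF summable_mult[OF c_sum, of "K x * K y"], of 0])
      (use t_bound[OF that] in auto)
  define ip where "ip x y = suminf (t x y)" for x y
  have ip_sums: "t x y sums ip x y" if "x \<in> carrier E" "y \<in> carrier E" for x y
    unfolding ip_def by (rule summable_sums[OF t_sum[OF that]])
  have a_add: "a (x \<oplus> y) j = (\<lambda>i. a x j i + a y j i)" if "x \<in> carrier E" "y \<in> carrier E" for x y j
    using f_add[OF that] by (simp add: a_def)
  have a_smult: "a (d \<odot> x) j = (\<lambda>i. d * a x j i)" if "x \<in> carrier E" for x j d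
    using f_smult[OF that] by (simp add: a_def)
  have lin: "linear_functional E (\<lambda>x. ip x z)" if z: "z \<in> carrier E" for z
    unfolding linear_functional_def
  proof (intro conjI ballI allI)
    fix x y assume x: "x \<in> carrier E" and y: "y \<in> carrier E"
    have "t (x \<oplus> y) z = (\<lambda>j. t x z j + t y z j)"
      by (simp add: t_def a_add x y l2_inner_add_left al z fun_eq_iff algebra_simps)
    then have "t (x \<oplus> y) z sums (ip x z + ip y z)" using sums_add[OF ip_sums[OF x z] ip_sums[OF y z]] by simp
    then show "ip (x \<oplus> y) z = ip x z + ip y z" by (simp add: ip_def sums_unique[symmetric])
  next
    fix d x assume x: "x \<in> carrier E"
    have "t (d \<odot> x) z = (\<lambda>j. d * t x z j)"
      by (simp add: t_def a_smult x l2_inner_scale_left al z fun_eq_iff algebra_simps)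
    then have "t (d \<odot> x) z sums (d * ip x z)" using sums_mult[OF ip_sums[OF x z], of d] by simp
    then show "ip (d \<odot> x) z = d * ip x z" by (simp add: ip_def sums_unique[symmetric])
  qed
  have conj: "ip y x = cnj (ip x y)" if x: "x \<in> carrier E" and y: "y \<in> carrier E" for x y
  proof -
    have "(\<lambda>j. cnj (t x y j)) = t y x"
      by (simp add: t_def fun_eq_iff l2_inner_cnj[OF al[OF x] al[OF y]])
    then have "t y x sums cnj (ip x y)" using ip_sums[OF x y] sums_cnj[of "t x y" "ip x y"] by simp
    then show ?thesis by (simp add: ip_def sums_unique[symmetric])
  qed
  have self_sums: "(\<lambda>j. (u j * l2_norm (a x j))\<^sup>2) sums Re (ip x x)" if x: "x \<in> carrier E" for x
  proof -
    have "Re (t x x j) = (u j * l2_norm (a x j))\<^sup>2" for j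
      by (simp add: t_def l2_inner_self[OF al[OF x]] power_mult_distrib flip: of_real_mult of_real_power)
    then show ?thesis using sums_Re[OF ip_sums[OF x x]] by simp
  qed
  define nm where "nm x = sqrt (Re (ip x x))" for x
  have self_nonneg: "0 \<le> Re (ip x x)" if "x \<in> carrier E" for x
    by (rule sums_le[OF _ sums_zero self_sums[OF that]]) simp
  have nm_lower: "u j * l2_norm (a x j) \<le> nm x" if x: "x \<in> carrier E" for x j
  proof -
    have "(u j * l2_norm (a x j))\<^sup>2 \<le> (\<Sum>i<Suc j. (u i * l2_norm (a x i))\<^sup>2)" by (rule member_le_sum) auto
    also have "\<dots> \<le> Re (ip x x)"
      unfolding sums_unique[OF self_sums[OF x]]
      by (rule sum_le_suminf[OF sums_summable[OF self_sums[OF x]]]) auto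
    finally show ?thesis unfolding nm_def by (rule real_le_rsqrt)
  qed
  have nm_upper: "nm x \<le> sqrt (suminf c) * K x" if x: "x \<in> carrier E" for x
  proof -
    have "Re (ip x x) \<le> K x * K x * suminf c"
    proof (rule sums_le[OF _ self_sums[OF x] sums_mult[OF summable_sums[OF c_sum]]])
      fix j
      have "(u j * l2_norm (a x j))\<^sup>2 \<le> (K x * (1 / real (Suc j)))\<^sup>2"
        by (intro power_mono uaK x mult_nonneg_nonneg u0 l2_norm_nonneg al)
      then show "(u j * l2_norm (a x j))\<^sup>2 \<le> K x * K x * c j"
        by (simp add: c_def power2_eq_square field_simps)
    qed
    then have "nm x \<le> sqrt (K x * K x * suminf c)" unfolding nm_def by (rule real_sqrt_le_mono)
    then show ?thesis using K0[OF x] by (simp add: real_sqrt_mult mult.commute)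
  qed
  have nm0: "0 \<le> nm x" if "x \<in> carrier E" for x using self_nonneg[OF that] by (simp add: nm_def)
  have P0: "0 \<le> P q x" if "x \<in> carrier E" for q x
    unfolding P_def by (rule lstar_seminorm_nonneg[OF f_lstar[OF that] Wb W0])
  \<comment> \<open>As \<open>f x\<close> is normal, \<open>\<bar>(f x)* e\<^sub>j\<bar>\<^sub>0 = \<bar>f x e\<^sub>j\<bar>\<^sub>0\<close>; this and \<open>\<bar>b\<bar>\<^sub>q\<^sup>2 \<le> \<bar>b\<bar>\<^sub>0 \<bar>b\<bar>\<^sub>2\<^sub>q\<close> bound both
    halves of the \<open>q\<close>-th seminorm, the factor \<open>(j + 1)\<^sup>4\<close> in \<open>u\<close> making the sum over \<open>j\<close> converge.\<close>
  have dom: "(P q x)\<^sup>2 \<le> (suminf c)\<^sup>2 * nm x * P (2 * q) x" if x: "x \<in> carrier E" for q x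
  proof -
    define T where "T = sqrt (nm x * P (2 * q) x)"
    have T0: "0 \<le> T" using nm0[OF x] P0[OF x] by (simp add: T_def)
    have wW: "(\<lambda>i. complex_of_real (w j) * unit_seq j i) \<in> W" for j
      using w(1) by (auto simp: W_def unit_seq_def norm_mult)
    \<comment> \<open>\<open>b\<close> will be the image of the \<open>j\<close>-th unit vector
      under \<open>f x\<close> or under its adjoint.\<close>
    have key: "w j * s_norm q b \<le> T * c j"
      if b: "b \<in> s_space" "l2_norm b = l2_norm (a x j)" "w j * s_norm (2 * q) b \<le> P (2 * q) x" for b j
    proof -
      have ip_b: "(s_norm q b)\<^sup>2 \<le> l2_norm b * s_norm (2 * q) b"
        using psp_interpolation[of b s_exponent q] b(1) by (simp add: s_norm_eq s_space_eq psp_norm_0)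
      have wu: "w j * l2_norm b = (c j)\<^sup>2 * (u j * l2_norm (a x j))"
        by (simp add: u_def c_def b(2) field_simps power_mult_distrib flip: power_mult del: of_nat_Suc)
      have "(w j * s_norm q b)\<^sup>2 \<le> (w j * l2_norm b) * (w j * s_norm (2 * q) b)"
        using mult_left_mono[OF ip_b, of "(w j)\<^sup>2"] by (simp add: power2_eq_square algebra_simps)
      also have "\<dots> \<le> ((c j)\<^sup>2 * nm x) * P (2 * q) x"
      proof (rule mult_mono)
        show "w j * l2_norm b \<le> (c j)\<^sup>2 * nm x"
          unfolding wu by (intro mult_left_mono nm_lower x) auto
        show "0 \<le> (c j)\<^sup>2 * nm x" using nm0[OF x] by simp
        show "0 \<le> w j * s_norm (2 * q) b" using w(1) s_norm_nonneg[OF b(1)] by simp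
      qed (rule b(3))
      also have "\<dots> = (T * c j)\<^sup>2"
        using nm0[OF x] P0[OF x] by (simp add: T_def power_mult_distrib)
      finally show ?thesis by (rule power2_le_imp_le) (use T0 c_pos[of j] in auto)
    qed
    have "P q x \<le> T * suminf c"
      unfolding P_def
    proof (rule lstar_seminorm_least[OF W0])
      fix \<xi> assume \<xi>W: "\<xi> \<in> W"
      note \<xi> = s_boundedD[OF Wb \<xi>W]
      have \<xi>w: "cmod (\<xi> j) \<le> w j" for j using \<xi>W by (simp add: W_def)
      show "s_norm q (f x \<xi>) \<le> T * suminf c"
      proof (rule lstar_series_bound[OF f_lstar[OF x] \<xi> c_sum])
        fix j
        have "w j * s_norm (2 * q) (f x (unit_seq j)) \<le> P (2 * q) x"
          using lstar_seminorm_upper(1)[OF f_lstar[OF x] Wb wW[of j], of "2 * q"] w(1)[of j]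
          unfolding lstar_scale[OF f_lstar[OF x] unit_seq_s] s_norm_scale[OF lstar_apply[OF f_lstar[OF x] unit_seq_s]]
          by (simp add: P_def)
        then have "w j * s_norm q (f x (unit_seq j)) \<le> T * c j"
          using as[OF x, of j] by (intro key) (auto simp: a_def)
        moreover have "cmod (\<xi> j) * s_norm q (f x (unit_seq j)) \<le> w j * s_norm q (f x (unit_seq j))"
          using as[OF x, of j] by (intro mult_right_mono \<xi>w s_norm_nonneg) (simp add: a_def)
        ultimately show "cmod (\<xi> j) * s_norm q (f x (unit_seq j)) \<le> T * c j" by linarith
      qed (use T0 c_pos in \<open>auto simp: less_imp_le\<close>)
      have st: "star lstar (f x) \<in> lstar_carrier" by (rule lstar_star_closed(1)[OF f_lstar[OF x]])
      have "s_norm q (star lstar (f x) \<xi>) \<le> T * suminf c"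
      proof (rule lstar_series_bound[OF st \<xi> c_sum])
        fix j
        let ?b = "adjoint_op (f x) (unit_seq j)"
        have bs: "?b \<in> s_space" by (rule lstar_adjoint_apply[OF f_lstar[OF x] unit_seq_s])
        have "w j * s_norm (2 * q) ?b \<le> P (2 * q) x"
          using lstar_seminorm_upper(2)[OF f_lstar[OF x] Wb wW[of j], of "2 * q"] w(1)[of j]
          unfolding lstar_adjoint_scale[OF f_lstar[OF x] unit_seq_s] s_norm_scale[OF bs]
          by (simp add: P_def)
        then have "w j * s_norm q ?b \<le> T * c j"
          using bs unit_norm_adjoint[OF x unit_seq_s[of j]] by (intro key) (auto simp: a_def)
        moreover have "cmod (\<xi> j) * s_norm q ?b \<le> w j * s_norm q ?b"
          by (intro mult_right_mono \<xi>w s_norm_nonneg bs)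
        ultimately show "cmod (\<xi> j) * s_norm q (star lstar (f x) (unit_seq j)) \<le> T * c j" by simp
      qed (use T0 c_pos in \<open>auto simp: less_imp_le\<close>)
      then show "s_norm q (adjoint_op (f x) \<xi>) \<le> T * suminf c" using \<xi> by simp
    qed
    then have "(P q x)\<^sup>2 \<le> (T * suminf c)\<^sup>2" using P0[OF x] by (rule power_mono)
    also have "\<dots> = (suminf c)\<^sup>2 * nm x * P (2 * q) x"
      using nm0[OF x] P0[OF x] by (simp add: T_def power_mult_distrib)
    finally show ?thesis .
  qed
  \<comment> \<open>Some weights may be 0, so definiteness cannot be read off the summands.
    Domination makes all seminorms of \<open>x\<close> vanish together with \<open>nm x\<close>, and
    the space is Hausdorff.\<close>
  have separating: "x = \<zero>" if x: "x \<in> carrier E" and 0: "nm x = 0" for x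
  proof (rule ccontr)
    assume "x \<noteq> \<zero>"
    then obtain U U' where "openin (topol E) U" "openin (topol E) U'" "\<zero> \<in> U" "x \<in> U'" "disjnt U U'"
      using metrizable_imp_Hausdorff_space[OF metrizable, unfolded Hausdorff_space_def topspace_eq, rule_format, of \<zero> x]
        x zero_closed by blast
    then have U: "openin (topol E) U" "\<zero> \<in> U" "x \<notin> U" by (auto simp: disjnt_iff)
    then obtain q e where "e > 0" "{x \<in> carrier E. P q x < e} \<subseteq> U"
      using fundP unfolding fundamental_system_def by meson
    moreover have "P q x = 0" using dom[OF x, of q] 0 by simp
    ultimately show False using U(3) x by auto
  qed
  have sp: "scalar_product E ip"
    unfolding scalar_product_def
  proof (intro conjI ballI impI)
    fix x assume x: "x \<in> carrier E" "x \<noteq> \<zero>"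
    then have "nm x \<noteq> 0" using separating by blast
    then have "Re (ip x x) \<noteq> 0" by (auto simp: nm_def)
    then show "0 < Re (ip x x)" using self_nonneg[OF x(1)] by simp
  next
    fix x y assume "x \<in> carrier E" "y \<in> carrier E"
    then show "ip y x = cnj (ip x y)" by (rule conj)
  qed (rule lin)
  interpret I: inner_product_module E ip by unfold_locales (rule sp)
  have "dominating_norm E nm"
    unfolding dominating_norm_def
  proof (intro conjI exI[of _ P] allI)
    have "continuous_seminorm E nm"
    proof (rule E.continuous_seminormI[of _ "\<lambda>x. lstar_seminorm 0 W' (f x)" "sqrt (suminf c)"])
      show "seminorm_on E nm" using I.seminorm_on_nrm unfolding nm_def .
      show "(\<lambda>x. lstar_seminorm 0 W' (f x)) \<in> (\<lambda>q x. q (f x)) ` lstar_seminorms" using Wb' W0' by blast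
      show "nm x \<le> sqrt (suminf c) * lstar_seminorm 0 W' (f x)" if "x \<in> carrier E" for x
        using nm_upper[OF that] by (simp add: K_def)
    qed
    then show "continuous_norm E nm" unfolding continuous_norm_def using separating by blast
    show "fundamental_system E P" by (rule fundP)
    fix q
    have "0 < suminf c" by (rule suminf_pos[OF c_sum c_pos])
    then have "0 < (suminf c)\<^sup>2" by simp
    then show "\<exists>r. \<exists>C>0. \<forall>x\<in>carrier E. (P q x)\<^sup>2 \<le> C * nm x * P r x" using dom by blast
  qed
  \<comment> \<open>The invariance holds summand by summand, since \<open>f\<close> is
    multiplicative and \<open>f (star E x)\<close> acts as the adjoint of
    \<open>f x\<close>.\<close>
  moreover have "ip (x \<otimes> y) z = ip y (star E x \<otimes> z)"
    if x: "x \<in> carrier E" and y: "y \<in> carrier E" and z: "z \<in> carrier E" for x y z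
  proof -
    have "l2_inner (a (x \<otimes> y) j) (a z j) = l2_inner (a y j) (a (star E x \<otimes> z) j)" for j
    proof -
      have "a (x \<otimes> y) j = f x (a y j)" using f_mult[OF x y] by (simp add: a_def compose_def)
      moreover have "a (star E x \<otimes> z) j = adjoint_op (f x) (a z j)"
        using f_mult[OF star_closed[OF x] z] f_star[OF x] as[OF z, of j] by (simp add: a_def compose_def)
      ultimately show ?thesis using lstar_adjoint[OF f_lstar[OF x] as[OF y] as[OF z]] by simp
    qed
    then have "t (x \<otimes> y) z = t y (star E x \<otimes> z)" by (simp add: t_def fun_eq_iff)
    then show ?thesis by (simp add: ip_def)
  qed
  ultimately show ?thesis
    unfolding DN_algebra_def nm_def using sp by blast
qed

end


section \<open>Orthonormalisation in a power series space\<close>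

text \<open>Normalisation is built into the recursion. The result is triangular: the
  \<open>n\<close>-th vector is supported on the coordinates up to \<open>n\<close>, on which an
  increasing \<alpha> does not exceed \<open>\<alpha> n\<close>. As a rewrite rule the equation
  would unfold without end, hence its removal below.\<close>

fun gram_schmidt :: "(cseq \<Rightarrow> cseq \<Rightarrow> complex) \<Rightarrow> nat \<Rightarrow> cseq" where
  "gram_schmidt ip n =
     (let g = (\<lambda>k. unit_seq n k - (\<Sum>i<n. ip (unit_seq n) (gram_schmidt ip i) * gram_schmidt ip i k))
      in (\<lambda>k. complex_of_real (1 / sqrt (Re (ip g g))) * g k))"

declare gram_schmidt.simps [simp del]

locale dominated_psp = inner_product_module "power_series_space \<alpha>" ip
  for \<alpha> :: "nat \<Rightarrow> real" and ip :: "cseq \<Rightarrow> cseq \<Rightarrow> complex" +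
  fixes k :: nat
  assumes pos: "\<And>j. 0 \<le> \<alpha> j" and inc: "incseq \<alpha>"
    and summ: "summable (\<lambda>j. exp (- 2 * real k * \<alpha> j))"
    and cont: "\<exists>C p. 0 < C \<and> (\<forall>\<xi>\<in>psp_carrier \<alpha>. nrm \<xi> \<le> C * psp_norm \<alpha> p \<xi>)"
    and dom: "\<And>q. \<exists>C r. 0 < C \<and> (\<forall>\<xi>\<in>psp_carrier \<alpha>. (psp_norm \<alpha> q \<xi>)\<^sup>2 \<le> C * nrm \<xi> * psp_norm \<alpha> r \<xi>)"
begin

lemma add_left: "\<lbrakk>x \<in> psp_carrier \<alpha>; y \<in> psp_carrier \<alpha>; z \<in> psp_carrier \<alpha>\<rbrakk> \<Longrightarrow> ip (\<lambda>j. x j + y j) z = ip x z + ip y z"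
  and scale_left: "\<lbrakk>x \<in> psp_carrier \<alpha>; z \<in> psp_carrier \<alpha>\<rbrakk> \<Longrightarrow> ip (\<lambda>j. c * x j) z = c * ip x z"
  and scale_right: "\<lbrakk>x \<in> psp_carrier \<alpha>; z \<in> psp_carrier \<alpha>\<rbrakk> \<Longrightarrow> ip z (\<lambda>j. c * x j) = cnj c * ip z x"
  and sym: "\<lbrakk>x \<in> psp_carrier \<alpha>; y \<in> psp_carrier \<alpha>\<rbrakk> \<Longrightarrow> ip y x = cnj (ip x y)"
  and pos_def: "\<lbrakk>x \<in> psp_carrier \<alpha>; x \<noteq> (\<lambda>_. 0)\<rbrakk> \<Longrightarrow> 0 < Re (ip x x)"
  and self_real: "x \<in> psp_carrier \<alpha> \<Longrightarrow> ip x x = complex_of_real (Re (ip x x))"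
  and CS: "\<lbrakk>x \<in> psp_carrier \<alpha>; y \<in> psp_carrier \<alpha>\<rbrakk> \<Longrightarrow> cmod (ip x y) \<le> nrm x * nrm y"
  and nrm_nonneg: "x \<in> psp_carrier \<alpha> \<Longrightarrow> 0 \<le> nrm x"
  using ip_add_left[unfolded psp_sel] ip_smult_left[unfolded psp_sel] ip_smult_right[unfolded psp_sel]
    ip_cnj[unfolded psp_sel] ip_pos[unfolded psp_sel] ip_self_real[unfolded psp_sel]
    ip_Cauchy_Schwarz[unfolded psp_sel] seminorm_on_nonneg[OF seminorm_on_nrm, unfolded psp_sel]
  by blast+

lemma sum_left:
  assumes "finite I" "\<And>i. i \<in> I \<Longrightarrow> F i \<in> psp_carrier \<alpha>" "z \<in> psp_carrier \<alpha>"
  shows "(\<lambda>j. \<Sum>i\<in>I. c i * F i j) \<in> psp_carrier \<alpha> \<and> ip (\<lambda>j. \<Sum>i\<in>I. c i * F i j) z = (\<Sum>i\<in>I. c i * ip (F i) z)"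
  using assms
proof (induction I rule: finite_induct)
  case empty
  then show ?case using scale_left[of "\<lambda>_. 0" z 0] by simp
next
  case (insert x A)
  then have F: "F x \<in> psp_carrier \<alpha>" and S: "(\<lambda>j. \<Sum>i\<in>A. c i * F i j) \<in> psp_carrier \<alpha>"
    and e: "ip (\<lambda>j. \<Sum>i\<in>A. c i * F i j) z = (\<Sum>i\<in>A. c i * ip (F i) z)" and z: "z \<in> psp_carrier \<alpha>" by auto
  have cF: "(\<lambda>j. c x * F x j) \<in> psp_carrier \<alpha>" by (rule psp_scale(1)[OF F])
  show ?case
    using psp_add(1)[OF cF S] add_left[OF cF S z] scale_left[OF F z, of "c x"] e insert.hyps by simp
qed

abbreviation f :: "nat \<Rightarrow> cseq" where "f \<equiv> gram_schmidt ip"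

definition g :: "nat \<Rightarrow> cseq" where
  "g n = (\<lambda>k. unit_seq n k - (\<Sum>i<n. ip (unit_seq n) (f i) * f i k))"

lemma f_eq: "f n = (\<lambda>k. complex_of_real (1 / nrm (g n)) * g n k)"
  unfolding g_def by (subst gram_schmidt.simps) (simp add: Let_def)

lemma gram_schmidt_props:
  "f n \<in> psp_carrier \<alpha> \<and> g n \<in> psp_carrier \<alpha> \<and> 0 < nrm (g n) \<and> (\<forall>k>n. f n k = 0) \<and>
    ip (f n) (f n) = 1 \<and> (\<forall>i<n. ip (f n) (f i) = 0)"
proof (induction n rule: less_induct)
  case (less n)
  define c where "c i = ip (unit_seq n) (f i)" for i
  have fi: "f i \<in> psp_carrier \<alpha>" if "i \<in> {..<n}" for i using less.IH[of i] that by blast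
  have orth: "ip (f i) (f l) = (if i = l then 1 else 0)" if "i < n" "l < n" for i l
  proof -
    have "ip (f i) (f l) = 0" if "l < i" using less.IH[of i] \<open>i < n\<close> that by blast
    moreover have "ip (f i) (f l) = 0" if "i < l"
      using less.IH[of l] \<open>l < n\<close> that sym[OF fi fi, of l i] \<open>i < n\<close> by simp
    moreover have "ip (f i) (f i) = 1" using less.IH[of i] \<open>i < n\<close> by blast
    ultimately show ?thesis by (metis nat_neq_iff)
  qed
  define h where "h = (\<lambda>k. \<Sum>i<n. c i * f i k)"
  have h: "h \<in> psp_carrier \<alpha>" unfolding h_def using sum_left[of "{..<n}" f "\<lambda>_. 0" c] fi by simp
  have g_h: "g n = (\<lambda>k. unit_seq n k + (-1) * h k)" by (simp add: g_def h_def c_def)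
  have mh: "(\<lambda>k. (-1) * h k) \<in> psp_carrier \<alpha>" by (rule psp_scale(1)[OF h])
  have gc: "g n \<in> psp_carrier \<alpha>" unfolding g_h by (rule psp_add(1)[OF psp_unit mh])
  have hn: "h k = 0" if "k \<ge> n" for k
    unfolding h_def using less.IH that by (intro sum.neutral) auto
  have gk: "g n k = unit_seq n k" if "k \<ge> n" for k using hn[OF that] by (simp add: g_h)
  \<comment> \<open>The earlier vectors vanish at \<open>n\<close>, so orthogonalisation cannot
    annihilate the unit vector, and the norm divided by is positive.\<close>
  have "g n n = 1" using gk[of n] by simp
  then have "g n \<noteq> (\<lambda>_. 0)" by (metis zero_neq_one)
  then have gp: "0 < Re (ip (g n) (g n))" by (rule pos_def[OF gc])
  have fc: "f n \<in> psp_carrier \<alpha>" unfolding f_eq by (rule psp_scale(1)[OF gc])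
  define s where "s = complex_of_real (1 / nrm (g n))"
  have fs: "f n = (\<lambda>k. s * g n k)" unfolding s_def by (rule f_eq)
  have "ip (f n) (f n) = s * ip (g n) (f n)" using scale_left[OF gc fc, of s] unfolding fs[symmetric] .
  also have "ip (g n) (f n) = cnj s * ip (g n) (g n)" using scale_right[OF gc gc, of s] unfolding fs[symmetric] .
  also have "ip (g n) (g n) = complex_of_real (Re (ip (g n) (g n)))" by (rule self_real[OF gc])
  also have "s * (cnj s * complex_of_real (Re (ip (g n) (g n)))) =
      complex_of_real (1 / nrm (g n) * (1 / nrm (g n) * Re (ip (g n) (g n))))"
    by (simp only: s_def complex_cnj_complex_of_real of_real_mult)
  also have "1 / nrm (g n) * (1 / nrm (g n) * Re (ip (g n) (g n))) = 1" using gp by (simp add: field_simps)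
  finally have one: "ip (f n) (f n) = 1" by simp
  have zero: "ip (f n) (f l) = 0" if l: "l < n" for l
  proof -
    have fl: "f l \<in> psp_carrier \<alpha>" using fi l by simp
    have "ip h (f l) = (\<Sum>i<n. c i * ip (f i) (f l))"
      unfolding h_def using sum_left[of "{..<n}" f "f l" c] fi fl by simp
    also have "\<dots> = (\<Sum>i<n. if i = l then c i else 0)" by (intro sum.cong) (use orth l in auto)
    also have "\<dots> = c l" using l by simp
    finally have "ip (g n) (f l) = 0"
      unfolding g_h using add_left[OF psp_unit mh fl, of n] scale_left[OF h fl, of "-1"] by (simp add: c_def)
    then show ?thesis using scale_left[OF gc fl, of s] unfolding fs[symmetric] by simp
  qed
  have "f n k = 0" if "k > n" for k unfolding f_eq using gk[of k] that by simp
  then show ?case using fc gc gp one zero by simp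
qed

lemma f_psp: "f n \<in> psp_carrier \<alpha>" and f_support: "n < i \<Longrightarrow> f n i = 0"
  and f_self: "ip (f n) (f n) = 1"
  using gram_schmidt_props[of n] by blast+

lemma f_orthonormal: "ip (f i) (f l) = (if i = l then 1 else 0)"
proof -
  consider "l < i" | "i < l" | "i = l" by linarith
  then show ?thesis
  proof cases
    case 1 then show ?thesis using gram_schmidt_props[of i] by auto
  next
    case 2 then show ?thesis using gram_schmidt_props[of l] sym[OF f_psp[of l] f_psp[of i]] by auto
  next
    case 3 then show ?thesis using f_self by simp
  qed
qed

lemma nrm_f [simp]: "nrm (f n) = 1"
  by (simp add: f_self)

lemma unit_expansion: "unit_seq n j = nrm (g n) * f n j + (\<Sum>i<n. ip (unit_seq n) (f i) * f i j)"
proof -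
  have "nrm (g n) * f n j = g n j" using gram_schmidt_props[of n] by (subst f_eq) (simp add: divide_simps)
  then show ?thesis by (simp add: g_def)
qed

text \<open>For \<open>l < n\<close> nothing is claimed. The content is that a unit vector is
  orthogonal to all later \<open>f l\<close>, and that its coefficient at \<open>n\<close> is the
  norm divided out in the construction.\<close>

lemma ip_unit_f: "ip (unit_seq n) (f l) = (if l < n then ip (unit_seq n) (f l) else if l = n then nrm (g n) else 0)"
proof -
  define S where "S = (\<lambda>j. \<Sum>i<n. ip (unit_seq n) (f i) * f i j)"
  have S: "S \<in> psp_carrier \<alpha>" "ip S (f l) = (\<Sum>i<n. ip (unit_seq n) (f i) * ip (f i) (f l))"
    using sum_left[of "{..<n}" f "f l" "\<lambda>i. ip (unit_seq n) (f i)"] f_psp by (auto simp: S_def)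
  have cf: "(\<lambda>j. complex_of_real (nrm (g n)) * f n j) \<in> psp_carrier \<alpha>" by (rule psp_scale(1)[OF f_psp])
  have eq: "unit_seq n = (\<lambda>j. complex_of_real (nrm (g n)) * f n j + S j)"
    using unit_expansion[of n] by (simp add: S_def fun_eq_iff)
  have main: "ip (unit_seq n) (f l) = complex_of_real (nrm (g n)) * ip (f n) (f l) + ip S (f l)"
    by (subst eq) (simp add: add_left[OF cf S(1) f_psp] scale_left[OF f_psp f_psp])
  have "ip S (f l) = 0" if "n \<le> l" unfolding S(2) using that by (intro sum.neutral) (auto simp: f_orthonormal)
  then show ?thesis using main by (auto simp: f_orthonormal)
qed

lemma unit_expansion': "unit_seq n j = (\<Sum>i\<le>n. ip (unit_seq n) (f i) * f i j)"
proof -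
  have "ip (unit_seq n) (f n) = nrm (g n)" using ip_unit_f[of n n] by simp
  then show ?thesis unfolding lessThan_Suc_atMost[symmetric] using unit_expansion[of n j] by simp
qed

text \<open>Smooth vectors are well approximated by the span of the first \<open>n\<close> unit vectors, to which \<open>f n\<close>
  is orthogonal.\<close>

lemma jackson:
  obtains C p where "0 < C"
    "\<And>m n \<xi>. \<xi> \<in> psp_carrier \<alpha> \<Longrightarrow> cmod (ip \<xi> (f n)) \<le> C * psp_norm \<alpha> (p + m) \<xi> * exp (- real m * \<alpha> n)"
    "\<And>\<xi>. \<xi> \<in> psp_carrier \<alpha> \<Longrightarrow> nrm \<xi> \<le> C * psp_norm \<alpha> p \<xi>"
proof -
  obtain C p where C: "0 < C" "\<And>\<xi>. \<xi> \<in> psp_carrier \<alpha> \<Longrightarrow> nrm \<xi> \<le> C * psp_norm \<alpha> p \<xi>" using cont by blast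
  have "cmod (ip \<xi> (f n)) \<le> C * psp_norm \<alpha> (p + m) \<xi> * exp (- real m * \<alpha> n)" if \<xi>: "\<xi> \<in> psp_carrier \<alpha>" for m n \<xi>
  proof -
    note ts = tail_seq_psp[OF \<xi>, of n]
    have "ip (\<lambda>j. \<Sum>i<n. \<xi> i * unit_seq i j) (f n) = (\<Sum>i<n. \<xi> i * ip (unit_seq i) (f n))"
      using sum_left[of "{..<n}" unit_seq "f n" \<xi>] f_psp by simp
    also have "\<dots> = 0"
    proof (rule sum.neutral, intro ballI)
      fix i assume "i \<in> {..<n}"
      then show "\<xi> i * ip (unit_seq i) (f n) = 0" using ip_unit_f[of i n] by simp
    qed
    finally have "ip \<xi> (f n) = ip (tail_seq n \<xi>) (f n)"
      using add_left[OF head_seq_psp[of \<xi> n] ts f_psp[of n]] head_plus_tail[of \<xi> n] by simp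
    then have "cmod (ip \<xi> (f n)) \<le> nrm (tail_seq n \<xi>)" using CS[OF ts f_psp[of n]] by simp
    also have "\<dots> \<le> C * psp_norm \<alpha> p (tail_seq n \<xi>)" by (rule C(2)[OF ts])
    also have "\<dots> \<le> C * (exp (- real m * \<alpha> n) * psp_norm \<alpha> (p + m) \<xi>)"
      using C(1) by (intro mult_left_mono tail_seq_decay \<xi> inc) auto
    finally show ?thesis by (simp add: algebra_simps)
  qed
  then show thesis using that C by blast
qed

text \<open>On the span of the first \<open>n + 1\<close> unit vectors all norms are comparable at the cost of a factor
  \<open>exp (r * \<alpha> n)\<close>, which turns the domination inequality into a bound by \<open>nrm (f n) = 1\<close>.\<close>

lemma bernstein: "\<exists>C r. 0 < C \<and> (\<forall>n. psp_norm \<alpha> q (f n) \<le> C * exp (real r * \<alpha> n))"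
proof -
  obtain C r where C: "0 < C" "\<And>\<xi>. \<xi> \<in> psp_carrier \<alpha> \<Longrightarrow> (psp_norm \<alpha> q \<xi>)\<^sup>2 \<le> C * nrm \<xi> * psp_norm \<alpha> r \<xi>"
    using dom by blast
  have "psp_norm \<alpha> q (f n) \<le> C * exp (real r * \<alpha> n)" for n
  proof -
    have "psp_norm \<alpha> r (f n) \<le> exp (real r * \<alpha> n) * psp_norm \<alpha> q (f n)"
      unfolding psp_norm_eq
    proof (rule l2_comparison(2)[OF psp_carrierD[OF f_psp]])
      fix j
      show "cmod (weigh \<alpha> r (f n) j) \<le> exp (real r * \<alpha> n) * cmod (weigh \<alpha> q (f n) j)"
      proof (cases "n < j")
        case False
        then have "\<alpha> j \<le> \<alpha> n" using inc by (simp add: incseq_def)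
        then have "real r * \<alpha> j \<le> real r * \<alpha> n" by (simp add: mult_left_mono)
        moreover have "0 \<le> real q * \<alpha> j" using pos by simp
        ultimately have "exp (real r * \<alpha> j) \<le> exp (real r * \<alpha> n + real q * \<alpha> j)" by simp
        then have "exp (real r * \<alpha> j) * cmod (f n j) \<le> exp (real r * \<alpha> n + real q * \<alpha> j) * cmod (f n j)"
          by (rule mult_right_mono) simp
        then show ?thesis unfolding exp_add by (simp add: norm_weigh)
      qed (simp add: norm_weigh f_support)
    qed simp
    then have "C * psp_norm \<alpha> r (f n) \<le> C * (exp (real r * \<alpha> n) * psp_norm \<alpha> q (f n))"
      by (rule mult_left_mono) (use C(1) in simp)
    moreover have "(psp_norm \<alpha> q (f n))\<^sup>2 \<le> C * psp_norm \<alpha> r (f n)"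
      using C(2)[OF f_psp[of n]] by simp
    \<comment> \<open>The same norm occurs squared on the left and once on the right, so it can be
      cancelled once it is known to be positive.\<close>
    ultimately have "(psp_norm \<alpha> q (f n))\<^sup>2 \<le> (C * exp (real r * \<alpha> n)) * psp_norm \<alpha> q (f n)"
      unfolding mult.assoc by (rule order_trans[rotated])
    moreover have "0 < psp_norm \<alpha> q (f n)"
    proof -
      have "f n \<noteq> (\<lambda>_. 0)"
      proof
        assume 0: "f n = (\<lambda>_. 0)"
        have "ip (\<lambda>_. 0) (\<lambda>_. 0) = 0" using scale_left[OF psp_zero(1) psp_zero(1), of 0] by simp
        then show False using f_self[of n] unfolding 0 by simp
      qed
      then have "psp_norm \<alpha> q (f n) \<noteq> 0" using psp_eqI_norm[OF f_psp[of n], of q] by blast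
      then show ?thesis using psp_norm_nonneg[OF f_psp[of n], of q] by linarith
    qed
    ultimately show ?thesis unfolding power2_eq_square by (rule mult_right_le_imp_le)
  qed
  then show ?thesis using C(1) by blast
qed

text \<open>Analysis, and below it synthesis, for the orthonormal system \<open>f\<close>. Explicit
  estimates for both maps give a continuous inverse directly, in place of the open mapping
  theorem.\<close>

definition A :: "cseq \<Rightarrow> cseq" where "A \<xi> = (\<lambda>n. ip \<xi> (f n))"

definition B :: "cseq \<Rightarrow> cseq" where "B \<xi> = (\<lambda>i. \<Sum>n. \<xi> n * f n i)"

definition K :: real where "K = (\<Sum>j. exp (- 2 * real k * \<alpha> j))"

lemma K_nonneg: "0 \<le> K"
  unfolding K_def by (rule suminf_nonneg[OF summ]) simp

text \<open>The norm estimate uses \<open>jackson\<close> with \<open>m = q + k\<close>: decay of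
  order \<open>q\<close> pays for the weight and order \<open>k\<close> for summability.\<close>

lemma A_psp: "\<xi> \<in> psp_carrier \<alpha> \<Longrightarrow> A \<xi> \<in> psp_carrier \<alpha>"
  and A_bound: "\<exists>C r. 0 < C \<and> (\<forall>\<xi>\<in>psp_carrier \<alpha>. psp_norm \<alpha> q (A \<xi>) \<le> C * psp_norm \<alpha> r \<xi>)"
proof -
  obtain C p where C: "0 < C"
    "\<And>m n \<xi>. \<xi> \<in> psp_carrier \<alpha> \<Longrightarrow> cmod (ip \<xi> (f n)) \<le> C * psp_norm \<alpha> (p + m) \<xi> * exp (- real m * \<alpha> n)"
    "\<And>\<xi>. \<xi> \<in> psp_carrier \<alpha> \<Longrightarrow> nrm \<xi> \<le> C * psp_norm \<alpha> p \<xi>"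
    by (rule jackson) blast
  show "A \<xi> \<in> psp_carrier \<alpha>" if "\<xi> \<in> psp_carrier \<alpha>"
  proof (rule psp_of_coordinate_bounds[OF summ])
    fix q
    show "\<exists>D. \<forall>j. cmod (A \<xi> j) \<le> D * exp (- real q * \<alpha> j)"
      unfolding A_def by (intro exI[of _ "C * psp_norm \<alpha> (p + q) \<xi>"] allI C(2)[OF that])
  qed
  have "psp_norm \<alpha> q (A \<xi>) \<le> (C * (sqrt K + 1)) * psp_norm \<alpha> (p + (q + k)) \<xi>" if \<xi>: "\<xi> \<in> psp_carrier \<alpha>" for \<xi>
  proof -
    have nn: "0 \<le> C * psp_norm \<alpha> (p + (q + k)) \<xi>" using C(1) \<xi> by simp
    have "psp_norm \<alpha> q (A \<xi>) \<le> (C * psp_norm \<alpha> (p + (q + k)) \<xi>) * sqrt K"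
      unfolding K_def A_def by (rule psp_norm_of_coordinate_bounds[OF summ nn C(2)[OF \<xi>]])
    also have "\<dots> \<le> (C * psp_norm \<alpha> (p + (q + k)) \<xi>) * (sqrt K + 1)" using nn by (intro mult_left_mono) auto
    finally show ?thesis by (simp add: algebra_simps)
  qed
  moreover have "0 < C * (sqrt K + 1)" using C(1) K_nonneg by (simp add: add_nonneg_pos)
  ultimately show "\<exists>C r. 0 < C \<and> (\<forall>\<xi>\<in>psp_carrier \<alpha>. psp_norm \<alpha> q (A \<xi>) \<le> C * psp_norm \<alpha> r \<xi>)" by blast
qed

lemma A_add: "\<lbrakk>\<xi> \<in> psp_carrier \<alpha>; \<eta> \<in> psp_carrier \<alpha>\<rbrakk> \<Longrightarrow> A (\<lambda>j. \<xi> j + \<eta> j) = (\<lambda>j. A \<xi> j + A \<eta> j)"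
  and A_scale: "\<xi> \<in> psp_carrier \<alpha> \<Longrightarrow> A (\<lambda>j. c * \<xi> j) = (\<lambda>j. c * A \<xi> j)"
  by (simp_all add: A_def add_left scale_left f_psp)

text \<open>By \<open>bernstein\<close> the vectors \<open>f n\<close> grow at most like
  \<open>exp (r \<alpha> n)\<close>. The decay of the coefficients measured by the norm of index
  \<open>r + 2 * k\<close> compensates this and leaves the summable factor
  \<open>exp (- 2 k \<alpha> n)\<close>.\<close>

lemma B_term_bound:
  "\<exists>C m. 0 < C \<and> (\<forall>\<xi>\<in>psp_carrier \<alpha>. \<forall>n i. cmod (\<xi> n * f n i) \<le>
     C * psp_norm \<alpha> m \<xi> * exp (- real q * \<alpha> i) * exp (- 2 * real k * \<alpha> n))"
proof -
  obtain C r where C: "0 < C" "\<And>n. psp_norm \<alpha> q (f n) \<le> C * exp (real r * \<alpha> n)" using bernstein by blast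
  have "cmod (\<xi> n * f n i) \<le> C * psp_norm \<alpha> (r + 2 * k) \<xi> * exp (- real q * \<alpha> i) * exp (- 2 * real k * \<alpha> n)"
    if \<xi>: "\<xi> \<in> psp_carrier \<alpha>" for \<xi> n i
  proof -
    have "exp (real q * \<alpha> i) * cmod (f n i) \<le> C * exp (real r * \<alpha> n)"
      using psp_coordinate[OF f_psp[of n], of q i] C(2)[of n] by linarith
    then have 1: "cmod (f n i) \<le> C * exp (real r * \<alpha> n) * exp (- (real q * \<alpha> i))" by (rule exp_mult_le_imp)
    have 2: "cmod (\<xi> n) \<le> psp_norm \<alpha> (r + 2 * k) \<xi> * exp (- (real (r + 2 * k) * \<alpha> n))"
      by (rule exp_mult_le_imp[OF psp_coordinate[OF \<xi>]])
    have "cmod (\<xi> n * f n i) \<le> (psp_norm \<alpha> (r + 2 * k) \<xi> * exp (- (real (r + 2 * k) * \<alpha> n))) *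
        (C * exp (real r * \<alpha> n) * exp (- (real q * \<alpha> i)))"
      unfolding norm_mult by (intro mult_mono 1 2 mult_nonneg_nonneg psp_norm_nonneg \<xi>) auto
    also have "\<dots> = C * psp_norm \<alpha> (r + 2 * k) \<xi> * exp (- (real q * \<alpha> i)) *
        (exp (- (real (r + 2 * k) * \<alpha> n)) * exp (real r * \<alpha> n))" by (simp add: mult_ac)
    also have "exp (- (real (r + 2 * k) * \<alpha> n)) * exp (real r * \<alpha> n) = exp (- 2 * real k * \<alpha> n)"
      unfolding exp_add[symmetric] by (simp add: algebra_simps)
    finally show ?thesis by simp
  qed
  then show ?thesis using C(1) by blast
qed

lemma B_summable: "\<xi> \<in> psp_carrier \<alpha> \<Longrightarrow> summable (\<lambda>n. \<xi> n * f n i)"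
proof -
  assume \<xi>: "\<xi> \<in> psp_carrier \<alpha>"
  obtain C m where C: "\<And>n i. cmod (\<xi> n * f n i) \<le> C * psp_norm \<alpha> m \<xi> * exp (- real 0 * \<alpha> i) * exp (- 2 * real k * \<alpha> n)"
    using B_term_bound[of 0] \<xi> by blast
  show ?thesis
    by (rule summable_comparison_test'[OF summable_mult[OF summ, of "C * psp_norm \<alpha> m \<xi> * exp (- real 0 * \<alpha> i)"], of 0])
      (use C in blast)
qed

lemma B_coordinate_bound:
  "\<exists>C m. 0 < C \<and> (\<forall>\<xi>\<in>psp_carrier \<alpha>. \<forall>i. cmod (B \<xi> i) \<le> C * psp_norm \<alpha> m \<xi> * exp (- real q * \<alpha> i))"
proof -
  obtain C m where C: "0 < C" "\<And>\<xi> n i. \<xi> \<in> psp_carrier \<alpha> \<Longrightarrow> cmod (\<xi> n * f n i) \<le>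
     C * psp_norm \<alpha> m \<xi> * exp (- real q * \<alpha> i) * exp (- 2 * real k * \<alpha> n)"
    using B_term_bound[of q] by blast
  have "cmod (B \<xi> i) \<le> (C * (K + 1)) * psp_norm \<alpha> m \<xi> * exp (- real q * \<alpha> i)" if \<xi>: "\<xi> \<in> psp_carrier \<alpha>" for \<xi> i
  proof -
    define D where "D = C * psp_norm \<alpha> m \<xi> * exp (- real q * \<alpha> i)"
    have D: "0 \<le> D" using C(1) \<xi> by (simp add: D_def)
    have s: "summable (\<lambda>n. D * exp (- 2 * real k * \<alpha> n))" by (rule summable_mult[OF summ])
    have ns: "summable (\<lambda>n. cmod (\<xi> n * f n i))"
      by (rule summable_comparison_test'[OF s, of 0]) (use C(2)[OF \<xi>] in \<open>simp add: D_def\<close>)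
    have "cmod (B \<xi> i) \<le> (\<Sum>n. cmod (\<xi> n * f n i))" unfolding B_def by (rule summable_norm[OF ns])
    also have "\<dots> \<le> (\<Sum>n. D * exp (- 2 * real k * \<alpha> n))"
      by (rule suminf_le[OF _ ns s]) (use C(2)[OF \<xi>] in \<open>simp add: D_def\<close>)
    also have "\<dots> = D * K" unfolding K_def by (rule suminf_mult[OF summ])
    also have "\<dots> \<le> D * (K + 1)" using D by (intro mult_left_mono) auto
    finally show ?thesis by (simp add: D_def mult_ac)
  qed
  moreover have "0 < C * (K + 1)" using C(1) K_nonneg by simp
  ultimately show ?thesis by blast
qed

lemma B_psp: "\<xi> \<in> psp_carrier \<alpha> \<Longrightarrow> B \<xi> \<in> psp_carrier \<alpha>"
proof (rule psp_of_coordinate_bounds[OF summ])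
  fix q assume \<xi>: "\<xi> \<in> psp_carrier \<alpha>"
  obtain C m where "\<forall>\<xi>\<in>psp_carrier \<alpha>. \<forall>i. cmod (B \<xi> i) \<le> C * psp_norm \<alpha> m \<xi> * exp (- real q * \<alpha> i)"
    using B_coordinate_bound[of q] by blast
  then show "\<exists>D. \<forall>j. cmod (B \<xi> j) \<le> D * exp (- real q * \<alpha> j)"
    using \<xi> by (intro exI[of _ "C * psp_norm \<alpha> m \<xi>"]) blast
qed

lemma B_bound: "\<exists>C r. 0 < C \<and> (\<forall>\<xi>\<in>psp_carrier \<alpha>. psp_norm \<alpha> q (B \<xi>) \<le> C * psp_norm \<alpha> r \<xi>)"
proof -
  obtain C m where C: "0 < C"
    "\<And>\<xi> i. \<xi> \<in> psp_carrier \<alpha> \<Longrightarrow> cmod (B \<xi> i) \<le> C * psp_norm \<alpha> m \<xi> * exp (- real (q + k) * \<alpha> i)"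
    using B_coordinate_bound[of "q + k"] by blast
  have "psp_norm \<alpha> q (B \<xi>) \<le> (C * (sqrt K + 1)) * psp_norm \<alpha> m \<xi>" if \<xi>: "\<xi> \<in> psp_carrier \<alpha>" for \<xi>
  proof -
    have nn: "0 \<le> C * psp_norm \<alpha> m \<xi>" using C(1) \<xi> by simp
    have "psp_norm \<alpha> q (B \<xi>) \<le> (C * psp_norm \<alpha> m \<xi>) * sqrt K"
      unfolding K_def by (rule psp_norm_of_coordinate_bounds[OF summ nn C(2)[OF \<xi>]])
    also have "\<dots> \<le> (C * psp_norm \<alpha> m \<xi>) * (sqrt K + 1)" using nn by (intro mult_left_mono) auto
    finally show ?thesis by (simp add: algebra_simps)
  qed
  moreover have "0 < C * (sqrt K + 1)" using C(1) K_nonneg by (simp add: add_nonneg_pos)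
  ultimately show ?thesis by blast
qed

lemma B_add: "\<lbrakk>\<xi> \<in> psp_carrier \<alpha>; \<eta> \<in> psp_carrier \<alpha>\<rbrakk> \<Longrightarrow> B (\<lambda>j. \<xi> j + \<eta> j) = (\<lambda>j. B \<xi> j + B \<eta> j)"
  using suminf_add[OF B_summable B_summable, of \<xi> \<eta>] by (simp add: B_def fun_eq_iff algebra_simps)

lemma B_scale: "\<xi> \<in> psp_carrier \<alpha> \<Longrightarrow> B (\<lambda>j. c * \<xi> j) = (\<lambda>j. c * B \<xi> j)"
  using suminf_mult[OF B_summable, of \<xi> c] by (simp add: B_def fun_eq_iff algebra_simps)

lemma B_finite:
  assumes "finite I" "\<And>n. n \<notin> I \<Longrightarrow> \<xi> n = 0"
  shows "B \<xi> i = (\<Sum>n\<in>I. \<xi> n * f n i)"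
  unfolding B_def using assms by (intro suminf_finite) auto

lemma B_unit: "B (unit_seq j) = f j"
  using B_finite[of "{j}" "unit_seq j"] by auto

text \<open>By density it suffices to look at unit vectors, which \<open>B\<close> maps to the
  vectors \<open>f j\<close>; there the claim is orthonormality.\<close>

lemma A_B: assumes \<xi>: "\<xi> \<in> psp_carrier \<alpha>" shows "A (B \<xi>) = \<xi>"
proof
  fix n
  obtain C r where C: "0 < C" "\<And>\<xi>. \<xi> \<in> psp_carrier \<alpha> \<Longrightarrow> psp_norm \<alpha> 0 (A \<xi>) \<le> C * psp_norm \<alpha> r \<xi>"
    using A_bound[of 0] by blast
  obtain D t where D: "0 < D" "\<And>\<xi>. \<xi> \<in> psp_carrier \<alpha> \<Longrightarrow> psp_norm \<alpha> r (B \<xi>) \<le> D * psp_norm \<alpha> t \<xi>"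
    using B_bound[of r] by blast
  have "A (B \<xi>) n - \<xi> n = 0"
  proof (rule psp_functional_zero[where \<phi>="\<lambda>\<xi>. A (B \<xi>) n - \<xi> n" and \<alpha>=\<alpha> and q=t and C="C * D + 1"])
    fix \<eta> assume \<eta>: "\<eta> \<in> psp_carrier \<alpha>"
    have "cmod (A (B \<eta>) n) \<le> C * psp_norm \<alpha> r (B \<eta>)"
      using psp_coordinate[OF A_psp[OF B_psp[OF \<eta>]], of 0 n] C(2)[OF B_psp[OF \<eta>]] by simp
    also have "\<dots> \<le> C * (D * psp_norm \<alpha> t \<eta>)" using C(1) D(2)[OF \<eta>] by (intro mult_left_mono) auto
    finally have 1: "cmod (A (B \<eta>) n) \<le> C * D * psp_norm \<alpha> t \<eta>" by simp
    have "cmod (\<eta> n) \<le> psp_norm \<alpha> t \<eta>"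
      using psp_coordinate[OF \<eta>, of 0 n] psp_norm_mono[OF \<eta> pos, of 0 t] by simp
    then show "cmod (A (B \<eta>) n - \<eta> n) \<le> (C * D + 1) * psp_norm \<alpha> t \<eta>"
      using 1 norm_triangle_ineq4[of "A (B \<eta>) n" "\<eta> n"] by (simp add: algebra_simps)
  next
    fix j
    show "A (B (unit_seq j)) n - unit_seq j n = 0"
      unfolding B_unit A_def f_orthonormal by (cases "j = n") auto
  qed (use \<xi> in \<open>auto simp: B_add B_scale A_add A_scale B_psp algebra_simps\<close>)
  then show "A (B \<xi>) n = \<xi> n" by simp
qed

text \<open>The coefficients of the \<open>j\<close>-th unit vector vanish beyond index
  \<open>j\<close>, so the series of \<open>B\<close> becomes the finite Gram-Schmidt expansion; the
  rest is density.\<close>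

lemma B_A: assumes \<xi>: "\<xi> \<in> psp_carrier \<alpha>" shows "B (A \<xi>) = \<xi>"
proof
  fix n
  obtain C r where C: "0 < C" "\<And>\<xi>. \<xi> \<in> psp_carrier \<alpha> \<Longrightarrow> psp_norm \<alpha> 0 (B \<xi>) \<le> C * psp_norm \<alpha> r \<xi>"
    using B_bound[of 0] by blast
  obtain D t where D: "0 < D" "\<And>\<xi>. \<xi> \<in> psp_carrier \<alpha> \<Longrightarrow> psp_norm \<alpha> r (A \<xi>) \<le> D * psp_norm \<alpha> t \<xi>"
    using A_bound[of r] by blast
  have "B (A \<xi>) n - \<xi> n = 0"
  proof (rule psp_functional_zero[where \<phi>="\<lambda>\<xi>. B (A \<xi>) n - \<xi> n" and \<alpha>=\<alpha> and q=t and C="C * D + 1"])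
    fix \<eta> assume \<eta>: "\<eta> \<in> psp_carrier \<alpha>"
    have "cmod (B (A \<eta>) n) \<le> C * psp_norm \<alpha> r (A \<eta>)"
      using psp_coordinate[OF B_psp[OF A_psp[OF \<eta>]], of 0 n] C(2)[OF A_psp[OF \<eta>]] by simp
    also have "\<dots> \<le> C * (D * psp_norm \<alpha> t \<eta>)" using C(1) D(2)[OF \<eta>] by (intro mult_left_mono) auto
    finally have 1: "cmod (B (A \<eta>) n) \<le> C * D * psp_norm \<alpha> t \<eta>" by simp
    have "cmod (\<eta> n) \<le> psp_norm \<alpha> t \<eta>"
      using psp_coordinate[OF \<eta>, of 0 n] psp_norm_mono[OF \<eta> pos, of 0 t] by simp
    then show "cmod (B (A \<eta>) n - \<eta> n) \<le> (C * D + 1) * psp_norm \<alpha> t \<eta>"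
      using 1 norm_triangle_ineq4[of "B (A \<eta>) n" "\<eta> n"] by (simp add: algebra_simps)
  next
    fix j
    have "B (A (unit_seq j)) n = (\<Sum>i\<le>j. A (unit_seq j) i * f i n)"
    proof (rule B_finite)
      fix i assume "i \<notin> {..j}"
      then show "A (unit_seq j) i = 0" using ip_unit_f[of j i] by (simp add: A_def)
    qed simp
    then show "B (A (unit_seq j)) n - unit_seq j n = 0" using unit_expansion'[of j n] by (simp add: A_def)
  qed (use \<xi> in \<open>auto simp: B_add B_scale A_add A_scale A_psp algebra_simps\<close>)
  then show "B (A \<xi>) n = \<xi> n" by simp
qed

text \<open>Parseval's identity. Writing \<open>\<xi>\<close> as \<open>B\<close> of its
  coefficients turns both sides into continuous functionals of the coefficient sequence, which are
  compared on unit vectors.\<close>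

lemma A_isometry:
  assumes "\<xi> \<in> psp_carrier \<alpha>" "\<eta> \<in> psp_carrier \<alpha>"
  shows "l2_inner (A \<xi>) (A \<eta>) = ip \<xi> \<eta>"
proof -
  define \<xi>' \<eta>' where "\<xi>' = A \<xi>" and "\<eta>' = A \<eta>"
  have \<xi>': "\<xi>' \<in> psp_carrier \<alpha>" "B \<xi>' = \<xi>" and \<eta>': "\<eta>' \<in> psp_carrier \<alpha>" "B \<eta>' = \<eta>"
    using assms by (simp_all add: \<xi>'_def \<eta>'_def A_psp B_A)
  obtain C p where C: "0 < C" "\<And>\<xi>. \<xi> \<in> psp_carrier \<alpha> \<Longrightarrow> nrm \<xi> \<le> C * psp_norm \<alpha> p \<xi>" using cont by blast
  obtain D t where D: "0 < D" "\<And>\<xi>. \<xi> \<in> psp_carrier \<alpha> \<Longrightarrow> psp_norm \<alpha> p (B \<xi>) \<le> D * psp_norm \<alpha> t \<xi>"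
    using B_bound[of p] by blast
  have "l2_inner \<xi>' \<eta>' - ip (B \<xi>') \<eta> = 0"
  proof (rule psp_functional_zero[where \<phi>="\<lambda>\<zeta>. l2_inner \<zeta> \<eta>' - ip (B \<zeta>) \<eta>" and \<alpha>=\<alpha> and q=t and C="l2_norm \<eta>' + C * D * nrm \<eta>"])
    fix \<zeta> assume \<zeta>: "\<zeta> \<in> psp_carrier \<alpha>"
    have "cmod (l2_inner \<zeta> \<eta>') \<le> l2_norm \<zeta> * l2_norm \<eta>'" by (rule l2_Cauchy_Schwarz[OF psp_l2[OF \<zeta>] psp_l2[OF \<eta>'(1)]])
    also have "\<dots> \<le> psp_norm \<alpha> t \<zeta> * l2_norm \<eta>'"
      using psp_norm_mono[OF \<zeta> pos, of 0 t] by (intro mult_right_mono l2_norm_nonneg psp_l2[OF \<eta>'(1)]) (auto simp: psp_norm_0)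
    finally have 1: "cmod (l2_inner \<zeta> \<eta>') \<le> l2_norm \<eta>' * psp_norm \<alpha> t \<zeta>" by (simp add: mult.commute)
    have "nrm (B \<zeta>) \<le> C * psp_norm \<alpha> p (B \<zeta>)" by (rule C(2)[OF B_psp[OF \<zeta>]])
    also have "\<dots> \<le> C * (D * psp_norm \<alpha> t \<zeta>)" using C(1) D(2)[OF \<zeta>] by (intro mult_left_mono) auto
    finally have "nrm (B \<zeta>) * nrm \<eta> \<le> (C * (D * psp_norm \<alpha> t \<zeta>)) * nrm \<eta>"
      by (intro mult_right_mono nrm_nonneg assms)
    then have 2: "cmod (ip (B \<zeta>) \<eta>) \<le> C * D * nrm \<eta> * psp_norm \<alpha> t \<zeta>"
      using CS[OF B_psp[OF \<zeta>] assms(2)] by (simp add: mult_ac)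
    show "cmod (l2_inner \<zeta> \<eta>' - ip (B \<zeta>) \<eta>) \<le> (l2_norm \<eta>' + C * D * nrm \<eta>) * psp_norm \<alpha> t \<zeta>"
      using 1 2 norm_triangle_ineq4[of "l2_inner \<zeta> \<eta>'" "ip (B \<zeta>) \<eta>"] unfolding distrib_right by linarith
  next
    fix j
    show "l2_inner (unit_seq j) \<eta>' - ip (B (unit_seq j)) \<eta> = 0"
      using sym[OF assms(2) f_psp[of j]] by (simp add: B_unit l2_inner_unit_left \<eta>'_def A_def)
  qed (use \<xi>'(1) \<eta>'(1) assms in \<open>auto simp: B_add B_scale B_psp l2_inner_add_left l2_inner_scale_left psp_l2 add_left scale_left algebra_simps\<close>)
  then show ?thesis using \<xi>' by (simp add: \<xi>'_def \<eta>'_def)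
qed

end


section \<open>Representation of DN-algebras\<close>

text \<open>Extension by zero along an injection: an isometry of l2 whose adjoint is restriction to
  the subsequence \<open>h\<close>.\<close>

definition spread :: "(nat \<Rightarrow> nat) \<Rightarrow> cseq \<Rightarrow> cseq" where
  "spread h a = (\<lambda>i. if i \<in> range h then a (inv_into UNIV h i) else 0)"

context
  fixes h :: "nat \<Rightarrow> nat"
  assumes h: "strict_mono h"
begin

lemma spread_apply: "spread h a (h j) = a j"
  using strict_mono_imp_inj_on[OF h] by (simp add: spread_def)

lemma spread_outside: "i \<notin> range h \<Longrightarrow> spread h a i = 0"
  by (simp add: spread_def)

lemma spread_l2:
  assumes "a \<in> l2_space"
  shows "spread h a \<in> l2_space" "l2_norm (spread h a) = l2_norm a"
proof -
  have z: "(cmod (spread h a i))\<^sup>2 = 0" if "i \<notin> range h" for i using spread_outside[OF that] by simp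
  have e: "(\<lambda>j. (cmod (spread h a (h j)))\<^sup>2) = (\<lambda>j. (cmod (a j))\<^sup>2)" by (simp add: spread_apply)
  show "spread h a \<in> l2_space"
    using summable_mono_reindex[OF h, of "\<lambda>i. (cmod (spread h a i))\<^sup>2"] z assms
    unfolding l2_space_def e by simp
  show "l2_norm (spread h a) = l2_norm a"
    using suminf_mono_reindex[OF h, of "\<lambda>i. (cmod (spread h a i))\<^sup>2"] z
    unfolding l2_norm_def e by simp
qed

lemma l2_inner_spread: "l2_inner (spread h a) b = l2_inner a (\<lambda>j. b (h j))"
  using suminf_mono_reindex[OF h, of "\<lambda>i. spread h a i * cnj (b i)"] spread_outside
  by (simp add: l2_inner_def spread_apply)

lemma l2_subsequence:
  assumes "a \<in> l2_space"
  shows "(\<lambda>j. a (h j)) \<in> l2_space" "l2_norm (\<lambda>j. a (h j)) \<le> l2_norm a"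
proof -
  have b: "(\<Sum>j<n. (cmod (a (h j)))\<^sup>2) \<le> (l2_norm a)\<^sup>2" for n
  proof -
    have "(\<Sum>j<n. (cmod (a (h j)))\<^sup>2) = (\<Sum>i\<in>h ` {..<n}. (cmod (a i))\<^sup>2)"
      using strict_mono_imp_inj_on[OF h] by (subst sum.reindex) (auto intro: inj_on_subset)
    also have "\<dots> \<le> (\<Sum>i<h n. (cmod (a i))\<^sup>2)"
      by (rule sum_mono2) (auto dest: strict_monoD[OF h])
    also have "\<dots> \<le> (l2_norm a)\<^sup>2" by (rule l2_sum_le[OF assms])
    finally show ?thesis .
  qed
  show "(\<lambda>j. a (h j)) \<in> l2_space" "l2_norm (\<lambda>j. a (h j)) \<le> l2_norm a"
    by (rule l2_boundedI[OF b l2_norm_nonneg[OF assms]])+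
qed

end

text \<open>The dominating scalar product has been absorbed into \<open>\<Phi>\<close>: it is the l2
  product of the coordinates, and \<open>l2_adjoint\<close> is the invariance condition in this
  form.\<close>

locale l2_represented = unital_commutative_frechet_star_algebra E
  for E :: "('a, 'm) star_tvs_scheme" (structure) +
  fixes \<alpha> :: "nat \<Rightarrow> real" and \<Phi> :: "'a \<Rightarrow> cseq" and k :: nat
  assumes pos: "\<And>j. 0 \<le> \<alpha> j" and inc: "incseq \<alpha>"
    and summ: "summable (\<lambda>j. exp (- 2 * real k * \<alpha> j))"
    and iso: "tvs_isomorphism E (power_series_space \<alpha>) \<Phi>"
    and l2_adjoint: "\<lbrakk>x \<in> carrier E; y \<in> carrier E; z \<in> carrier E\<rbrakk> \<Longrightarrow>
       l2_inner (\<Phi> (x \<otimes> y)) (\<Phi> z) = l2_inner (\<Phi> y) (\<Phi> (star E x \<otimes> z))"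
begin

section \<open>The algebra operations as estimates in the power series space\<close>

lemma \<Phi>_psp: "x \<in> carrier E \<Longrightarrow> \<Phi> x \<in> psp_carrier \<alpha>"
  and \<Phi>_add: "\<lbrakk>x \<in> carrier E; y \<in> carrier E\<rbrakk> \<Longrightarrow> \<Phi> (x \<oplus> y) = (\<lambda>j. \<Phi> x j + \<Phi> y j)"
  and \<Phi>_smult: "x \<in> carrier E \<Longrightarrow> \<Phi> (c \<odot> x) = (\<lambda>j. c * \<Phi> x j)"
  using iso unfolding tvs_isomorphism_def clinear_map_def psp_sel by auto

lemma bij_\<Phi>: "bij_betw \<Phi> (carrier E) (psp_carrier \<alpha>)"
  using iso unfolding tvs_isomorphism_def psp_sel by simp

definition \<Psi> :: "cseq \<Rightarrow> 'a" where "\<Psi> = inv_into (carrier E) \<Phi>"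

lemma \<Psi>_carrier: "\<xi> \<in> psp_carrier \<alpha> \<Longrightarrow> \<Psi> \<xi> \<in> carrier E"
  using bij_betw_imp_surj_on[OF bij_\<Phi>] unfolding \<Psi>_def by (metis inv_into_into)

lemma \<Phi>_\<Psi>: "\<xi> \<in> psp_carrier \<alpha> \<Longrightarrow> \<Phi> (\<Psi> \<xi>) = \<xi>"
  unfolding \<Psi>_def by (rule bij_betw_inv_into_right[OF bij_\<Phi>])

lemma \<Psi>_\<Phi>: "x \<in> carrier E \<Longrightarrow> \<Psi> (\<Phi> x) = x"
  unfolding \<Psi>_def by (rule bij_betw_inv_into_left[OF bij_\<Phi>])

lemma \<Psi>_eqI: "x \<in> carrier E \<Longrightarrow> \<Phi> x = \<xi> \<Longrightarrow> \<Psi> \<xi> = x"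
  using \<Psi>_\<Phi> by blast

lemma \<Psi>_add: "\<lbrakk>\<xi> \<in> psp_carrier \<alpha>; \<eta> \<in> psp_carrier \<alpha>\<rbrakk> \<Longrightarrow> \<Psi> (\<lambda>j. \<xi> j + \<eta> j) = \<Psi> \<xi> \<oplus> \<Psi> \<eta>"
  by (rule \<Psi>_eqI) (simp_all add: \<Psi>_carrier \<Phi>_add \<Phi>_\<Psi>)

lemma \<Psi>_scale: "\<xi> \<in> psp_carrier \<alpha> \<Longrightarrow> \<Psi> (\<lambda>j. c * \<xi> j) = c \<odot> \<Psi> \<xi>"
  by (rule \<Psi>_eqI) (simp_all add: \<Psi>_carrier \<Phi>_smult \<Phi>_\<Psi>)

lemma seminormed_E: "seminormed_space E ((\<lambda>q x. q (\<Phi> x)) ` range (psp_norm \<alpha>))"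
  by (rule seminormed_space_via_psp[OF pos module_axioms topspace_eq iso])

sublocale E: seminormed_space E "(\<lambda>q x. q (\<Phi> x)) ` range (psp_norm \<alpha>)"
  by (rule seminormed_E)

text \<open>The scalar \<open>d\<close> may be the conjugate of \<open>c\<close>, so that the
  involution is covered together with the multiplications. Topological continuity becomes an
  estimate between norms of the power series space.\<close>

lemma seminorm_composed_bound:
  assumes F: "\<And>x. x \<in> carrier E \<Longrightarrow> F x \<in> carrier E"
    and "\<And>x y. x \<in> carrier E \<Longrightarrow> y \<in> carrier E \<Longrightarrow> F (x \<oplus> y) = F x \<oplus> F y"
    and "\<And>c x. x \<in> carrier E \<Longrightarrow> \<exists>d. cmod d = cmod c \<and> F (c \<odot> x) = d \<odot> F x"
    and cont: "continuous_map (topol E) (topol E) F"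
  shows "\<exists>C r. 0 < C \<and> (\<forall>x\<in>carrier E. psp_norm \<alpha> N (\<Phi> (F x)) \<le> C * psp_norm \<alpha> r (\<Phi> x))"
proof -
  have sem: "seminorm_on E (\<lambda>x. psp_norm \<alpha> N (\<Phi> (F x)))"
    unfolding seminorm_on_def
  proof (intro conjI ballI allI)
    fix c x assume x: "x \<in> carrier E"
    obtain d where "cmod d = cmod c" "F (c \<odot> x) = d \<odot> F x" using assms(3)[OF x] by blast
    then show "psp_norm \<alpha> N (\<Phi> (F (c \<odot> x))) = cmod c * psp_norm \<alpha> N (\<Phi> (F x))"
      using F[OF x] by (simp add: \<Phi>_smult psp_scale \<Phi>_psp)
  qed (auto simp: assms(2) F \<Phi>_add psp_add \<Phi>_psp)
  have "(\<lambda>x. psp_norm \<alpha> N (\<Phi> x)) \<in> (\<lambda>q x. q (\<Phi> x)) ` range (psp_norm \<alpha>)" by blast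
  then have "continuous_seminorm E (\<lambda>x. psp_norm \<alpha> N (\<Phi> x))"
    by (intro E.continuous_seminormI[OF E.seminorms, of _ _ 1]) auto
  then have "continuous_map (topol E) euclideanreal (\<lambda>x. psp_norm \<alpha> N (\<Phi> x))"
    by (simp add: continuous_seminorm_def)
  from continuous_map_compose[OF cont this]
  have "continuous_seminorm E (\<lambda>x. psp_norm \<alpha> N (\<Phi> (F x)))"
    using sem by (simp add: continuous_seminorm_def o_def)
  then obtain p C where p: "p \<in> (\<lambda>q x. q (\<Phi> x)) ` range (psp_norm \<alpha>)" "C > 0"
    "\<And>x. x \<in> carrier E \<Longrightarrow> psp_norm \<alpha> N (\<Phi> (F x)) \<le> C * p x"
    by (rule E.continuous_seminormD) blast
  then obtain r where "p = (\<lambda>x. psp_norm \<alpha> r (\<Phi> x))" by blast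
  then show ?thesis using p(2,3) by blast
qed

lemma star_bound: "\<exists>C r. 0 < C \<and> (\<forall>x\<in>carrier E. psp_norm \<alpha> N (\<Phi> (star E x)) \<le> C * psp_norm \<alpha> r (\<Phi> x))"
proof (rule seminorm_composed_bound)
  show "\<exists>d. cmod d = cmod c \<and> star E (c \<odot> x) = d \<odot> star E x" if "x \<in> carrier E" for c x
    using star_smult[OF that, of c] by (intro exI[of _ "cnj c"]) simp
qed (auto simp: star_closed star_add continuous_star)

lemma mult_left_bound:
  assumes a: "a \<in> carrier E"
  shows "\<exists>C r. 0 < C \<and> (\<forall>x\<in>carrier E. psp_norm \<alpha> N (\<Phi> (a \<otimes> x)) \<le> C * psp_norm \<alpha> r (\<Phi> x))"
proof (rule seminorm_composed_bound)
  show "\<exists>d. cmod d = cmod c \<and> a \<otimes> (c \<odot> x) = d \<odot> (a \<otimes> x)" if "x \<in> carrier E" for c x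
    using smult_mult_r[OF a that, of c] by blast
qed (auto simp: mult_closed a mult_r_distr continuous_mult_l)

lemma mult_right_bound:
  assumes a: "a \<in> carrier E"
  shows "\<exists>C r. 0 < C \<and> (\<forall>x\<in>carrier E. psp_norm \<alpha> N (\<Phi> (x \<otimes> a)) \<le> C * psp_norm \<alpha> r (\<Phi> x))"
proof (rule seminorm_composed_bound)
  show "\<exists>d. cmod d = cmod c \<and> (c \<odot> x) \<otimes> a = d \<odot> (x \<otimes> a)" if "x \<in> carrier E" for c x
    using smult_mult_l[OF that a, of c] by blast
qed (auto simp: mult_closed a mult_l_distr continuous_mult_r)

text \<open>Multiplication is only separately continuous. Continuity for fixed \<open>\<eta>\<close>
  is one hypothesis of uniform boundedness; continuity in the other factor, applied to the bounded
  set \<open>D\<close>, gives the pointwise bounds. The result is uniform over bounded sets.\<close>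

lemma mult_bound_uniform:
  assumes D: "D \<subseteq> psp_carrier \<alpha>" "\<And>q. \<exists>M. \<forall>\<eta>\<in>D. psp_norm \<alpha> q \<eta> \<le> M"
  shows "\<exists>C r. 0 < C \<and> (\<forall>\<eta>\<in>D. \<forall>x\<in>carrier E. psp_norm \<alpha> N (\<Phi> (x \<otimes> \<Psi> \<eta>)) \<le> C * psp_norm \<alpha> r (\<Phi> x))"
proof -
  have "\<exists>C r. 0 < C \<and> (\<forall>\<eta>\<in>D. \<forall>\<xi>\<in>psp_carrier \<alpha>. psp_norm \<alpha> N (\<Phi> (\<Psi> \<xi> \<otimes> \<Psi> \<eta>)) \<le> C * psp_norm \<alpha> r \<xi>)"
  proof (rule psp_uniform_boundedness[OF pos])
    fix \<eta> assume "\<eta> \<in> D"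
    then have y: "\<Psi> \<eta> \<in> carrier E" using D(1) \<Psi>_carrier by blast
    show "seminorm_on (power_series_space \<alpha>) (\<lambda>\<xi>. psp_norm \<alpha> N (\<Phi> (\<Psi> \<xi> \<otimes> \<Psi> \<eta>)))"
      unfolding seminorm_on_def psp_sel
      using y by (auto simp: \<Psi>_carrier \<Psi>_add \<Psi>_scale mult_closed mult_l_distr smult_mult_l \<Phi>_add \<Phi>_smult \<Phi>_psp psp_add psp_scale)
    obtain C r where "\<And>x. x \<in> carrier E \<Longrightarrow> psp_norm \<alpha> N (\<Phi> (x \<otimes> \<Psi> \<eta>)) \<le> C * psp_norm \<alpha> r (\<Phi> x)"
      using mult_right_bound[OF y, of N] by blast
    from this[OF \<Psi>_carrier] have "\<forall>\<xi>\<in>psp_carrier \<alpha>. psp_norm \<alpha> N (\<Phi> (\<Psi> \<xi> \<otimes> \<Psi> \<eta>)) \<le> C * psp_norm \<alpha> r \<xi>"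
      by (simp add: \<Phi>_\<Psi>)
    then show "\<exists>C r. \<forall>\<xi>\<in>psp_carrier \<alpha>. psp_norm \<alpha> N (\<Phi> (\<Psi> \<xi> \<otimes> \<Psi> \<eta>)) \<le> C * psp_norm \<alpha> r \<xi>" by blast
  next
    fix \<xi> assume "\<xi> \<in> psp_carrier \<alpha>"
    then have x: "\<Psi> \<xi> \<in> carrier E" by (rule \<Psi>_carrier)
    obtain C r where C: "0 < C" "\<And>y. y \<in> carrier E \<Longrightarrow> psp_norm \<alpha> N (\<Phi> (\<Psi> \<xi> \<otimes> y)) \<le> C * psp_norm \<alpha> r (\<Phi> y)"
      using mult_left_bound[OF x, of N] by blast
    obtain M where M: "\<And>\<eta>. \<eta> \<in> D \<Longrightarrow> psp_norm \<alpha> r \<eta> \<le> M" using D(2) by blast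
    have "psp_norm \<alpha> N (\<Phi> (\<Psi> \<xi> \<otimes> \<Psi> \<eta>)) \<le> C * M" if \<eta>: "\<eta> \<in> D" for \<eta>
    proof -
      have "\<eta> \<in> psp_carrier \<alpha>" using D(1) \<eta> by blast
      then have "psp_norm \<alpha> N (\<Phi> (\<Psi> \<xi> \<otimes> \<Psi> \<eta>)) \<le> C * psp_norm \<alpha> r \<eta>"
        using C(2)[OF \<Psi>_carrier[of \<eta>]] by (simp add: \<Phi>_\<Psi>)
      also have "\<dots> \<le> C * M" using M[OF \<eta>] C(1) by (intro mult_left_mono) auto
      finally show ?thesis .
    qed
    then show "\<exists>M. \<forall>\<eta>\<in>D. psp_norm \<alpha> N (\<Phi> (\<Psi> \<xi> \<otimes> \<Psi> \<eta>)) \<le> M" by blast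
  qed
  then obtain C r where C: "0 < C"
    "\<And>\<eta> \<xi>. \<eta> \<in> D \<Longrightarrow> \<xi> \<in> psp_carrier \<alpha> \<Longrightarrow> psp_norm \<alpha> N (\<Phi> (\<Psi> \<xi> \<otimes> \<Psi> \<eta>)) \<le> C * psp_norm \<alpha> r \<xi>"
    by blast
  have "psp_norm \<alpha> N (\<Phi> (x \<otimes> \<Psi> \<eta>)) \<le> C * psp_norm \<alpha> r (\<Phi> x)" if "\<eta> \<in> D" "x \<in> carrier E" for \<eta> x
    using C(2)[OF that(1) \<Phi>_psp[OF that(2)]] by (simp add: \<Psi>_\<Phi> that(2))
  then show ?thesis using C(1) by blast
qed

text \<open>Spreading the coordinates to the positions \<open>j + \<lfloor>exp \<alpha>\<^sub>j\<rfloor>\<close> identifies the power series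
  space with an orthogonal coordinate subspace of \<open>s\<close>.\<close>

definition position :: "nat \<Rightarrow> nat" where "position j = j + nat \<lfloor>exp (\<alpha> j)\<rfloor>"

text \<open>The summand \<open>j\<close> in \<open>position\<close> gives strictness where the
  rounded exponentials repeat.\<close>

lemma strict_mono_position: "strict_mono position"
proof (rule strict_monoI)
  fix i j :: nat assume "i < j"
  then have "\<alpha> i \<le> \<alpha> j" using inc by (simp add: incseq_def)
  then have "nat \<lfloor>exp (\<alpha> i)\<rfloor> \<le> nat \<lfloor>exp (\<alpha> j)\<rfloor>" by (intro nat_mono floor_mono) simp
  then show "position i < position j" using \<open>i < j\<close> by (simp add: position_def)
qed

lemma exp_le_position: "exp (\<alpha> j) \<le> real (Suc (position j))"
proof -
  have "exp (\<alpha> j) \<le> real_of_int \<lfloor>exp (\<alpha> j)\<rfloor> + 1" by linarith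
  also have "\<dots> \<le> real (Suc (position j))" by (simp add: position_def)
  finally show ?thesis .
qed

text \<open>The first \<open>j + 1\<close> terms of the convergent series are each at least the last
  of them, which bounds \<open>j + 1\<close> by a multiple of \<open>exp (2 k \<alpha> j)\<close>.
  The exponent \<open>2 * k + 1\<close> also covers the part \<open>exp (\<alpha> j)\<close> of the
  position.\<close>

lemma position_le: "\<exists>c>0. \<forall>j. real (Suc (position j)) \<le> c * exp (real (2 * k + 1) * \<alpha> j)"
proof -
  define K where "K = (\<Sum>j. exp (- 2 * real k * \<alpha> j))"
  have K0: "0 \<le> K" unfolding K_def by (rule suminf_nonneg[OF summ]) simp
  have "real (Suc (position j)) \<le> (K + 1) * exp (real (2 * k + 1) * \<alpha> j)" for j
  proof -
    have "real (Suc j) * exp (- 2 * real k * \<alpha> j) = (\<Sum>i<Suc j. exp (- 2 * real k * \<alpha> j))" by simp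
    also have "\<dots> \<le> (\<Sum>i<Suc j. exp (- 2 * real k * \<alpha> i))"
    proof (rule sum_mono)
      fix i assume "i \<in> {..<Suc j}"
      then have "\<alpha> i \<le> \<alpha> j" using inc by (simp add: incseq_def)
      then show "exp (- 2 * real k * \<alpha> j) \<le> exp (- 2 * real k * \<alpha> i)" by (simp add: mult_left_mono)
    qed
    also have "\<dots> \<le> K" unfolding K_def by (rule sum_le_suminf[OF summ]) auto
    finally have "exp (- 2 * real k * \<alpha> j) * real (Suc j) \<le> K" by (simp only: mult.commute)
    from exp_mult_le_imp[OF this] have j: "real (Suc j) \<le> K * exp (2 * real k * \<alpha> j)" by simp
    have "2 * real k * \<alpha> j \<le> real (2 * k + 1) * \<alpha> j" "\<alpha> j \<le> real (2 * k + 1) * \<alpha> j"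
      using pos[of j] by (simp_all add: algebra_simps)
    then have e: "exp (2 * real k * \<alpha> j) \<le> exp (real (2 * k + 1) * \<alpha> j)" "exp (\<alpha> j) \<le> exp (real (2 * k + 1) * \<alpha> j)"
      by simp_all
    have "real_of_int \<lfloor>exp (\<alpha> j)\<rfloor> \<le> exp (\<alpha> j)" by (rule of_int_floor_le)
    moreover have "real (Suc (position j)) = real (Suc j) + real_of_int \<lfloor>exp (\<alpha> j)\<rfloor>"
      by (simp add: position_def)
    ultimately have "real (Suc (position j)) \<le> K * exp (2 * real k * \<alpha> j) + exp (\<alpha> j)"
      using j by linarith
    also have "\<dots> \<le> K * exp (real (2 * k + 1) * \<alpha> j) + exp (real (2 * k + 1) * \<alpha> j)"
      using e K0 by (intro add_mono mult_left_mono) auto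
    finally show ?thesis by (simp add: algebra_simps)
  qed
  moreover have "0 < K + 1" using K0 by simp
  ultimately show ?thesis by blast
qed

text \<open>\<open>\<iota>\<close> and the restriction \<open>\<rho>\<close> below are adjoint for
  the l2 product, and \<open>\<rho>\<close> inverts \<open>\<iota>\<close> from the left; hence
  \<open>\<iota> (\<rho> \<eta>)\<close> is the orthogonal projection onto the coordinate
  subspace.\<close>

definition \<iota> :: "cseq \<Rightarrow> cseq" where "\<iota> = spread position"

definition \<rho> :: "cseq \<Rightarrow> cseq" where "\<rho> \<eta> = (\<lambda>j. \<eta> (position j))"

lemma \<rho>_\<iota>: "\<rho> (\<iota> \<xi>) = \<xi>"
  by (simp add: \<rho>_def \<iota>_def spread_apply[OF strict_mono_position])

lemma \<iota>_add: "\<iota> (\<lambda>j. \<xi> j + \<eta> j) = (\<lambda>j. \<iota> \<xi> j + \<iota> \<eta> j)"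
  and \<iota>_scale: "\<iota> (\<lambda>j. c * \<xi> j) = (\<lambda>j. c * \<iota> \<xi> j)"
  by (auto simp: \<iota>_def spread_def)

lemma \<rho>_add: "\<rho> (\<lambda>j. \<xi> j + \<eta> j) = (\<lambda>j. \<rho> \<xi> j + \<rho> \<eta> j)"
  and \<rho>_scale: "\<rho> (\<lambda>j. c * \<xi> j) = (\<lambda>j. c * \<rho> \<xi> j)"
  by (auto simp: \<rho>_def)

lemma l2_inner_\<iota>: "l2_inner (\<iota> \<xi>) \<eta> = l2_inner \<xi> (\<rho> \<eta>)"
  unfolding \<iota>_def \<rho>_def by (rule l2_inner_spread[OF strict_mono_position])

lemma \<rho>_s: "\<eta> \<in> s_space \<Longrightarrow> \<rho> \<eta> \<in> psp_carrier \<alpha>"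
  and \<rho>_bound: "\<eta> \<in> s_space \<Longrightarrow> psp_norm \<alpha> q (\<rho> \<eta>) \<le> s_norm q \<eta>"
proof -
  assume \<eta>: "\<eta> \<in> s_space"
  have w: "weigh s_exponent q \<eta> \<in> l2_space" for q using \<eta> by (simp add: s_space_eq psp_carrierD)
  have c: "cmod (weigh \<alpha> q (\<rho> \<eta>) j) \<le> 1 * cmod (weigh s_exponent q \<eta> (position j))" for q j
  proof -
    have "exp (real q * \<alpha> j) \<le> exp (real q * s_exponent (position j))"
      unfolding exp_s_exponent exp_of_nat_mult[of q "\<alpha> j"] by (rule power_mono[OF exp_le_position]) simp
    then show ?thesis unfolding norm_weigh \<rho>_def mult_1 by (rule mult_right_mono) simp
  qed
  note sub = l2_subsequence[OF strict_mono_position w]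
  show "\<rho> \<eta> \<in> psp_carrier \<alpha>" unfolding psp_carrier_iff
    using l2_comparison(1)[OF sub(1) c] by simp
  have "l2_norm (weigh \<alpha> q (\<rho> \<eta>)) \<le> 1 * l2_norm (\<lambda>j. weigh s_exponent q \<eta> (position j))"
    by (rule l2_comparison(2)[OF sub(1) c]) simp
  then show "psp_norm \<alpha> q (\<rho> \<eta>) \<le> s_norm q \<eta>" using sub(2)[of q] by (simp add: psp_norm_eq s_norm_eq)
qed

text \<open>By \<open>position_le\<close> the weights of \<open>s\<close> are bounded by powers of
  the weights of the power series space, which multiplies the index by
  \<open>2 * k + 1\<close>.\<close>

lemma \<iota>_psp: "\<xi> \<in> psp_carrier \<alpha> \<Longrightarrow> \<iota> \<xi> \<in> s_space"
  and \<iota>_bound: "\<exists>C r. 0 < C \<and> (\<forall>\<xi>\<in>psp_carrier \<alpha>. s_norm N (\<iota> \<xi>) \<le> C * psp_norm \<alpha> r \<xi>)"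
proof -
  obtain c where c: "c > 0" "\<And>j. real (Suc (position j)) \<le> c * exp (real (2 * k + 1) * \<alpha> j)"
    using position_le by blast
  have w: "weigh s_exponent N (\<iota> \<xi>) \<in> l2_space \<and>
      l2_norm (weigh s_exponent N (\<iota> \<xi>)) \<le> c ^ N * l2_norm (weigh \<alpha> (N * (2 * k + 1)) \<xi>)"
    if \<xi>: "\<xi> \<in> psp_carrier \<alpha>" for \<xi> N
  proof -
    define b where "b = (\<lambda>j. complex_of_real (exp (real N * s_exponent (position j))) * \<xi> j)"
    have e: "weigh s_exponent N (\<iota> \<xi>) = \<iota> b"
    proof
      fix i
      show "weigh s_exponent N (\<iota> \<xi>) i = \<iota> b i"
      proof (cases "i \<in> range position")
        case True
        then obtain j where "i = position j" by blast
        then show ?thesis by (simp add: weigh_def \<iota>_def b_def spread_apply[OF strict_mono_position])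
      qed (simp add: weigh_def \<iota>_def spread_def)
    qed
    have "cmod (b j) \<le> c ^ N * cmod (weigh \<alpha> (N * (2 * k + 1)) \<xi> j)" for j
    proof -
      have "exp (real N * s_exponent (position j)) \<le> (c * exp (real (2 * k + 1) * \<alpha> j)) ^ N"
        unfolding exp_s_exponent by (rule power_mono[OF c(2)]) simp
      also have "\<dots> = c ^ N * exp (real (N * (2 * k + 1)) * \<alpha> j)"
        unfolding power_mult_distrib exp_of_nat_mult[symmetric] of_nat_mult by (simp only: mult.assoc)
      finally have "exp (real N * s_exponent (position j)) * cmod (\<xi> j) \<le>
          (c ^ N * exp (real (N * (2 * k + 1)) * \<alpha> j)) * cmod (\<xi> j)" by (rule mult_right_mono) simp
      then show ?thesis unfolding norm_weigh b_def norm_mult mult.assoc by simp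
    qed
    from l2_comparison[OF psp_carrierD[OF \<xi>] this] c(1)
    have "b \<in> l2_space" "l2_norm b \<le> c ^ N * l2_norm (weigh \<alpha> (N * (2 * k + 1)) \<xi>)" by auto
    then show ?thesis
      unfolding e using spread_l2[OF strict_mono_position, of b, folded \<iota>_def] by simp
  qed
  show "\<iota> \<xi> \<in> s_space" if "\<xi> \<in> psp_carrier \<alpha>"
    using w[OF that] unfolding s_space_eq psp_carrier_iff by blast
  show "\<exists>C r. 0 < C \<and> (\<forall>\<xi>\<in>psp_carrier \<alpha>. s_norm N (\<iota> \<xi>) \<le> C * psp_norm \<alpha> r \<xi>)"
    using w c(1) by (intro exI[of _ "c ^ N"] exI[of _ "N * (2 * k + 1)"]) (simp add: s_norm_eq psp_norm_eq)
qed

section \<open>The representation on \<open>s\<close> and the projection onto its image\<close>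

definition T :: "'a \<Rightarrow> cseq \<Rightarrow> cseq" where
  "T x = (\<lambda>\<eta>\<in>s_space. \<iota> (\<Phi> (x \<otimes> \<Psi> (\<rho> \<eta>))))"

text \<open>Evaluation at the vector that represents the unit. It makes sense on all of
  \<open>lstar\<close>, not only on the image of \<open>T\<close>, and extends the inverse of
  \<open>T\<close> continuously; this makes the image complemented.\<close>

definition R :: "(cseq \<Rightarrow> cseq) \<Rightarrow> 'a" where
  "R X = \<Psi> (\<rho> (X (\<iota> (\<Phi> \<one>))))"

lemma T_apply: "\<eta> \<in> s_space \<Longrightarrow> T x \<eta> = \<iota> (\<Phi> (x \<otimes> \<Psi> (\<rho> \<eta>)))"
  by (simp add: T_def)

lemma T_s: "x \<in> carrier E \<Longrightarrow> \<eta> \<in> s_space \<Longrightarrow> T x \<eta> \<in> s_space"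
  by (simp add: T_apply \<iota>_psp \<Phi>_psp mult_closed \<Psi>_carrier \<rho>_s)

text \<open>The adjoint is moved in three stages: from \<open>\<iota>\<close> to
  \<open>\<rho>\<close>, then across the product by invariance, then from \<open>\<rho>\<close> back
  to \<open>\<iota>\<close> by conjugate symmetry.\<close>

lemma T_lstar:
  assumes x: "x \<in> carrier E"
  shows "T x \<in> lstar_carrier" "\<And>\<eta>. \<eta> \<in> s_space \<Longrightarrow> adjoint_op (T x) \<eta> = T (star E x) \<eta>"
proof -
  have a: "T x \<in> s_space \<rightarrow>\<^sub>E s_space" using T_s[OF x] by (auto simp: T_def)
  have b: "T (star E x) \<eta> \<in> s_space" if "\<eta> \<in> s_space" for \<eta> by (rule T_s[OF star_closed[OF x] that])
  have c: "l2_inner (T x \<xi>) \<eta> = l2_inner \<xi> (T (star E x) \<eta>)" if \<xi>: "\<xi> \<in> s_space" and \<eta>: "\<eta> \<in> s_space" for \<xi> \<eta>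
  proof -
    note r\<xi> = \<rho>_s[OF \<xi>] and r\<eta> = \<rho>_s[OF \<eta>]
    let ?m = "\<Phi> (star E x \<otimes> \<Psi> (\<rho> \<eta>))"
    have m: "?m \<in> psp_carrier \<alpha>" by (simp add: \<Phi>_psp mult_closed \<Psi>_carrier r\<eta> star_closed x)
    have "l2_inner (T x \<xi>) \<eta> = l2_inner (\<Phi> (x \<otimes> \<Psi> (\<rho> \<xi>))) (\<rho> \<eta>)" by (simp add: T_apply[OF \<xi>] l2_inner_\<iota>)
    also have "\<dots> = l2_inner (\<rho> \<xi>) ?m"
      using l2_adjoint[OF x \<Psi>_carrier[OF r\<xi>] \<Psi>_carrier[OF r\<eta>]] by (simp add: \<Phi>_\<Psi> r\<xi> r\<eta>)
    also have "\<dots> = cnj (l2_inner ?m (\<rho> \<xi>))" by (rule l2_inner_cnj[OF psp_l2[OF m] psp_l2[OF r\<xi>]])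
    also have "l2_inner ?m (\<rho> \<xi>) = l2_inner (\<iota> ?m) \<xi>" by (simp add: l2_inner_\<iota>)
    also have "cnj (l2_inner (\<iota> ?m) \<xi>) = l2_inner \<xi> (\<iota> ?m)"
      by (rule l2_inner_cnj[OF s_l2[OF \<iota>_psp[OF m]] s_l2[OF \<xi>], symmetric])
    finally show ?thesis by (simp add: T_apply[OF \<eta>])
  qed
  show "T x \<in> lstar_carrier" by (rule lstarI(1)[OF a b c])
  show "\<And>\<eta>. \<eta> \<in> s_space \<Longrightarrow> adjoint_op (T x) \<eta> = T (star E x) \<eta>" by (rule lstarI(2)[OF a b c])
qed

lemma T_add: "\<lbrakk>x \<in> carrier E; y \<in> carrier E\<rbrakk> \<Longrightarrow> T (x \<oplus> y) = T x \<oplus>\<^bsub>lstar\<^esub> T y"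
  by (auto simp: T_def fun_eq_iff \<Psi>_carrier \<rho>_s mult_l_distr \<Phi>_add mult_closed \<iota>_add)

lemma T_smult: "x \<in> carrier E \<Longrightarrow> T (c \<odot> x) = c \<odot>\<^bsub>lstar\<^esub> T x"
  by (auto simp: T_def fun_eq_iff \<Psi>_carrier \<rho>_s smult_mult_l \<Phi>_smult mult_closed \<iota>_scale)

lemma T_mult: "\<lbrakk>x \<in> carrier E; y \<in> carrier E\<rbrakk> \<Longrightarrow> T (x \<otimes> y) = T x \<otimes>\<^bsub>lstar\<^esub> T y"
proof (rule ext)
  fix \<eta> assume x: "x \<in> carrier E" and y: "y \<in> carrier E"
  show "T (x \<otimes> y) \<eta> = (T x \<otimes>\<^bsub>lstar\<^esub> T y) \<eta>"
  proof (cases "\<eta> \<in> s_space")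
    case True
    have z: "\<Psi> (\<rho> \<eta>) \<in> carrier E" by (rule \<Psi>_carrier[OF \<rho>_s[OF True]])
    have "T x (T y \<eta>) = \<iota> (\<Phi> (x \<otimes> \<Psi> (\<rho> (T y \<eta>))))" by (rule T_apply[OF T_s[OF y True]])
    also have "\<Psi> (\<rho> (T y \<eta>)) = y \<otimes> \<Psi> (\<rho> \<eta>)"
      by (simp add: T_apply[OF True] \<rho>_\<iota> \<Psi>_\<Phi> mult_closed y z)
    finally show ?thesis using True by (simp add: compose_def T_apply[OF True] mult_assoc x y z)
  qed (simp add: T_def compose_def)
qed

lemma T_star: "x \<in> carrier E \<Longrightarrow> T (star E x) = star lstar (T x)"
  using T_lstar(2)[of x] by (auto simp: fun_eq_iff T_def)

lemma T_zero: "T \<zero> = \<zero>\<^bsub>lstar\<^esub>"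
  using T_smult[of \<zero> 0] smult_l_null[of \<zero>] by simp

lemma R_carrier: "X \<in> lstar_carrier \<Longrightarrow> R X \<in> carrier E"
  by (simp add: R_def \<Psi>_carrier \<rho>_s lstar_apply \<iota>_psp \<Phi>_psp one_closed)

lemma R_T:
  assumes x: "x \<in> carrier E" shows "R (T x) = x"
proof -
  have "x \<otimes> \<one> = x" using mult_commute[OF x one_closed] one_mult[OF x] by simp
  then show ?thesis
    by (simp add: R_def T_apply \<iota>_psp \<Phi>_psp one_closed \<rho>_\<iota> \<Psi>_\<Phi> x)
qed

lemma clinear_R: "clinear_map lstar E R"
proof -
  have u: "\<iota> (\<Phi> \<one>) \<in> s_space" by (simp add: \<iota>_psp \<Phi>_psp one_closed)
  show ?thesis
    unfolding clinear_map_def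
    using u by (auto simp: R_carrier) (simp_all add: R_def \<rho>_add \<rho>_scale \<Psi>_add \<Psi>_scale \<rho>_s lstar_apply)
qed

lemma clinear_T: "clinear_map E lstar T"
  unfolding clinear_map_def using T_lstar(1) T_add T_smult by simp

text \<open>The three constants belong to the embedding into \<open>s\<close>, to multiplication by
  a bounded set, and to the involution. The last one enters because the adjoint half of the seminorm
  is the operator half for \<open>star E x\<close>.\<close>

lemma T_bound:
  assumes B: "s_bounded B" "B \<noteq> {}"
  shows "\<exists>C r. \<forall>x\<in>carrier E. lstar_seminorm N B (T x) \<le> C * psp_norm \<alpha> r (\<Phi> x)"
proof -
  have D: "\<rho> ` B \<subseteq> psp_carrier \<alpha>" using \<rho>_s s_boundedD[OF B(1)] by blast
  have D2: "\<exists>M. \<forall>\<eta>\<in>\<rho> ` B. psp_norm \<alpha> q \<eta> \<le> M" for q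
  proof -
    obtain M where M: "\<And>\<xi>. \<xi> \<in> B \<Longrightarrow> s_norm q \<xi> \<le> M"
      using B(1) unfolding s_bounded_def bdd_above_def by blast
    have "psp_norm \<alpha> q (\<rho> \<xi>) \<le> M" if "\<xi> \<in> B" for \<xi>
      using \<rho>_bound[OF s_boundedD[OF B(1) that], of q] M[OF that] by linarith
    then show ?thesis by blast
  qed
  obtain C1 r1 where 1: "0 < C1" "\<And>\<xi>. \<xi> \<in> psp_carrier \<alpha> \<Longrightarrow> s_norm N (\<iota> \<xi>) \<le> C1 * psp_norm \<alpha> r1 \<xi>"
    using \<iota>_bound[of N] by blast
  obtain C2 r2 where 2: "0 < C2" "\<And>\<eta> x. \<eta> \<in> \<rho> ` B \<Longrightarrow> x \<in> carrier E \<Longrightarrow> psp_norm \<alpha> r1 (\<Phi> (x \<otimes> \<Psi> \<eta>)) \<le> C2 * psp_norm \<alpha> r2 (\<Phi> x)"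
    using mult_bound_uniform[OF D D2, of r1] by blast
  obtain C3 r3 where 3: "0 < C3" "\<And>x. x \<in> carrier E \<Longrightarrow> psp_norm \<alpha> r2 (\<Phi> (star E x)) \<le> C3 * psp_norm \<alpha> r3 (\<Phi> x)"
    using star_bound[of r2] by blast
  have Tb: "s_norm N (T x \<xi>) \<le> C1 * C2 * psp_norm \<alpha> r2 (\<Phi> x)" if x: "x \<in> carrier E" and \<xi>: "\<xi> \<in> B" for x \<xi>
  proof -
    note s = s_boundedD[OF B(1) \<xi>]
    have m: "\<Phi> (x \<otimes> \<Psi> (\<rho> \<xi>)) \<in> psp_carrier \<alpha>" by (simp add: \<Phi>_psp mult_closed x \<Psi>_carrier \<rho>_s s)
    have "s_norm N (T x \<xi>) \<le> C1 * psp_norm \<alpha> r1 (\<Phi> (x \<otimes> \<Psi> (\<rho> \<xi>)))" unfolding T_apply[OF s] by (rule 1(2)[OF m])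
    also have "\<dots> \<le> C1 * (C2 * psp_norm \<alpha> r2 (\<Phi> x))"
      using 1(1) by (intro mult_left_mono 2(2) x imageI \<xi>) auto
    finally show ?thesis by simp
  qed
  have "lstar_seminorm N B (T x) \<le> C1 * C2 * (1 + C3) * psp_norm \<alpha> (max r2 r3) (\<Phi> x)" if x: "x \<in> carrier E" for x
  proof -
    define n where "n = psp_norm \<alpha> (max r2 r3) (\<Phi> x)"
    have n0: "0 \<le> n" using \<Phi>_psp[OF x] by (simp add: n_def)
    have n2: "psp_norm \<alpha> r2 (\<Phi> x) \<le> n" and n3: "psp_norm \<alpha> r3 (\<Phi> x) \<le> n"
      unfolding n_def by (intro psp_norm_mono[OF \<Phi>_psp[OF x] pos]; simp)+
    have c12: "0 < C1 * C2" using 1(1) 2(1) by simp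
    show ?thesis
      unfolding n_def[symmetric]
    proof (rule lstar_seminorm_least[OF B(2)])
      fix \<xi> assume \<xi>: "\<xi> \<in> B"
      have "s_norm N (T x \<xi>) \<le> C1 * C2 * n"
        using Tb[OF x \<xi>] mult_left_mono[OF n2, of "C1 * C2"] c12 by linarith
      also have "\<dots> \<le> C1 * C2 * (1 + C3) * n"
        using c12 3(1) n0 by (intro mult_right_mono) (auto simp: mult_le_cancel_left1)
      finally show "s_norm N (T x \<xi>) \<le> C1 * C2 * (1 + C3) * n" .
      have "psp_norm \<alpha> r2 (\<Phi> (star E x)) \<le> C3 * n"
        using 3(2)[OF x] mult_left_mono[OF n3, of C3] 3(1) by linarith
      also have "\<dots> \<le> (1 + C3) * n" using n0 by (simp add: algebra_simps)
      finally have "C1 * C2 * psp_norm \<alpha> r2 (\<Phi> (star E x)) \<le> C1 * C2 * ((1 + C3) * n)"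
        using c12 by (intro mult_left_mono) auto
      then show "s_norm N (adjoint_op (T x) \<xi>) \<le> C1 * C2 * (1 + C3) * n"
        using Tb[OF star_closed[OF x] \<xi>] T_lstar(2)[OF x s_boundedD[OF B(1) \<xi>]] by (simp add: mult.assoc)
    qed
  qed
  then show ?thesis by blast
qed

text \<open>A bounded set with one point suffices, since \<open>R\<close> evaluates operators at a
  single vector.\<close>

lemma R_bound:
  assumes X: "X \<in> lstar_carrier"
  shows "psp_norm \<alpha> q (\<Phi> (R X)) \<le> lstar_seminorm q {\<iota> (\<Phi> \<one>)} X"
proof -
  have u: "\<iota> (\<Phi> \<one>) \<in> s_space" by (simp add: \<iota>_psp \<Phi>_psp one_closed)
  have "psp_norm \<alpha> q (\<Phi> (R X)) = psp_norm \<alpha> q (\<rho> (X (\<iota> (\<Phi> \<one>))))"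
    by (simp add: R_def \<Phi>_\<Psi> \<rho>_s lstar_apply[OF X u])
  also have "\<dots> \<le> s_norm q (X (\<iota> (\<Phi> \<one>)))" by (rule \<rho>_bound[OF lstar_apply[OF X u]])
  also have "\<dots> \<le> lstar_seminorm q {\<iota> (\<Phi> \<one>)} X"
    by (rule lstar_seminorm_upper(1)[OF X s_bounded_singleton[OF u]]) simp
  finally show ?thesis .
qed

lemma unit_seminorm: "lstar_seminorm q {\<iota> (\<Phi> \<one>)} \<in> lstar_seminorms"
  using s_bounded_singleton[OF \<iota>_psp[OF \<Phi>_psp[OF one_closed]]] by blast

lemma continuous_T: "continuous_map (topol E) (topol lstar) T"
proof (rule continuous_map_of_seminorm_bounds[OF seminormed_E seminormed_space_lstar clinear_T])
  fix p assume "p \<in> lstar_seminorms"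
  then obtain N B where p: "p = lstar_seminorm N B" "s_bounded B" "B \<noteq> {}" by blast
  obtain C r where "\<forall>x\<in>carrier E. lstar_seminorm N B (T x) \<le> C * psp_norm \<alpha> r (\<Phi> x)"
    using T_bound[OF p(2,3)] by blast
  then show "\<exists>pa\<in>(\<lambda>q x. q (\<Phi> x)) ` range (psp_norm \<alpha>). \<exists>C. \<forall>x\<in>carrier E. p (T x) \<le> C * pa x"
    unfolding p(1) by (intro bexI[of _ "\<lambda>x. psp_norm \<alpha> r (\<Phi> x)"] exI[of _ C]) auto
qed

lemma continuous_R: "continuous_map (topol lstar) (topol E) R"
proof (rule continuous_map_of_seminorm_bounds[OF seminormed_space_lstar seminormed_E clinear_R])
  fix p assume "p \<in> (\<lambda>q x. q (\<Phi> x)) ` range (psp_norm \<alpha>)"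
  then obtain q where p: "p = (\<lambda>x. psp_norm \<alpha> q (\<Phi> x))" by blast
  have "\<forall>X\<in>carrier lstar. p (R X) \<le> 1 * lstar_seminorm q {\<iota> (\<Phi> \<one>)} X" using R_bound by (simp add: p)
  then show "\<exists>pa\<in>lstar_seminorms. \<exists>C. \<forall>x\<in>carrier lstar. p (R x) \<le> C * pa x" using unit_seminorm by blast
qed

lemma star_subalgebra_T: "star_subalgebra (T ` carrier E) lstar"
  unfolding star_subalgebra_def
proof (intro conjI ballI allI)
  show "T ` carrier E \<subseteq> carrier lstar" using T_lstar(1) by auto
  show "\<zero>\<^bsub>lstar\<^esub> \<in> T ` carrier E" using T_zero zero_closed by (metis imageI)
next
  fix X Y assume "X \<in> T ` carrier E" "Y \<in> T ` carrier E"
  then obtain x y where xy: "x \<in> carrier E" "y \<in> carrier E" "X = T x" "Y = T y" by blast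
  show "X \<oplus>\<^bsub>lstar\<^esub> Y \<in> T ` carrier E" unfolding xy(3,4) using T_add[OF xy(1,2)] xy(1,2) by (metis a_closed imageI)
  show "X \<otimes>\<^bsub>lstar\<^esub> Y \<in> T ` carrier E" unfolding xy(3,4) using T_mult[OF xy(1,2)] mult_closed[OF xy(1,2)] by (metis imageI)
next
  fix c X assume "X \<in> T ` carrier E"
  then obtain x where x: "x \<in> carrier E" "X = T x" by blast
  show "c \<odot>\<^bsub>lstar\<^esub> X \<in> T ` carrier E" unfolding x(2) T_smult[OF x(1), symmetric] using x(1) by (intro imageI smult_closed) auto
next
  fix X assume "X \<in> T ` carrier E"
  then obtain x where x: "x \<in> carrier E" "X = T x" by blast
  show "star lstar X \<in> T ` carrier E" unfolding x(2) T_star[OF x(1), symmetric] by (intro imageI star_closed x(1))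
qed

lemma complemented_T: "complemented_in (T ` carrier E) lstar"
  unfolding complemented_in_def
proof (intro exI[of _ "\<lambda>X. T (R X)"] conjI ballI)
  have R: "R X \<in> carrier E" "R (X \<oplus>\<^bsub>lstar\<^esub> Y) = R X \<oplus> R Y" "R (c \<odot>\<^bsub>lstar\<^esub> X) = c \<odot> R X"
    if "X \<in> carrier lstar" "Y \<in> carrier lstar" for X Y c
    using clinear_R that unfolding clinear_map_def by blast+
  show "clinear_map lstar lstar (\<lambda>X. T (R X))"
    unfolding clinear_map_def
    using R T_lstar(1) T_add T_smult by (simp del: lstar_sel(4,5))
  show "continuous_map (topol lstar) (topol lstar) (\<lambda>X. T (R X))"
    using continuous_map_compose[OF continuous_R continuous_T] by (simp add: o_def)
  show "T (R (T (R X))) = T (R X)" if "X \<in> carrier lstar" for X using R(1)[OF that that] by (simp add: R_T)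
  show "(\<lambda>X. T (R X)) ` carrier lstar = T ` carrier E"
  proof (intro equalityI subsetI)
    fix Y assume "Y \<in> T ` carrier E"
    then obtain x where x: "x \<in> carrier E" "Y = T x" by blast
    then have "Y = T (R Y)" "Y \<in> carrier lstar" by (simp_all add: R_T T_lstar(1))
    then show "Y \<in> (\<lambda>X. T (R X)) ` carrier lstar" by blast
  qed (use R(1) in blast)
qed

text \<open>Injectivity and openness onto the image are both due to the continuous left inverse
  \<open>R\<close>.\<close>

lemma isomorphic_T: "star_algebra_isomorphic E (subalgebra_of lstar (T ` carrier E))"
  unfolding star_algebra_isomorphic_def
proof (intro exI[of _ T] conjI ballI)
  show "tvs_isomorphism E (subalgebra_of lstar (T ` carrier E)) T"
    unfolding tvs_isomorphism_def subalgebra_of_sel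
  proof (intro conjI)
    show "clinear_map E (subalgebra_of lstar (T ` carrier E)) T"
      unfolding clinear_map_def subalgebra_of_sel using T_add T_smult by blast
    have "inj_on T (carrier E)" by (rule inj_on_inverseI[where g=R]) (rule R_T)
    then show "bij_betw T (carrier E) (T ` carrier E)" by (simp add: bij_betw_def)
    have "homeomorphic_maps (topol E) (subtopology (topol lstar) (T ` carrier E)) T R"
      unfolding homeomorphic_maps_def
    proof (intro conjI ballI)
      show "continuous_map (topol E) (subtopology (topol lstar) (T ` carrier E)) T"
        unfolding continuous_map_in_subtopology using continuous_T topspace_eq by auto
      show "continuous_map (subtopology (topol lstar) (T ` carrier E)) (topol E) R"
        by (rule continuous_map_from_subtopology[OF continuous_R])
      show "R (T x) = x" if "x \<in> topspace (topol E)" for x using that by (simp add: topspace_eq R_T)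
      show "T (R X) = X" if "X \<in> topspace (subtopology (topol lstar) (T ` carrier E))" for X
        using that R_T by auto
    qed
    then show "homeomorphic_map (topol E) (subtopology (topol lstar) (T ` carrier E)) T"
      using homeomorphic_map_maps by blast
  qed
qed (simp_all add: T_mult T_star del: lstar_sel)

end


section \<open>The equivalence\<close>

lemma (in dominated_psp) tvs_isomorphism_A: "tvs_isomorphism (power_series_space \<alpha>) (power_series_space \<alpha>) A"
proof -
  note sn = seminormed_space_psp[OF pos]
  interpret P: seminormed_space "power_series_space \<alpha>" "range (psp_norm \<alpha>)" by (rule sn)
  have cA: "clinear_map (power_series_space \<alpha>) (power_series_space \<alpha>) A"
    unfolding clinear_map_def psp_sel using A_psp A_add A_scale by blast
  have cB: "clinear_map (power_series_space \<alpha>) (power_series_space \<alpha>) B"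
    unfolding clinear_map_def psp_sel using B_psp B_add B_scale by blast
  have "continuous_map (topol (power_series_space \<alpha>)) (topol (power_series_space \<alpha>)) A"
  proof (rule continuous_map_of_seminorm_bounds[OF sn sn cA])
    fix p assume "p \<in> range (psp_norm \<alpha>)"
    then obtain q where p: "p = psp_norm \<alpha> q" by blast
    obtain C r where "\<forall>\<xi>\<in>psp_carrier \<alpha>. psp_norm \<alpha> q (A \<xi>) \<le> C * psp_norm \<alpha> r \<xi>" using A_bound[of q] by blast
    then show "\<exists>pa\<in>range (psp_norm \<alpha>). \<exists>C. \<forall>x\<in>carrier (power_series_space \<alpha>). p (A x) \<le> C * pa x"
      unfolding p psp_sel(1) by (intro bexI[of _ "psp_norm \<alpha> r"] exI[of _ C]) auto
  qed
  moreover have "continuous_map (topol (power_series_space \<alpha>)) (topol (power_series_space \<alpha>)) B"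
  proof (rule continuous_map_of_seminorm_bounds[OF sn sn cB])
    fix p assume "p \<in> range (psp_norm \<alpha>)"
    then obtain q where p: "p = psp_norm \<alpha> q" by blast
    obtain C r where "\<forall>\<xi>\<in>psp_carrier \<alpha>. psp_norm \<alpha> q (B \<xi>) \<le> C * psp_norm \<alpha> r \<xi>" using B_bound[of q] by blast
    then show "\<exists>pa\<in>range (psp_norm \<alpha>). \<exists>C. \<forall>x\<in>carrier (power_series_space \<alpha>). p (B x) \<le> C * pa x"
      unfolding p psp_sel(1) by (intro bexI[of _ "psp_norm \<alpha> r"] exI[of _ C]) auto
  qed
  ultimately have "homeomorphic_maps (topol (power_series_space \<alpha>)) (topol (power_series_space \<alpha>)) A B"
    unfolding homeomorphic_maps_def P.topspace_carrier psp_sel(1) using A_B B_A by blast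
  then have "homeomorphic_map (topol (power_series_space \<alpha>)) (topol (power_series_space \<alpha>)) A"
    using homeomorphic_map_maps by blast
  moreover have "bij_betw A (psp_carrier \<alpha>) (psp_carrier \<alpha>)"
    by (rule bij_betw_byWitness[where f'=B]) (use A_B B_A A_psp B_psp in auto)
  ultimately show ?thesis unfolding tvs_isomorphism_def psp_sel(1) using cA by blast
qed

lemma tvs_isomorphism_compose:
  assumes "tvs_isomorphism U V f" "tvs_isomorphism V W g"
  shows "tvs_isomorphism U W (\<lambda>x. g (f x))"
  using assms homeomorphic_map_compose[of "topol U" "topol V" f "topol W" g]
    bij_betw_trans[of f "carrier U" "carrier V" g "carrier W"]
  unfolding tvs_isomorphism_def clinear_map_def o_def by (auto simp: Pi_iff)

text \<open>The scalar product is transported to the power series space along the given isomorphism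
  \<open>\<Phi>0\<close>. Composing \<open>\<Phi>0\<close> with the automorphism \<open>A\<close>
  then gives the isomorphism under which it is the product of l2.\<close>

lemma DN_imp_l2_represented:
  fixes E :: "('a, 'm) star_tvs_scheme"
  assumes E: "unital_commutative_frechet_star_algebra E" and DN: "DN_algebra E"
    and \<alpha>: "\<And>j. 0 \<le> \<alpha> j" "incseq \<alpha>" and nuc: "nuclear_space (power_series_space \<alpha>)"
    and iso: "tvs_isomorphism E (power_series_space \<alpha>) \<Phi>0"
  shows "\<exists>\<Phi> k. l2_represented E \<alpha> \<Phi> k"
proof -
  interpret E: unital_commutative_frechet_star_algebra E by fact
  obtain k where k: "summable (\<lambda>j. exp (- real k * \<alpha> j))" using nuclear_imp_summable[OF \<alpha>(1) nuc] by blast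
  \<comment> \<open>Squared norms call for the doubled exponent, which follows by comparison as
    \<alpha> is nonnegative.\<close>
  have summ: "summable (\<lambda>j. exp (- 2 * real k * \<alpha> j))"
  proof (rule summable_comparison_test'[OF k, of 0])
    fix j
    have "0 \<le> real k * \<alpha> j" using \<alpha>(1) by simp
    then show "norm (exp (- 2 * real k * \<alpha> j)) \<le> exp (- real k * \<alpha> j)" by simp
  qed
  have \<Phi>0_psp: "\<Phi>0 x \<in> psp_carrier \<alpha>" if "x \<in> carrier E" for x
    using iso that unfolding tvs_isomorphism_def clinear_map_def psp_sel by auto
  have \<Phi>0_add: "\<Phi>0 (x \<oplus>\<^bsub>E\<^esub> y) = (\<lambda>j. \<Phi>0 x j + \<Phi>0 y j)" if "x \<in> carrier E" "y \<in> carrier E" for x y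
    using iso that unfolding tvs_isomorphism_def clinear_map_def psp_sel by auto
  have \<Phi>0_smult: "\<Phi>0 (c \<odot>\<^bsub>E\<^esub> x) = (\<lambda>j. c * \<Phi>0 x j)" if "x \<in> carrier E" for x c
    using iso that unfolding tvs_isomorphism_def clinear_map_def psp_sel by auto
  have bij: "bij_betw \<Phi>0 (carrier E) (psp_carrier \<alpha>)" using iso unfolding tvs_isomorphism_def psp_sel by simp
  define \<Psi>0 where "\<Psi>0 = inv_into (carrier E) \<Phi>0"
  have \<Psi>0: "\<Psi>0 \<xi> \<in> carrier E" "\<Phi>0 (\<Psi>0 \<xi>) = \<xi>" if "\<xi> \<in> psp_carrier \<alpha>" for \<xi>
    using bij_betw_inv_into_right[OF bij that] bij_betw_imp_surj_on[OF bij] that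
    unfolding \<Psi>0_def by (auto intro: inv_into_into)
  have \<Psi>0\<Phi>0: "\<Psi>0 (\<Phi>0 x) = x" if "x \<in> carrier E" for x
    unfolding \<Psi>0_def by (rule bij_betw_inv_into_left[OF bij that])
  have \<Psi>0_add: "\<Psi>0 (\<lambda>j. \<xi> j + \<eta> j) = \<Psi>0 \<xi> \<oplus>\<^bsub>E\<^esub> \<Psi>0 \<eta>" if "\<xi> \<in> psp_carrier \<alpha>" "\<eta> \<in> psp_carrier \<alpha>" for \<xi> \<eta>
    using \<Psi>0\<Phi>0[of "\<Psi>0 \<xi> \<oplus>\<^bsub>E\<^esub> \<Psi>0 \<eta>"] \<Psi>0 that by (simp add: \<Phi>0_add)
  have \<Psi>0_scale: "\<Psi>0 (\<lambda>j. c * \<xi> j) = c \<odot>\<^bsub>E\<^esub> \<Psi>0 \<xi>" if "\<xi> \<in> psp_carrier \<alpha>" for \<xi> c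
    using \<Psi>0\<Phi>0[of "c \<odot>\<^bsub>E\<^esub> \<Psi>0 \<xi>"] \<Psi>0 that by (simp add: \<Phi>0_smult)
  interpret S: seminormed_space E "(\<lambda>q x. q (\<Phi>0 x)) ` range (psp_norm \<alpha>)"
    by (rule seminormed_space_via_psp[OF \<alpha>(1) E.module_axioms E.topspace_eq iso])
  obtain ip0 where sp: "scalar_product E ip0" and dn: "dominating_norm E (\<lambda>x. sqrt (Re (ip0 x x)))"
    and adj: "\<And>x y z. x \<in> carrier E \<Longrightarrow> y \<in> carrier E \<Longrightarrow> z \<in> carrier E \<Longrightarrow>
      ip0 (x \<otimes>\<^bsub>E\<^esub> y) z = ip0 y (star E x \<otimes>\<^bsub>E\<^esub> z)"
    using DN unfolding DN_algebra_def by blast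
  define nm where "nm x = sqrt (Re (ip0 x x))" for x
  obtain p C where p: "p \<in> (\<lambda>q x. q (\<Phi>0 x)) ` range (psp_norm \<alpha>)" "C > 0"
    "\<And>x. x \<in> carrier E \<Longrightarrow> nm x \<le> C * p x"
  proof (rule S.continuous_seminormD)
    show "continuous_seminorm E nm"
      using dn unfolding dominating_norm_def continuous_norm_def nm_def by blast
  qed blast
  obtain p0 where p0: "p = (\<lambda>x. psp_norm \<alpha> p0 (\<Phi>0 x))" using p(1) by blast
  have nm_bound: "nm x \<le> C * psp_norm \<alpha> p0 (\<Phi>0 x)" if "x \<in> carrier E" for x using p(3)[OF that] by (simp add: p0)
  obtain P where P: "fundamental_system E P"
    "\<And>q. \<exists>r. \<exists>C>0. \<forall>x\<in>carrier E. (P q x)\<^sup>2 \<le> C * nm x * P r x"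
    using dn unfolding dominating_norm_def nm_def by blast
  have nm0: "0 \<le> nm x" if "x \<in> carrier E" for x
    using dn that unfolding dominating_norm_def continuous_norm_def continuous_seminorm_def seminorm_on_def nm_def by blast
  have Pc: "continuous_seminorm E (P m)" for m using P(1) unfolding fundamental_system_def by blast
  \<comment> \<open>Domination is given for some fundamental system \<open>P\<close>. Each norm of
    the power series space is bounded by a multiple of some \<open>P m\<close>, and each
    \<open>P r\<close> by a multiple of such a norm, so the inequality passes to these
    norms.\<close>
  have dom: "\<exists>C r. 0 < C \<and> (\<forall>x\<in>carrier E. (psp_norm \<alpha> q (\<Phi>0 x))\<^sup>2 \<le> C * nm x * psp_norm \<alpha> r (\<Phi>0 x))" for q
  proof -
    have sq: "seminorm_on E (\<lambda>x. psp_norm \<alpha> q (\<Phi>0 x))" by (rule S.seminorms) blast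
    have "continuous_seminorm E (\<lambda>x. psp_norm \<alpha> q (\<Phi>0 x))"
      by (rule S.continuous_seminormI[OF sq, of "\<lambda>x. psp_norm \<alpha> q (\<Phi>0 x)" 1]) auto
    then have c: "continuous_map (topol E) euclideanreal (\<lambda>x. psp_norm \<alpha> q (\<Phi>0 x))" by (simp add: continuous_seminorm_def)
    define U where "U = {x \<in> topspace (topol E). psp_norm \<alpha> q (\<Phi>0 x) \<in> {..<1}}"
    have "openin (topol E) U"
      unfolding U_def by (rule openin_continuous_map_preimage[OF c]) (simp del: lessThan_iff)
    moreover have "\<zero>\<^bsub>E\<^esub> \<in> U" using S.seminorm_zero[OF sq] by (simp add: U_def E.topspace_eq)
    ultimately obtain m e where e: "e > 0" "{x \<in> carrier E. P m x < e} \<subseteq> U"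
      using P(1) unfolding fundamental_system_def by meson
    have sPm: "seminorm_on E (P m)" using Pc by (simp add: continuous_seminorm_def)
    have 1: "psp_norm \<alpha> q (\<Phi>0 x) \<le> (1 / e) * P m x" if "x \<in> carrier E" for x
      by (rule S.seminorm_le_of_small[OF sq sPm e(1) _ that]) (use e(2) in \<open>auto simp: U_def\<close>)
    obtain r D where D: "D > 0" "\<And>x. x \<in> carrier E \<Longrightarrow> (P m x)\<^sup>2 \<le> D * nm x * P r x" using P(2)[of m] by blast
    obtain p' D' where p': "p' \<in> (\<lambda>q x. q (\<Phi>0 x)) ` range (psp_norm \<alpha>)" "D' > 0"
      "\<And>x. x \<in> carrier E \<Longrightarrow> P r x \<le> D' * p' x"
      by (rule S.continuous_seminormD[OF Pc[of r]]) blast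
    obtain r' where r': "p' = (\<lambda>x. psp_norm \<alpha> r' (\<Phi>0 x))" using p'(1) by blast
    have "(psp_norm \<alpha> q (\<Phi>0 x))\<^sup>2 \<le> ((1 / e)\<^sup>2 * D * D') * nm x * psp_norm \<alpha> r' (\<Phi>0 x)" if x: "x \<in> carrier E" for x
    proof -
      have "(psp_norm \<alpha> q (\<Phi>0 x))\<^sup>2 \<le> ((1 / e) * P m x)\<^sup>2" by (rule power_mono[OF 1[OF x]]) (simp add: \<Phi>0_psp x)
      also have "\<dots> = (1 / e)\<^sup>2 * (P m x)\<^sup>2" by (rule power_mult_distrib)
      also have "\<dots> \<le> (1 / e)\<^sup>2 * (D * nm x * (D' * psp_norm \<alpha> r' (\<Phi>0 x)))"
      proof (rule mult_left_mono)
        have "D * nm x * P r x \<le> D * nm x * (D' * psp_norm \<alpha> r' (\<Phi>0 x))"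
          using p'(3)[OF x] D(1) nm0[OF x] unfolding r' by (intro mult_left_mono) auto
        then show "(P m x)\<^sup>2 \<le> D * nm x * (D' * psp_norm \<alpha> r' (\<Phi>0 x))" using D(2)[OF x] by linarith
      qed simp
      finally show ?thesis by (simp add: mult_ac)
    qed
    moreover have "0 < (1 / e)\<^sup>2 * D * D'" using e(1) D(1) p'(2) by simp
    ultimately show ?thesis by blast
  qed
  define ip where "ip \<xi> \<eta> = ip0 (\<Psi>0 \<xi>) (\<Psi>0 \<eta>)" for \<xi> \<eta>
  interpret I: inner_product_module E ip0 by unfold_locales (rule sp)
  have ip_sp: "scalar_product (power_series_space \<alpha>) ip"
    unfolding scalar_product_def linear_functional_def psp_sel
  proof (intro conjI ballI allI impI)
    fix \<xi> assume \<xi>: "\<xi> \<in> psp_carrier \<alpha>" "\<xi> \<noteq> (\<lambda>_. 0)"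
    have "\<Psi>0 \<xi> \<noteq> \<zero>\<^bsub>E\<^esub>"
    proof
      assume 0: "\<Psi>0 \<xi> = \<zero>\<^bsub>E\<^esub>"
      have "\<Phi>0 \<zero>\<^bsub>E\<^esub> = (\<lambda>j. 0)" using \<Phi>0_smult[of "\<zero>\<^bsub>E\<^esub>" 0] E.smult_l_null[of "\<zero>\<^bsub>E\<^esub>"] by simp
      then show False using \<Psi>0(2)[OF \<xi>(1)] 0 \<xi>(2) by simp
    qed
    then show "0 < Re (ip \<xi> \<xi>)" unfolding ip_def by (rule I.ip_pos[OF \<Psi>0(1)[OF \<xi>(1)]])
  next
    fix \<xi> \<eta> assume "\<xi> \<in> psp_carrier \<alpha>" "\<eta> \<in> psp_carrier \<alpha>"
    then show "ip \<eta> \<xi> = cnj (ip \<xi> \<eta>)" unfolding ip_def by (intro I.ip_cnj \<Psi>0(1))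
  qed (auto simp: ip_def \<Psi>0_add \<Psi>0_scale I.ip_add_left I.ip_smult_left \<Psi>0(1))
  interpret D: dominated_psp \<alpha> ip k
  proof (intro dominated_psp.intro inner_product_module.intro inner_product_module_axioms.intro
      dominated_psp_axioms.intro module_power_series_space ip_sp \<alpha> summ)
    have "sqrt (Re (ip \<xi> \<xi>)) \<le> C * psp_norm \<alpha> p0 \<xi>" if "\<xi> \<in> psp_carrier \<alpha>" for \<xi>
      using nm_bound[OF \<Psi>0(1)[OF that]] by (simp add: nm_def ip_def \<Psi>0(2)[OF that])
    then show "\<exists>C p. 0 < C \<and> (\<forall>\<xi>\<in>psp_carrier \<alpha>. sqrt (Re (ip \<xi> \<xi>)) \<le> C * psp_norm \<alpha> p \<xi>)" using p(2) by blast
    fix q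
    obtain C' r where C': "0 < C'" "\<And>x. x \<in> carrier E \<Longrightarrow> (psp_norm \<alpha> q (\<Phi>0 x))\<^sup>2 \<le> C' * nm x * psp_norm \<alpha> r (\<Phi>0 x)"
      using dom[of q] by blast
    have "(psp_norm \<alpha> q \<xi>)\<^sup>2 \<le> C' * sqrt (Re (ip \<xi> \<xi>)) * psp_norm \<alpha> r \<xi>" if "\<xi> \<in> psp_carrier \<alpha>" for \<xi>
      using C'(2)[OF \<Psi>0(1)[OF that]] by (simp add: nm_def ip_def \<Psi>0(2)[OF that])
    then show "\<exists>C r. 0 < C \<and> (\<forall>\<xi>\<in>psp_carrier \<alpha>. (psp_norm \<alpha> q \<xi>)\<^sup>2 \<le> C * sqrt (Re (ip \<xi> \<xi>)) * psp_norm \<alpha> r \<xi>)"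
      using C'(1) by blast
  qed
  have "l2_represented E \<alpha> (\<lambda>x. D.A (\<Phi>0 x)) k"
  proof (intro l2_represented.intro l2_represented_axioms.intro E \<alpha> summ tvs_isomorphism_compose[OF iso D.tvs_isomorphism_A])
    fix x y z assume x: "x \<in> carrier E" and y: "y \<in> carrier E" and z: "z \<in> carrier E"
    have "l2_inner (D.A (\<Phi>0 a)) (D.A (\<Phi>0 b)) = ip0 a b" if "a \<in> carrier E" "b \<in> carrier E" for a b
      using D.A_isometry[OF \<Phi>0_psp[OF that(1)] \<Phi>0_psp[OF that(2)]] that by (simp add: ip_def \<Psi>0\<Phi>0)
    then show "l2_inner (D.A (\<Phi>0 (x \<otimes>\<^bsub>E\<^esub> y))) (D.A (\<Phi>0 z)) =
        l2_inner (D.A (\<Phi>0 y)) (D.A (\<Phi>0 (star E x \<otimes>\<^bsub>E\<^esub> z)))"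
      using adj[OF x y z] x y z by (simp add: E.mult_closed E.star_closed)
  qed
  then show ?thesis by blast
qed

lemma lstar_embedded_imp_DN:
  assumes E: "unital_commutative_frechet_star_algebra E"
    and S: "star_subalgebra S lstar" and iso: "star_algebra_isomorphic E (subalgebra_of lstar S)"
  shows "DN_algebra E"
proof -
  obtain f where f: "tvs_isomorphism E (subalgebra_of lstar S) f"
    "\<And>x y. x \<in> carrier E \<Longrightarrow> y \<in> carrier E \<Longrightarrow> f (x \<otimes>\<^bsub>E\<^esub> y) = f x \<otimes>\<^bsub>subalgebra_of lstar S\<^esub> f y"
    "\<And>x. x \<in> carrier E \<Longrightarrow> f (star E x) = star (subalgebra_of lstar S) (f x)"
    using iso unfolding star_algebra_isomorphic_def by blast
  have "lstar_embedded E S f"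
    by (intro lstar_embedded.intro lstar_embedded_axioms.intro E S f(1)) (use f(2,3) in simp_all)
  then show ?thesis by (rule lstar_embedded.DN_algebra_E)
qed

lemma DN_imp_complemented:
  assumes E: "unital_commutative_frechet_star_algebra E" and DN: "DN_algebra E"
    and \<alpha>: "\<And>j. 0 \<le> \<alpha> j" "incseq \<alpha>" and nuc: "nuclear_space (power_series_space \<alpha>)"
    and iso: "tvs_isomorphic E (power_series_space \<alpha>)"
  shows "\<exists>S. star_subalgebra S lstar \<and> complemented_in S lstar \<and>
    star_algebra_isomorphic E (subalgebra_of lstar S)"
proof -
  obtain \<Phi> k where "l2_represented E \<alpha> \<Phi> k"
    using DN_imp_l2_represented[OF E DN \<alpha> nuc] iso unfolding tvs_isomorphic_def by blast
  then interpret l2_represented E \<alpha> \<Phi> k .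
  show ?thesis using star_subalgebra_T complemented_T isomorphic_T by blast
qed

theorem theorem3p5:
  fixes E :: "'a star_tvs" and \<alpha> :: "nat \<Rightarrow> real"
  assumes "unital_commutative_frechet_star_algebra E"
    and "\<And>j. 0 < \<alpha> j" and "incseq \<alpha>" and "filterlim \<alpha> at_top sequentially"
    and "nuclear_space (power_series_space \<alpha>)"
    and "tvs_isomorphic E (power_series_space \<alpha>)"
  shows "((\<exists>S. star_subalgebra S lstar \<and> complemented_in S lstar \<and>
               star_algebra_isomorphic E (subalgebra_of lstar S)) \<longleftrightarrow>
          (\<exists>S. star_subalgebra S lstar \<and> closedin (topol lstar) S \<and>
               star_algebra_isomorphic E (subalgebra_of lstar S))) \<and>
         ((\<exists>S. star_subalgebra S lstar \<and> closedin (topol lstar) S \<and>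
               star_algebra_isomorphic E (subalgebra_of lstar S)) \<longleftrightarrow>
          DN_algebra E)"
  \<comment> \<open>The cycle of implications from (i) to (ii) to (iii) to (i).\<close>
  using complemented_in_lstar_closed lstar_embedded_imp_DN[OF assms(1)]
    DN_imp_complemented[OF assms(1) _ less_imp_le[OF assms(2)] assms(3,5,6)]
  by blast

end
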